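(* Let $\mathcal{S}$ be a family of dendric return morphisms from $\mathcal{A}^*$ to $\mathcal{A}^*$, fix two distinct letters $a,b\in\mathcal{A}$, and let $X$ be a shift space having an $\mathcal{S}$-adic representation $\boldsymbol\sigma=(\sigma_n)_{n\ge0}$. Then $X$ is the natural coding of a regular interval exchange transformation if and only if $\boldsymbol\sigma$ is primitive and labels an infinite path in the graph $\mathcal{G}_{IET}(\mathcal{S})$. Moreover, if this path starts at the vertex $(\le^L,\le^R)$, then $X$ is the natural coding of a regular interval exchange transformation for the pair of orders with top order $\le^R$ and bottom order $\le^L$.
   Context: Shift spaces, languages, extension sets $E_F^L(w),E_F^R(w),E_F(w)$, extension graphs, dendricity, return morphisms, $\sigma$-initial factors, $\mathcal{L}(\sigma)$, dendric return morphisms, $\mathcal{T}^L(\sigma),\mathcal{T}^R(\sigma)$, $\varphi^L_{\sigma,s},\varphi^R_{\sigma,p}$, multi-cliques, left/right valid triplets, $\mathcal{S}$-adic representations, primitivity and labeled infinite paths are as follows. [A finite alphabet $\mathcal{A}$, $|\mathcal{A}|\ge2$; a shift space is a nonempty closed shift-invariant $X\subseteq\mathcal{A}^{\mathbb{Z}}$; $E^L_F(w)=\{c:cw\in F\}$, $E^R_F(w)=\{c:wc\in F\}$, $E_F(w)=\{(c,d):cwd\in F\}$; a return morphism for $w$ is an injective non-erasing morphism $\sigma$ with $\sigma(c)w$ containing exactly two occurrences of $w$, as proper prefix and proper suffix, for each letter $c$, $w$ being of maximal length if unspecified; $\mathcal{A}^L_{\sigma,s}=\{c:\sigma(c)\in\mathcal{A}^+s\}$,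 $\mathcal{A}^R_{\sigma,p}=\{c:\sigma(c)w\in p\mathcal{A}^+\}$; $\varphi^L_{\sigma,s}(c)$ is the letter $c'$ with $\sigma(c)\in\mathcal{A}^*c's$ and $\varphi^R_{\sigma,p}(c)$ the letter $c'$ with $\sigma(c)w\in pc'\mathcal{A}^*$; $\mathcal{T}^L(\sigma)$ (resp. $\mathcal{T}^R(\sigma)$) is the set of longest common suffixes of $\sigma(c),\sigma(d)$ (resp. longest common prefixes of $\sigma(c)w,\sigma(d)w$) over $c\ne d$; $\mathcal{L}(\sigma)$ is the set of factors of the $\sigma(c)w$ and $\sigma$-initial factors are those without occurrence of $w$; $\sigma$ is dendric if each $\sigma$-initial factor $u$ has $\mathcal{E}_{\mathcal{L}(\sigma)}(u)$ a tree. Multi-clique $G(\{C_1,\dots,C_k\})$: for each $i$ all pairs of distinct elements of $C_i$ joined by an edge of color $c_i$, colors distinct; acyclic for the coloring: every simple cycle is monochromatic; $G^L_{\sigma,s}$, $G^R_{\sigma,p}$ are the subgraphs induced by $\mathcal{A}^L_{\sigma,s}$, $\mathcal{A}^R_{\sigma,p}$; $\sigma^L(G)=G(\{\varphi^L_{\sigma,s}(C_i)\}_{i,s\in\mathcal{T}^L(\sigma)})$, $\sigma^R(G)=G(\{\varphi^R_{\sigma,p}(C_i)\}_{i,p\in\mathcal{T}^R(\sigma)})$; $(G',\sigma,G)$ is left (resp. right) valid if $G$ is a multi-clique acyclic for the coloring and connected, each $G^L_{\sigma,s}$, $s\in\mathcal{T}^L(\sigma)$ (resp. $G^R_{\sigma,p}$,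 $p\in\mathcal{T}^R(\sigma)$) is connected, and $G'=\sigma^L(G)$ (resp. $\sigma^R(G)$) is acyclic for the coloring and connected. $\mathcal{S}$-adic: $X=\{x: \mathcal{L}(x)\subseteq\mathcal{L}^{(0)}(\boldsymbol\sigma)\}$ where $\mathcal{L}^{(n)}(\boldsymbol\sigma)$ is the set of factors of the words $\sigma_n\cdots\sigma_{N-1}(c)$, $N>n$; primitive: for every $n$ there is $N>n$ with every letter occurring in every $\sigma_n\cdots\sigma_{N-1}(c)$.] Interval exchanges: given a pair of total orders on $\mathcal{A}$ with top order $\le_1$ and bottom order $\le_2$, an interval exchange transformation is a partition $\{I_c: c\in\mathcal{A}\}$ of $[0,1)$ into left-closed right-open intervals placed from left to right according to $\le_1$, together with a bijection $T:[0,1)\to[0,1)$ that is a translation on each $I_c$ and such that the images $T(I_c)$ are placed from left to right according to $\le_2$. It is regular if the orbits of the nonzero left endpoints of the $I_c$ are infinite and pairwise disjoint. Its natural coding is the set of $x\in\mathcal{A}^{\mathbb{Z}}$ such that for every factor $u_0\cdots u_{n-1}$ of $x$, $\bigcap_{0\le i<n}T^{-i}(I_{u_i})\ne\emptyset$. Planarity: for total orders $\le^L,\le^R$ on $\mathcal{A}$, a word $w$ of a factorial set $F$ is planar for $(\le^L,\le^R)$ if for all $(c_1,d_1),(c_2,d_2)\in E_F(w)$, $c_1<^L c_2$ implies $d_1\le^R d_2$. A return morphism $\sigma$ is $(\le^L,\le^R)$-planar if all its $\sigma$-initial factors are planar in $\mathcal{L}(\sigma)$ for $(\le^L,\le^R)$.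 A partial map $\varphi$ is order preserving from $\preceq$ to $\le$ if $x\prec y$ implies $\varphi(x)\le\varphi(y)$ for $x,y$ in its domain. $\sigma$ is planar preserving from $(\preceq^L,\preceq^R)$ to $(\le^L,\le^R)$ if every $\varphi^L_{\sigma,s}$, $s\in\mathcal{T}^L(\sigma)$, is order preserving from $\preceq^L$ to $\le^L$ and every $\varphi^R_{\sigma,p}$, $p\in\mathcal{T}^R(\sigma)$, is order preserving from $\preceq^R$ to $\le^R$. For a total order $\le$ with $c_1<\dots<c_n$, $G(\le)$ is the colored tree on $\mathcal{A}$ whose edges are $\{c_i,c_{i+1}\}$, $i<n$, each with its own color; $\le^*$ denotes the reverse order. A pair $(\le^L,\le^R)$ is irreducible if for no $0<k<|\mathcal{A}|$ are the $k$ smallest letters for $\le^L$ the same as the $k$ smallest letters for $\le^R$. The graph $\mathcal{G}_{IET}(\mathcal{S})$ (depending on the fixed letters $a,b$): its vertices are the irreducible pairs $(\le^L,\le^R)$ with $a<^Lb$, and there is an edge from $(\le^L,\le^R)$ to $(\preceq^L,\preceq^R)$ labeled $\sigma\in\mathcal{S}$ if (1) $(G(\le^L),\sigma,G(\preceq^L))$ is left valid; (2) $(G(\le^R),\sigma,G(\preceq^R))$ is right valid; (3) $\sigma$ is $(\le^L,\le^R)$-planar; (4) $\sigma$ is planar preserving from $(\preceq^L,\preceq^R)$ to $(\le^L,\le^R)$ or from $((\preceq^L)^*,(\preceq^R)^* )$ to $(\le^L,\le^R)$. *)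

theory Defs
  imports Complex_Main "HOL-Library.Multiset"
begin

section \<open>Words and morphisms\<close>

definition morph_app :: "('a \<Rightarrow> 'b list) \<Rightarrow> 'a list \<Rightarrow> 'b list" where
  "morph_app \<sigma> u = concat (map \<sigma> u)"

definition factors :: "'a list \<Rightarrow> 'a list set" where
  "factors u = {v. \<exists>p s. u = p @ v @ s}"

text \<open>Positions of the occurrences of w in u.\<close>
definition occ :: "'a list \<Rightarrow> 'a list \<Rightarrow> nat set" where
  "occ w u = {i. i + length w \<le> length u \<and> take (length w) (drop i u) = w}"

fun lcp :: "'a list \<Rightarrow> 'a list \<Rightarrow> 'a list" where
  "lcp (x # xs) (y # ys) = (if x = y then x # lcp xs ys else [])"
| "lcp _ _ = []"

definition lcs :: "'a list \<Rightarrow> 'a list \<Rightarrow> 'a list" where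
  "lcs u v = rev (lcp (rev u) (rev v))"

section \<open>Return morphisms\<close>

text \<open>sigma is a return morphism for w: injective, non-erasing, and for every letter c
  the word sigma(c) w has exactly two occurrences of w, as proper prefix and proper suffix.\<close>
definition return_for :: "('a \<Rightarrow> 'a list) \<Rightarrow> 'a list \<Rightarrow> bool" where
  "return_for \<sigma> w \<longleftrightarrow> inj (morph_app \<sigma>) \<and> (\<forall>c. \<sigma> c \<noteq> [])
     \<and> (\<forall>c. occ w (\<sigma> c @ w) = {0, length (\<sigma> c)})"

definition return_morphism :: "('a \<Rightarrow> 'a list) \<Rightarrow> bool" where
  "return_morphism \<sigma> \<longleftrightarrow> (\<exists>w. return_for \<sigma> w)"

text \<open>The word w of maximal length.\<close>
definition ret_word :: "('a \<Rightarrow> 'a list) \<Rightarrow> 'a list" where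
  "ret_word \<sigma> = (SOME w. return_for \<sigma> w \<and> (\<forall>v. return_for \<sigma> v \<longrightarrow> length v \<le> length w))"

definition AL :: "('a \<Rightarrow> 'a list) \<Rightarrow> 'a list \<Rightarrow> 'a set" where
  "AL \<sigma> s = {c. \<exists>u. u \<noteq> [] \<and> \<sigma> c = u @ s}"

definition AR :: "('a \<Rightarrow> 'a list) \<Rightarrow> 'a list \<Rightarrow> 'a set" where
  "AR \<sigma> p = {c. \<exists>u. u \<noteq> [] \<and> \<sigma> c @ ret_word \<sigma> = p @ u}"

definition phiL :: "('a \<Rightarrow> 'a list) \<Rightarrow> 'a list \<Rightarrow> 'a \<Rightarrow> 'a" where
  "phiL \<sigma> s c = \<sigma> c ! (length (\<sigma> c) - length s - 1)"

definition phiR :: "('a \<Rightarrow> 'a list) \<Rightarrow> 'a list \<Rightarrow> 'a \<Rightarrow> 'a" where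
  "phiR \<sigma> p c = (\<sigma> c @ ret_word \<sigma>) ! length p"

definition TL :: "('a \<Rightarrow> 'a list) \<Rightarrow> 'a list set" where
  "TL \<sigma> = {lcs (\<sigma> c) (\<sigma> d) | c d. c \<noteq> d}"

definition TR :: "('a \<Rightarrow> 'a list) \<Rightarrow> 'a list set" where
  "TR \<sigma> = {lcp (\<sigma> c @ ret_word \<sigma>) (\<sigma> d @ ret_word \<sigma>) | c d. c \<noteq> d}"

definition lang_morph :: "('a \<Rightarrow> 'a list) \<Rightarrow> 'a list set" where
  "lang_morph \<sigma> = (\<Union>c. factors (\<sigma> c @ ret_word \<sigma>))"

definition sigma_initial :: "('a \<Rightarrow> 'a list) \<Rightarrow> 'a list \<Rightarrow> bool" where
  "sigma_initial \<sigma> u \<longleftrightarrow> u \<in> lang_morph \<sigma> \<and> ret_word \<sigma> \<notin> factors u"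

section \<open>Extension graphs and dendricity\<close>

definition ext_L :: "'a list set \<Rightarrow> 'a list \<Rightarrow> 'a set" where
  "ext_L F w = {c. [c] @ w \<in> F}"

definition ext_R :: "'a list set \<Rightarrow> 'a list \<Rightarrow> 'a set" where
  "ext_R F w = {d. w @ [d] \<in> F}"

definition ext :: "'a list set \<Rightarrow> 'a list \<Rightarrow> ('a \<times> 'a) set" where
  "ext F w = {(c, d). [c] @ w @ [d] \<in> F}"

text \<open>Simple undirected graphs: vertex set V, edges given as two-element sets.\<close>
definition ug_connected :: "'v set \<Rightarrow> 'v set set \<Rightarrow> bool" where
  "ug_connected V E \<longleftrightarrow>
     (\<forall>x\<in>V. \<forall>y\<in>V. (x, y) \<in> {(p, q). {p, q} \<in> E \<and> p \<noteq> q}\<^sup>*)"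

text \<open>A (simple) cycle: at least 3 distinct vertices, consecutive ones (cyclically) adjacent.\<close>
definition ug_acyclic :: "'v set \<Rightarrow> 'v set set \<Rightarrow> bool" where
  "ug_acyclic V E \<longleftrightarrow>
     \<not> (\<exists>vs. length vs \<ge> 3 \<and> distinct vs \<and> set vs \<subseteq> V \<and>
           (\<forall>j < length vs. {vs ! j, vs ! ((j + 1) mod length vs)} \<in> E))"

definition ug_tree :: "'v set \<Rightarrow> 'v set set \<Rightarrow> bool" where
  "ug_tree V E \<longleftrightarrow> V \<noteq> {} \<and> ug_connected V E \<and> ug_acyclic V E"

text \<open>The extension graph of w in F: bipartite graph on disjoint copies of the left and right
  extension sets, with an edge between c and d iff (c,d) is in the extension set.\<close>
definition ext_graph_tree :: "'a list set \<Rightarrow> 'a list \<Rightarrow> bool" where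
  "ext_graph_tree F w \<longleftrightarrow>
     ug_tree (Inl ` ext_L F w \<union> Inr ` ext_R F w) {{Inl c, Inr d} | c d. (c, d) \<in> ext F w}"

definition dendric_morph :: "('a \<Rightarrow> 'a list) \<Rightarrow> bool" where
  "dendric_morph \<sigma> \<longleftrightarrow> (\<forall>u. sigma_initial \<sigma> u \<longrightarrow> ext_graph_tree (lang_morph \<sigma>) u)"

definition dendric_return_morphism :: "('a \<Rightarrow> 'a list) \<Rightarrow> bool" where
  "dendric_return_morphism \<sigma> \<longleftrightarrow> return_morphism \<sigma> \<and> dendric_morph \<sigma>"

section \<open>Multi-cliques\<close>

text \<open>A multi-clique G({C_1,...,C_k}) is represented by the multiset of its cliques
  (each occurrence of a clique carries its own colour).  Cliques with fewer than two elements
  contribute no edges.\<close>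

text \<open>Colour classes listed as xs (colour = index).  A simple cycle: k >= 2 distinct vertices
  and k pairwise distinct coloured edges joining consecutive vertices cyclically.\<close>
definition col_acyclic_list :: "'a set list \<Rightarrow> bool" where
  "col_acyclic_list xs \<longleftrightarrow>
    (\<forall>vs cs. let k = length vs in
       (k \<ge> 2 \<and> length cs = k \<and> distinct vs \<and>
        (\<forall>j<k. cs ! j < length xs \<and> vs ! j \<in> xs ! (cs ! j) \<and> vs ! ((j + 1) mod k) \<in> xs ! (cs ! j)) \<and>
        distinct (map (\<lambda>j. (cs ! j, {vs ! j, vs ! ((j + 1) mod k)})) [0..<k]))
       \<longrightarrow> (\<forall>j<k. cs ! j = cs ! 0))"

definition mc_acyclic :: "'a set multiset \<Rightarrow> bool" where
  "mc_acyclic M \<longleftrightarrow> (\<forall>xs. mset xs = M \<longrightarrow> col_acyclic_list xs)"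

definition mc_connected :: "'a set \<Rightarrow> 'a set multiset \<Rightarrow> bool" where
  "mc_connected V M \<longleftrightarrow>
     (\<forall>x\<in>V. \<forall>y\<in>V. (x, y) \<in> {(p, q). p \<noteq> q \<and> (\<exists>C\<in>#M. p \<in> C \<and> q \<in> C)}\<^sup>*)"

text \<open>Induced subgraph on V.\<close>
definition mc_induced :: "'a set \<Rightarrow> 'a set multiset \<Rightarrow> 'a set multiset" where
  "mc_induced V M = image_mset (\<lambda>C. C \<inter> V) M"

text \<open>Equality of coloured graphs (colours up to renaming).\<close>
definition mc_same :: "'a set multiset \<Rightarrow> 'a set multiset \<Rightarrow> bool" where
  "mc_same M N \<longleftrightarrow> filter_mset (\<lambda>C. 2 \<le> card C) M = filter_mset (\<lambda>C. 2 \<le> card C) N"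

definition sigmaL :: "('a \<Rightarrow> 'a list) \<Rightarrow> 'a set multiset \<Rightarrow> 'a set multiset" where
  "sigmaL \<sigma> G = (\<Sum>s\<in>TL \<sigma>. image_mset (\<lambda>C. phiL \<sigma> s ` (C \<inter> AL \<sigma> s)) G)"

definition sigmaR :: "('a \<Rightarrow> 'a list) \<Rightarrow> 'a set multiset \<Rightarrow> 'a set multiset" where
  "sigmaR \<sigma> G = (\<Sum>p\<in>TR \<sigma>. image_mset (\<lambda>C. phiR \<sigma> p ` (C \<inter> AR \<sigma> p)) G)"

definition left_valid :: "'a set multiset \<Rightarrow> ('a \<Rightarrow> 'a list) \<Rightarrow> 'a set multiset \<Rightarrow> bool" where
  "left_valid G' \<sigma> G \<longleftrightarrow>
     mc_acyclic G \<and> mc_connected UNIV G \<and>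
     (\<forall>s\<in>TL \<sigma>. mc_connected (AL \<sigma> s) (mc_induced (AL \<sigma> s) G)) \<and>
     mc_same G' (sigmaL \<sigma> G) \<and> mc_acyclic (sigmaL \<sigma> G) \<and> mc_connected UNIV (sigmaL \<sigma> G)"

definition right_valid :: "'a set multiset \<Rightarrow> ('a \<Rightarrow> 'a list) \<Rightarrow> 'a set multiset \<Rightarrow> bool" where
  "right_valid G' \<sigma> G \<longleftrightarrow>
     mc_acyclic G \<and> mc_connected UNIV G \<and>
     (\<forall>p\<in>TR \<sigma>. mc_connected (AR \<sigma> p) (mc_induced (AR \<sigma> p) G)) \<and>
     mc_same G' (sigmaR \<sigma> G) \<and> mc_acyclic (sigmaR \<sigma> G) \<and> mc_connected UNIV (sigmaR \<sigma> G)"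

section \<open>Orders, planarity\<close>

text \<open>Total orders on the alphabet are reflexive relations r with linear_order r; strict part:\<close>
definition lt :: "('a \<times> 'a) set \<Rightarrow> 'a \<Rightarrow> 'a \<Rightarrow> bool" where
  "lt r x y \<longleftrightarrow> (x, y) \<in> r \<and> x \<noteq> y"

definition order_graph :: "('a \<times> 'a) set \<Rightarrow> 'a set multiset" where
  "order_graph r = mset_set {{c, d} | c d. lt r c d \<and> \<not> (\<exists>e. lt r c e \<and> lt r e d)}"

definition planar_word :: "('a \<times> 'a) set \<Rightarrow> ('a \<times> 'a) set \<Rightarrow> 'a list set \<Rightarrow> 'a list \<Rightarrow> bool" where
  "planar_word rL rR F w \<longleftrightarrow>
     (\<forall>c1 d1 c2 d2. (c1, d1) \<in> ext F w \<and> (c2, d2) \<in> ext F w \<and> lt rL c1 c2 \<longrightarrow> (d1, d2) \<in> rR)"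

definition planar_morph :: "('a \<times> 'a) set \<Rightarrow> ('a \<times> 'a) set \<Rightarrow> ('a \<Rightarrow> 'a list) \<Rightarrow> bool" where
  "planar_morph rL rR \<sigma> \<longleftrightarrow> (\<forall>u. sigma_initial \<sigma> u \<longrightarrow> planar_word rL rR (lang_morph \<sigma>) u)"

definition order_preserving :: "'a set \<Rightarrow> ('a \<Rightarrow> 'a) \<Rightarrow> ('a \<times> 'a) set \<Rightarrow> ('a \<times> 'a) set \<Rightarrow> bool" where
  "order_preserving D \<phi> r1 r2 \<longleftrightarrow> (\<forall>x\<in>D. \<forall>y\<in>D. lt r1 x y \<longrightarrow> (\<phi> x, \<phi> y) \<in> r2)"

text \<open>planar preserving from (pL,pR) to (rL,rR)\<close>
definition planar_preserving ::
  "('a \<Rightarrow> 'a list) \<Rightarrow> ('a \<times> 'a) set \<Rightarrow> ('a \<times> 'a) set \<Rightarrow> ('a \<times> 'a) set \<Rightarrow> ('a \<times> 'a) set \<Rightarrow> bool" where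
  "planar_preserving \<sigma> pL pR rL rR \<longleftrightarrow>
     (\<forall>s\<in>TL \<sigma>. order_preserving (AL \<sigma> s) (phiL \<sigma> s) pL rL) \<and>
     (\<forall>p\<in>TR \<sigma>. order_preserving (AR \<sigma> p) (phiR \<sigma> p) pR rR)"

definition smallest :: "('a \<times> 'a) set \<Rightarrow> nat \<Rightarrow> 'a set" where
  "smallest r k = {x. card {y. lt r y x} < k}"

definition irreducible_pair :: "('a::finite \<times> 'a) set \<Rightarrow> ('a \<times> 'a) set \<Rightarrow> bool" where
  "irreducible_pair rL rR \<longleftrightarrow> (\<forall>k. 0 < k \<and> k < card (UNIV :: 'a set) \<longrightarrow> smallest rL k \<noteq> smallest rR k)"

section \<open>The graph G_IET(S)\<close>

definition gIET_vertex :: "'a::finite \<Rightarrow> 'a \<Rightarrow> ('a \<times> 'a) set \<times> ('a \<times> 'a) set \<Rightarrow> bool" where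
  "gIET_vertex a b v \<longleftrightarrow> linear_order (fst v) \<and> linear_order (snd v) \<and>
     irreducible_pair (fst v) (snd v) \<and> lt (fst v) a b"

definition gIET_edge :: "('a::finite \<Rightarrow> 'a list) set \<Rightarrow> 'a \<Rightarrow> 'a \<Rightarrow>
    ('a \<times> 'a) set \<times> ('a \<times> 'a) set \<Rightarrow> ('a \<Rightarrow> 'a list) \<Rightarrow> ('a \<times> 'a) set \<times> ('a \<times> 'a) set \<Rightarrow> bool" where
  "gIET_edge S a b v \<sigma> v' \<longleftrightarrow> gIET_vertex a b v \<and> gIET_vertex a b v' \<and> \<sigma> \<in> S \<and>
     left_valid (order_graph (fst v)) \<sigma> (order_graph (fst v')) \<and>
     right_valid (order_graph (snd v)) \<sigma> (order_graph (snd v')) \<and>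
     planar_morph (fst v) (snd v) \<sigma> \<and>
     (planar_preserving \<sigma> (fst v') (snd v') (fst v) (snd v) \<or>
      planar_preserving \<sigma> ((fst v')\<inverse>) ((snd v')\<inverse>) (fst v) (snd v))"

text \<open>The sequence sigma labels the infinite path v_0 -> v_1 -> ... in G_IET(S).\<close>
definition labels_path :: "('a::finite \<Rightarrow> 'a list) set \<Rightarrow> 'a \<Rightarrow> 'a \<Rightarrow> (nat \<Rightarrow> 'a \<Rightarrow> 'a list) \<Rightarrow>
    (nat \<Rightarrow> ('a \<times> 'a) set \<times> ('a \<times> 'a) set) \<Rightarrow> bool" where
  "labels_path S a b \<sigma> v \<longleftrightarrow> (\<forall>n. gIET_edge S a b (v n) (\<sigma> n) (v (Suc n)))"

section \<open>Shift spaces and S-adic representations\<close>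

definition word_at :: "(int \<Rightarrow> 'a) \<Rightarrow> int \<Rightarrow> nat \<Rightarrow> 'a list" where
  "word_at x i n = map (\<lambda>k. x (i + int k)) [0..<n]"

definition lang :: "(int \<Rightarrow> 'a) \<Rightarrow> 'a list set" where
  "lang x = {word_at x i n | i n. True}"

text \<open>Nonempty, closed (for the product of discrete topologies) and shift-invariant.\<close>
definition shift_space :: "(int \<Rightarrow> 'a) set \<Rightarrow> bool" where
  "shift_space X \<longleftrightarrow> X \<noteq> {} \<and>
     (\<forall>x. x \<in> X \<longleftrightarrow> (\<lambda>i. x (i + 1)) \<in> X) \<and>
     (\<forall>x. (\<forall>n::nat. \<exists>y\<in>X. \<forall>i. \<bar>i\<bar> \<le> int n \<longrightarrow> y i = x i) \<longrightarrow> x \<in> X)"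

text \<open>mprod sigma n k w = sigma_n (sigma_(n+1) ( ... sigma_(n+k-1) (w)))\<close>
fun mprod :: "(nat \<Rightarrow> 'a \<Rightarrow> 'a list) \<Rightarrow> nat \<Rightarrow> nat \<Rightarrow> 'a list \<Rightarrow> 'a list" where
  "mprod \<sigma> n 0 w = w"
| "mprod \<sigma> n (Suc k) w = morph_app (\<sigma> n) (mprod \<sigma> (Suc n) k w)"

definition lang_n :: "(nat \<Rightarrow> 'a \<Rightarrow> 'a list) \<Rightarrow> nat \<Rightarrow> 'a list set" where
  "lang_n \<sigma> n = (\<Union>{factors (mprod \<sigma> n (N - n) [c]) | N c. N > n})"

definition S_adic_shift :: "(nat \<Rightarrow> 'a \<Rightarrow> 'a list) \<Rightarrow> (int \<Rightarrow> 'a) set" where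
  "S_adic_shift \<sigma> = {x. lang x \<subseteq> lang_n \<sigma> 0}"

definition primitive :: "(nat \<Rightarrow> 'a \<Rightarrow> 'a list) \<Rightarrow> bool" where
  "primitive \<sigma> \<longleftrightarrow> (\<forall>n. \<exists>N>n. \<forall>c d. d \<in> set (mprod \<sigma> n (N - n) [c]))"

section \<open>Interval exchange transformations\<close>

text \<open>I c is the interval of letter c, T the map; top order r1, bottom order r2.\<close>
definition IET :: "('a \<times> 'a) set \<Rightarrow> ('a \<times> 'a) set \<Rightarrow> ('a \<Rightarrow> real set) \<Rightarrow> (real \<Rightarrow> real) \<Rightarrow> bool" where
  "IET r1 r2 I T \<longleftrightarrow>
     (\<forall>c. \<exists>l r. l < r \<and> I c = {l..<r}) \<and>
     (\<Union>c. I c) = {0..<1} \<and>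
     (\<forall>c d. c \<noteq> d \<longrightarrow> I c \<inter> I d = {}) \<and>
     (\<forall>c d. lt r1 c d \<longrightarrow> (\<forall>x\<in>I c. \<forall>y\<in>I d. x < y)) \<and>
     bij_betw T {0..<1} {0..<1} \<and>
     (\<forall>c. \<exists>t. \<forall>x\<in>I c. T x = x + t) \<and>
     (\<forall>c d. lt r2 c d \<longrightarrow> (\<forall>x\<in>T ` I c. \<forall>y\<in>T ` I d. x < y))"

definition orbit :: "(real \<Rightarrow> real) \<Rightarrow> real \<Rightarrow> real set" where
  "orbit T x = {y \<in> {0..<1}. \<exists>n. (T ^^ n) x = y \<or> (T ^^ n) y = x}"

definition IET_regular :: "('a \<Rightarrow> real set) \<Rightarrow> (real \<Rightarrow> real) \<Rightarrow> bool" where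
  "IET_regular I T \<longleftrightarrow>
     (\<forall>c. Inf (I c) \<noteq> 0 \<longrightarrow> infinite (orbit T (Inf (I c)))) \<and>
     (\<forall>c d. Inf (I c) \<noteq> 0 \<and> Inf (I d) \<noteq> 0 \<and> Inf (I c) \<noteq> Inf (I d) \<longrightarrow>
        orbit T (Inf (I c)) \<inter> orbit T (Inf (I d)) = {})"

definition natural_coding :: "('a \<Rightarrow> real set) \<Rightarrow> (real \<Rightarrow> real) \<Rightarrow> (int \<Rightarrow> 'a) set" where
  "natural_coding I T = {x. \<forall>u\<in>lang x.
      {z \<in> {0..<1}. \<forall>i<length u. (T ^^ i) z \<in> I (u ! i)} \<noteq> {}}"

text \<open>X is the natural coding of a regular IET for the pair (top r1, bottom r2).\<close>
definition coding_of_regular_IET_for :: "('a \<times> 'a) set \<Rightarrow> ('a \<times> 'a) set \<Rightarrow> (int \<Rightarrow> 'a) set \<Rightarrow> bool" where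
  "coding_of_regular_IET_for r1 r2 X \<longleftrightarrow>
     (\<exists>I T. IET r1 r2 I T \<and> IET_regular I T \<and> X = natural_coding I T)"

definition coding_of_regular_IET :: "(int \<Rightarrow> 'a) set \<Rightarrow> bool" where
  "coding_of_regular_IET X \<longleftrightarrow>
     (\<exists>r1 r2. linear_order r1 \<and> linear_order r2 \<and> coding_of_regular_IET_for r1 r2 X)"

end

theory Submission
  imports Defs "HOL-Library.Sublist" "HOL-Library.Diagonal_Subsequence" "HOL-Library.Countable"
begin

text \<open>
  Call a language a staircase for a pair of orders if every extension set is planar and is not
  split by a pair of initial segments of the two orders.  For the coding of an interval exchange,
  a split extension set is exactly a connection between two end points, so regular interval
  exchanges give staircase languages, which are moreover uniformly recurrent by Keane's argument.

  The staircase property passes through a return morphism in both directions, because the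
  extension set of the word s @ morph_app sigma v @ p is the image of the extension set of v,
  restricted to the letters c, d for which s is a proper suffix of sigma(c) and p a proper prefix
  of sigma(d) w.  Going up a directive sequence, the orders are the lexicographic orders on the
  words sigma(c) w and on the reversed words sigma(c); intervals, order preservation and the graph
  conditions are then automatic, up to the fact that covering pairs of letters correspond
  bijectively, which is a counting argument.  Going down, primitivity provides a uniformly
  recurrent language with invariant letter frequencies.  In a staircase language the weight of
  c u d is forced by the weights of c u and u d (a planar coupling is the monotone one), so these
  frequencies are the lengths of the cylinders of an interval exchange.
\<close>

section \<open>Words and languages\<close>

text \<open>The staircase property survives reversing both orders at once, and the derived
  lexicographic orders may put \<open>b\<close> before \<open>a\<close>. Fixing \<open>a\<close>
  before \<open>b\<close> at every vertex selects one of the two orientations; the second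
  alternative in the edge condition records a switch between them, which the graphs
  \<open>order_graph\<close> do not see. The left order is the bottom order because a letter in
  front of a word records the image under \<open>T\<close> of which interval contains the point. The
  downward transfer is an induction on word length, and it stalls at a level whose return word is
  empty: such a morphism sends letters to letters and shortens nothing. It is rescued by nonempty
  return words occurring at infinitely many levels. The frequencies are limits along one
  subsequence. Any weight that is consistent under left and right extension and positive exactly on
  the staircase language yields an exchange with that language, so the shift is recovered from its
  language.\<close>

lemma append_eq_longer:
  assumes "xs @ ys = zs @ ts" "length xs \<le> length zs"
  shows "\<exists>y. zs = xs @ y \<and> ys = y @ ts"
proof -
  have "take (length xs) zs = xs"
    using assms by (metis append_eq_conv_conj append_take_drop_id take_all_iff take_append diff_is_0_eq take_0 append_Nil2)
  then obtain y where "zs = xs @ y" by (metis append_take_drop_id)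
  then show ?thesis using assms(1) by auto
qed

lemma factors_eq: "factors u = {v. sublist v u}"
  unfolding factors_def sublist_def by auto

lemma occ_iff: "i \<in> occ w u \<longleftrightarrow> (\<exists>a b. u = a @ w @ b \<and> length a = i)"
proof
  assume "i \<in> occ w u"
  then have h: "i + length w \<le> length u" "take (length w) (drop i u) = w"
    unfolding occ_def by auto
  have "u = take i u @ w @ drop (length w) (drop i u)"
    using h(2) by (metis append_take_drop_id)
  moreover have "length (take i u) = i" using h(1) by simp
  ultimately show "\<exists>a b. u = a @ w @ b \<and> length a = i" by blast
qed (auto simp: occ_def)

lemma morph_app_append [simp]: "morph_app \<sigma> (u @ v) = morph_app \<sigma> u @ morph_app \<sigma> v"
  by (simp add: morph_app_def)

lemma morph_app_Nil [simp]: "morph_app \<sigma> [] = []"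
  by (simp add: morph_app_def)

lemma morph_app_Cons [simp]: "morph_app \<sigma> (c # v) = \<sigma> c @ morph_app \<sigma> v"
  by (simp add: morph_app_def)

lemma sublist_morph_app: "sublist u v \<Longrightarrow> sublist (morph_app \<sigma> u) (morph_app \<sigma> v)"
  unfolding sublist_def by (metis morph_app_append)

text \<open>Such sets are the languages of shift spaces; passing to them replaces bi-infinite
  sequences by finite words.\<close>

definition biextendable :: "'a list set \<Rightarrow> bool" where
  "biextendable F \<longleftrightarrow> [] \<in> F \<and> (\<forall>u v. sublist v u \<and> u \<in> F \<longrightarrow> v \<in> F) \<and> (\<forall>u\<in>F. \<exists>c d. [c] @ u @ [d] \<in> F)"

text \<open>Minimality of the shift, expressed on its language.\<close>

definition uniformly_recurrent :: "'a list set \<Rightarrow> bool" where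
  "uniformly_recurrent F \<longleftrightarrow> (\<forall>u\<in>F. \<exists>R. \<forall>v\<in>F. R \<le> length v \<longrightarrow> sublist u v)"

definition image_lang :: "('a \<Rightarrow> 'a list) \<Rightarrow> 'a list set \<Rightarrow> 'a list set" where
  "image_lang \<sigma> F = {u. \<exists>v\<in>F. sublist u (morph_app \<sigma> v)}"

lemma biextendable_Nil: "biextendable F \<Longrightarrow> [] \<in> F"
  by (simp add: biextendable_def)

lemma biextendable_sublist: "biextendable F \<Longrightarrow> sublist v u \<Longrightarrow> u \<in> F \<Longrightarrow> v \<in> F"
  by (auto simp: biextendable_def)

lemma biextendable_factor: "biextendable F \<Longrightarrow> x @ v @ y \<in> F \<Longrightarrow> v \<in> F"
  by (rule biextendable_sublist) auto

lemma biextendable_extend: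
  assumes "biextendable F" "u \<in> F"
  shows "\<exists>x y. length x = n \<and> length y = n \<and> x @ u @ y \<in> F"
proof (induction n)
  case 0
  show ?case using assms by auto
next
  case (Suc n)
  then obtain x y where xy: "length x = n" "length y = n" "x @ u @ y \<in> F" by auto
  then obtain c d where "[c] @ (x @ u @ y) @ [d] \<in> F" using assms(1) unfolding biextendable_def by blast
  then show ?case using xy(1,2) by (intro exI[of _ "[c] @ x"] exI[of _ "y @ [d]"]) auto
qed

lemma biextendable_ext_right:
  assumes "biextendable F" "u \<in> F" shows "\<exists>d. u @ [d] \<in> F"
proof -
  obtain c d where "[c] @ u @ [d] \<in> F" using assms unfolding biextendable_def by blast
  then show ?thesis using biextendable_factor[OF assms(1), of "[c]" "u @ [d]" "[]"] by auto
qed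

lemma biextendable_ext_left:
  assumes "biextendable F" "u \<in> F" shows "\<exists>c. [c] @ u \<in> F"
proof -
  obtain c d where "[c] @ u @ [d] \<in> F" using assms unfolding biextendable_def by blast
  then show ?thesis using biextendable_factor[OF assms(1), of "[]" "[c] @ u" "[d]"] by auto
qed

lemma in_ext: "(c, d) \<in> ext F u \<longleftrightarrow> [c] @ u @ [d] \<in> F"
  by (simp add: ext_def)

section \<open>Recognizability of return morphisms\<close>

locale return_mor =
  fixes \<sigma> :: "'a \<Rightarrow> 'a list" and w :: "'a list"
  assumes ret: "return_for \<sigma> w"
begin

lemma inj: "morph_app \<sigma> u = morph_app \<sigma> v \<Longrightarrow> u = v"
  using ret unfolding return_for_def by (auto dest: injD)

lemma nonempty [simp]: "\<sigma> c \<noteq> []"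
  using ret unfolding return_for_def by auto

lemma length_pos: "0 < length (\<sigma> c)" by simp

lemma occ_block: "\<sigma> c @ w = a @ w @ b \<Longrightarrow> a = [] \<or> a = \<sigma> c \<and> b = []"
proof -
  assume h: "\<sigma> c @ w = a @ w @ b"
  then have "length a \<in> occ w (\<sigma> c @ w)" unfolding occ_iff by metis
  then have "length a = 0 \<or> length a = length (\<sigma> c)"
    using ret unfolding return_for_def by auto
  then show ?thesis using h by (auto simp: append_eq_append_conv)
qed

lemma block_prefix: "\<exists>b. \<sigma> c @ w = w @ b"
proof -
  have "0 \<in> occ w (\<sigma> c @ w)" using ret unfolding return_for_def by auto
  then show ?thesis unfolding occ_iff by auto
qed

lemma image_prefix: "\<exists>b. morph_app \<sigma> v @ w = w @ b"
proof (induction v)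
  case (Cons c v)
  then obtain b where "morph_app \<sigma> v @ w = w @ b" by auto
  moreover obtain b' where "\<sigma> c @ w = w @ b'" using block_prefix by auto
  ultimately have "morph_app \<sigma> (c # v) @ w = w @ b' @ b" by (metis append.assoc morph_app_Cons)
  then show ?case by blast
qed auto

lemma length_image: "length v \<le> length (morph_app \<sigma> v)"
proof (induction v)
  case (Cons c v)
  have "length (c # v) \<le> length (\<sigma> c) + length (morph_app \<sigma> v)" using Cons length_pos[of c] by (simp del: length_greater_0_conv)
  then show ?case by simp
qed auto

text \<open>Block boundaries are the only places where \<open>w\<close> occurs: an occurrence
  starting strictly inside the first block would lie in \<open>\<sigma> c @ w\<close>, since the
  rest of the image begins with \<open>w\<close>, and would be a third one there.\<close>

lemma parse_one:
  "morph_app \<sigma> V @ w = a @ w @ b \<Longrightarrow> \<exists>V1 V2. V = V1 @ V2 \<and> a = morph_app \<sigma> V1 \<and> w @ b = morph_app \<sigma> V2 @ w"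
proof (induction V arbitrary: a)
  case Nil
  then have "length w = length a + (length w + length b)"
    by (metis append_Nil length_append morph_app_Nil)
  then have "a = []" by simp
  then show ?case using Nil by auto
next
  case (Cons c V)
  obtain z where z: "morph_app \<sigma> V @ w = w @ z" using image_prefix by auto
  show ?case
  proof (cases "a = []")
    case True
    then show ?thesis using Cons.prems by (intro exI[of _ "[]"] exI[of _ "c # V"]) auto
  next
    case ne: False
    show ?thesis
    proof (cases "length (\<sigma> c) \<le> length a")
      case True
      then obtain a' where a': "a = \<sigma> c @ a'"
        using Cons.prems append_eq_longer[of "\<sigma> c" "morph_app \<sigma> V @ w" a "w @ b"] by auto
      then have "morph_app \<sigma> V @ w = a' @ w @ b" using Cons.prems by simp
      from Cons.IH[OF this] obtain V1 V2 where
        "V = V1 @ V2" "a' = morph_app \<sigma> V1" "w @ b = morph_app \<sigma> V2 @ w" by auto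
      then show ?thesis using a' by (intro exI[of _ "c # V1"] exI[of _ V2]) auto
    next
      case False
      have "(\<sigma> c @ w) @ z = (a @ w) @ b" using Cons.prems z by simp
      then obtain y where "\<sigma> c @ w = (a @ w) @ y"
        using False append_eq_longer[of "a @ w" b "\<sigma> c @ w" z] by auto
      then have "a = [] \<or> a = \<sigma> c" using occ_block[of c a y] by auto
      then show ?thesis using ne False by auto
    qed
  qed
qed

text \<open>Two occurrences of \<open>w\<close> are two block boundaries, so the word from the first
  to the second is an image. The second assumption says that \<open>w\<close> also occurs directly
  after \<open>a\<close>; in this form the two occurrences may overlap.\<close>

lemma parse_two:
  assumes "morph_app \<sigma> V @ w = a @ x @ w @ b" and "x @ w @ b = w @ b'"
  shows "\<exists>V1 v V2. V = V1 @ v @ V2 \<and> a = morph_app \<sigma> V1 \<and> x = morph_app \<sigma> v \<and> w @ b = morph_app \<sigma> V2 @ w"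
proof -
  have "morph_app \<sigma> V @ w = (a @ x) @ w @ b" using assms by simp
  from parse_one[OF this] obtain V' V2 where V': "V = V' @ V2" "a @ x = morph_app \<sigma> V'"
    "w @ b = morph_app \<sigma> V2 @ w" by auto
  have "a @ w @ b' = (a @ x) @ w @ b" using assms(2) by simp
  have "morph_app \<sigma> V @ w = a @ w @ b'" using assms by simp
  from parse_one[OF this] obtain V1 V3 where V1: "V = V1 @ V3" "a = morph_app \<sigma> V1" by auto
  have "length V1 \<le> length V'"
  proof (rule ccontr)
    assume "\<not> ?thesis"
    then obtain y where y: "V1 = V' @ y" "y \<noteq> []"
      using V'(1) V1(1) append_eq_longer[of V' V2 V1 V3] by auto
    then have "a = a @ x @ morph_app \<sigma> y" using V1 V' by (metis append.assoc morph_app_append)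
    then have "length (morph_app \<sigma> y) = 0" by (metis append_self_conv append_is_Nil_conv length_0_conv)
    then show False using y(2) length_image[of y] by simp
  qed
  then obtain v where v: "V' = V1 @ v" using V'(1) V1(1) append_eq_longer[of V1 V3 V' V2] by auto
  then have "x = morph_app \<sigma> v" using V1(2) V'(2) by simp
  then show ?thesis using v V'(1,3) V1(2) by auto
qed

text \<open>Synchronization: \<open>parse_two\<close> cuts out some preimage of the middle word, and
  injectivity identifies it with \<open>v\<close>.\<close>

lemma parse_image:
  assumes "morph_app \<sigma> V @ w = a @ morph_app \<sigma> v @ w @ b"
  shows "\<exists>V1 V2. V = V1 @ v @ V2 \<and> a = morph_app \<sigma> V1 \<and> w @ b = morph_app \<sigma> V2 @ w"
proof -
  obtain z where "morph_app \<sigma> v @ w = w @ z" using image_prefix by auto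
  then have "morph_app \<sigma> v @ w @ b = w @ (z @ b)" by (metis append.assoc)
  from parse_two[OF assms this] obtain V1 v' V2 where
    "V = V1 @ v' @ V2 \<and> a = morph_app \<sigma> V1 \<and> morph_app \<sigma> v = morph_app \<sigma> v' \<and> w @ b = morph_app \<sigma> V2 @ w"
    by auto
  then show ?thesis using inj by metis
qed

text \<open>No block boundary is visible in \<open>s @ w\<close> before its end. Proper suffixes of
  blocks have this property by \<open>only_suffixI\<close>.\<close>

definition only_suffix :: "'a list \<Rightarrow> bool" where
  "only_suffix s \<longleftrightarrow> (\<forall>a b. s @ w = a @ w @ b \<longrightarrow> b = [])"

definition only_prefix :: "'a list \<Rightarrow> bool" where
  "only_prefix p \<longleftrightarrow> (\<forall>a b. p = a @ w @ b \<longrightarrow> a = [])"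

lemma only_suffixI:
  assumes "\<sigma> c = u @ s" "u \<noteq> []" shows "only_suffix s"
  unfolding only_suffix_def
proof (intro allI impI)
  fix a b assume "s @ w = a @ w @ b"
  then have "\<sigma> c @ w = (u @ a) @ w @ b" using assms by simp
  then show "b = []" using occ_block[of c "u @ a" b] assms(2) by auto
qed

lemma only_prefixI:
  assumes "\<sigma> c @ w = p @ u" "u \<noteq> []" shows "only_prefix p"
  unfolding only_prefix_def
proof (intro allI impI)
  fix a b assume "p = a @ w @ b"
  then have "\<sigma> c @ w = a @ w @ b @ u" using assms by simp
  then show "a = []" using occ_block[of c a "b @ u"] assms(2) by auto
qed

text \<open>If the last block were no longer than \<open>s\<close>, the \<open>w\<close> at its
  start would be visible in \<open>s @ w\<close> before the end. Hence the last block reaches back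
  at least to \<open>x\<close>.\<close>

lemma parse_left:
  assumes "morph_app \<sigma> V = \<alpha> @ [x] @ s" "only_suffix s"
  shows "\<exists>V' c z. V = V' @ [c] \<and> \<sigma> c = z @ [x] @ s"
proof -
  obtain V' c where V: "V = V' @ [c]" using assms(1) by (cases V rule: rev_cases) auto
  then have eq: "morph_app \<sigma> V' @ \<sigma> c = \<alpha> @ [x] @ s" using assms(1) by simp
  show ?thesis
  proof (cases "length (\<sigma> c) \<le> length s")
    case True
    then have "suffix (\<sigma> c) s"
      by (metis eq suffix_length_suffix suffixI append.assoc)
    then obtain s' where s': "s = s' @ \<sigma> c" by (auto simp: suffix_def)
    obtain z where "\<sigma> c @ w = w @ z" using block_prefix by auto
    then have "s @ w = s' @ w @ z" using s' by simp
    then have "z = []" using assms(2) unfolding only_suffix_def by blast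
    then show ?thesis using \<open>\<sigma> c @ w = w @ z\<close> by simp
  next
    case False
    then have "length ([x] @ s) \<le> length (\<sigma> c)" by simp
    then have "suffix ([x] @ s) (\<sigma> c)"
    proof (rule suffix_length_suffix[rotated 2])
      show "suffix ([x] @ s) (\<alpha> @ [x] @ s)" by (rule suffixI) simp
      show "suffix (\<sigma> c) (\<alpha> @ [x] @ s)" by (rule suffixI) (rule eq[symmetric])
    qed
    then show ?thesis using V by (auto simp: suffix_def)
  qed
qed

text \<open>Mirror image of \<open>parse_left\<close>. The bound on \<open>length p\<close> rules
  out \<open>V = []\<close>, where \<open>w\<close> alone would have to contain \<open>p\<close> and
  one more letter.\<close>

lemma parse_right:
  assumes "morph_app \<sigma> V @ w = p @ [y] @ \<beta>" "only_prefix p" "length w \<le> length p"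
  shows "\<exists>d V' z. V = d # V' \<and> \<sigma> d @ w = p @ [y] @ z"
proof -
  obtain d V' where V: "V = d # V'" using assms(1,3)
    by (cases V) (auto dest: arg_cong[where f=length])
  obtain z where z: "morph_app \<sigma> V' @ w = w @ z" using image_prefix by auto
  have eq: "(\<sigma> d @ w) @ z = p @ [y] @ \<beta>" using assms(1) V z by simp
  show ?thesis
  proof (cases "length (\<sigma> d @ w) \<le> length p")
    case True
    then obtain p' where "p = (\<sigma> d @ w) @ p'" using append_eq_longer[OF eq] by auto
    then have "p = \<sigma> d @ w @ p'" by simp
    then have "\<sigma> d = []" using assms(2) unfolding only_prefix_def by blast
    then show ?thesis by simp
  next
    case False
    then have "length (p @ [y]) \<le> length (\<sigma> d @ w)" by simp
    moreover have "(\<sigma> d @ w) @ z = (p @ [y]) @ \<beta>" using eq by simp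
    ultimately obtain z' where "\<sigma> d @ w = (p @ [y]) @ z'"
      using append_eq_longer[of "p @ [y]" \<beta> "\<sigma> d @ w" z] by auto
    then show ?thesis using V by auto
  qed
qed

text \<open>Take the block containing the letter \<open>c\<close>. The copy of \<open>w\<close> that
  follows this block either reaches the end of \<open>u @ [d]\<close> or lies inside
  \<open>u\<close>, and the latter is excluded.\<close>

lemma initial_in_block:
  assumes "sublist ([c] @ u @ [d]) (morph_app \<sigma> V @ w)" "\<not> sublist w u"
  shows "\<exists>e. sublist ([c] @ u @ [d]) (\<sigma> e @ w)"
  using assms(1)
proof (induction V)
  case Nil
  then have "sublist ([c] @ u @ [d]) w" by simp
  then show ?case by (meson sublist_append_leftI sublist_order.order.trans sublist_append)
next
  case (Cons e V)
  then obtain \<alpha> \<beta> where eq: "\<sigma> e @ morph_app \<sigma> V @ w = \<alpha> @ ([c] @ u @ [d]) @ \<beta>"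
    by (auto simp: sublist_def)
  show ?case
  proof (cases "length (\<sigma> e) \<le> length \<alpha>")
    case True
    then obtain \<alpha>' where "\<alpha> = \<sigma> e @ \<alpha>'" using append_eq_longer[OF eq] by auto
    then have "morph_app \<sigma> V @ w = \<alpha>' @ ([c] @ u @ [d]) @ \<beta>" using eq by simp
    then show ?thesis using Cons.IH by (auto simp: sublist_def)
  next
    case False
    then have "length (\<alpha> @ [c]) \<le> length (\<sigma> e)" by simp
    then obtain y where y: "\<sigma> e = \<alpha> @ [c] @ y"
      using eq append_eq_longer[of "\<alpha> @ [c]" "u @ [d] @ \<beta>" "\<sigma> e" "morph_app \<sigma> V @ w"] by auto
    obtain z where z: "morph_app \<sigma> V @ w = w @ z" using image_prefix by auto
    have eq2: "y @ w @ z = u @ [d] @ \<beta>" using eq y z by simp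
    show ?thesis
    proof (cases "length (y @ w) \<le> length u")
      case True
      then obtain u' where "u = y @ w @ u'"
        using eq2 append_eq_longer[of "y @ w" z u "[d] @ \<beta>"] by auto
      then show ?thesis using assms(2) by (auto simp: sublist_def)
    next
      case False
      then have "length (u @ [d]) \<le> length (y @ w)" by simp
      then obtain x where "y @ w = (u @ [d]) @ x"
        using eq2 append_eq_longer[of "u @ [d]" \<beta> "y @ w" z] by auto
      then have "\<sigma> e @ w = \<alpha> @ ([c] @ u @ [d]) @ x" using y by simp
      then show ?thesis by (auto simp: sublist_def)
    qed
  qed
qed

text \<open>Without its end letters, a long \<open>u\<close> avoiding \<open>w\<close> falls under
  \<open>initial_in_block\<close>, so \<open>u\<close> would fill a whole
  \<open>\<sigma> e @ w\<close>, which does contain \<open>w\<close>.\<close>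

lemma long_contains:
  assumes "\<And>e. length (\<sigma> e @ w) \<le> K" "K \<le> length u" "sublist u (morph_app \<sigma> V @ w)"
  shows "sublist w u"
proof (rule ccontr)
  assume n: "\<not> sublist w u"
  show False
  proof (cases "2 \<le> length u")
    case True
    then obtain c u' d where u: "u = [c] @ u' @ [d]"
      by (cases u; cases "tl u" rule: rev_cases) auto
    then have "\<not> sublist w u'" using n by (auto simp: sublist_def) (metis append.assoc append_Cons)
    then obtain e where "sublist u (\<sigma> e @ w)" using initial_in_block assms(3) u by blast
    then obtain a b where ab: "\<sigma> e @ w = a @ u @ b" by (auto simp: sublist_def)
    then have "length (\<sigma> e @ w) = length a + length u + length b" by simp
    then have "length a = 0" "length b = 0" using assms(1)[of e] assms(2) by linarith+
    then have "a = []" "b = []" by auto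
    then have "u = \<sigma> e @ w" using ab by simp
    then show False using n by simp
  next
    case False
    \<comment> \<open>Here \<open>K\<close> is at most one, and nonempty blocks leave no room for a
      nonempty \<open>w\<close>.\<close>
    have "length (\<sigma> c @ w) \<le> 1" for c using assms(1)[of c] assms(2) False by linarith
    then have "length (\<sigma> undefined) + length w \<le> 1" by simp
    then have "length w = 0" using length_pos[of undefined] by linarith
    then show False using n by simp
  qed
qed

end

lemma bound_family:
  fixes f :: "'a::finite \<Rightarrow> nat" shows "\<exists>K. \<forall>c. f c \<le> K"
proof -
  have "\<forall>c. f c \<le> Max (range f)" by simp
  then show ?thesis by blast
qed

lemma return_bound:
  fixes \<sigma> :: "'a::finite \<Rightarrow> 'a list" shows "\<exists>K. \<forall>e. length (\<sigma> e @ w) \<le> K"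
  by (rule bound_family)

text \<open>A return word longer than \<open>\<sigma> a\<close> and \<open>\<sigma> b\<close>
  together would have both \<open>\<sigma> a @ \<sigma> b\<close> and
  \<open>\<sigma> b @ \<sigma> a\<close> as prefixes, against injectivity. So lengths are bounded, a
  longest return word exists, and the choice in \<open>ret_word\<close> is genuine.\<close>

lemma ret_word_return:
  fixes \<sigma> :: "'a \<Rightarrow> 'a list"
  assumes "return_morphism \<sigma>" "a \<noteq> (b::'a)"
  shows "return_for \<sigma> (ret_word \<sigma>)"
proof -
  let ?K = "length (\<sigma> a) + length (\<sigma> b)"
  have bd: "length v \<le> ?K" if "return_for \<sigma> v" for v
  proof (rule ccontr)
    assume l: "\<not> ?thesis"
    interpret return_mor \<sigma> v by standard (rule that)
    obtain x where "morph_app \<sigma> [a, b] @ v = v @ x" using image_prefix by blast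
    then have x: "(\<sigma> a @ \<sigma> b) @ v = v @ x" by simp
    obtain y where "morph_app \<sigma> [b, a] @ v = v @ y" using image_prefix by blast
    then have y: "(\<sigma> b @ \<sigma> a) @ v = v @ y" by simp
    obtain v1 where 1: "v = (\<sigma> a @ \<sigma> b) @ v1" using append_eq_longer[OF x] l by auto
    obtain v2 where 2: "v = (\<sigma> b @ \<sigma> a) @ v2" using append_eq_longer[OF y] l by auto

    have "take ?K v = \<sigma> a @ \<sigma> b" unfolding 1 by simp
    moreover have "take ?K v = \<sigma> b @ \<sigma> a" unfolding 2 by simp
    ultimately have "\<sigma> a @ \<sigma> b = \<sigma> b @ \<sigma> a" by metis
    then have "morph_app \<sigma> [a, b] = morph_app \<sigma> [b, a]"
      unfolding morph_app_Cons morph_app_Nil append_Nil2 .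
    then have "[a, b] = [b, a]" by (rule inj)
    then show False using assms(2) by simp
  qed
  obtain v where v: "return_for \<sigma> v" using assms(1) unfolding return_morphism_def by auto
  obtain u where "return_for \<sigma> u \<and> (\<forall>v. return_for \<sigma> v \<longrightarrow> length v \<le> length u)"
    using ex_has_greatest_nat[of "return_for \<sigma>" v length "Suc ?K"] v bd by (auto simp: less_Suc_eq_le)
  from someI[of "\<lambda>w. return_for \<sigma> w \<and> (\<forall>v. return_for \<sigma> v \<longrightarrow> length v \<le> length w)", OF this]
  show ?thesis unfolding ret_word_def by blast
qed

section \<open>Extension sets of images\<close>

lemma AL_iff: "c \<in> AL \<sigma> s \<longleftrightarrow> (\<exists>z x. \<sigma> c = z @ [x] @ s)"
proof
  assume "c \<in> AL \<sigma> s"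
  then obtain u where "u \<noteq> []" "\<sigma> c = u @ s" unfolding AL_def by auto
  then show "\<exists>z x. \<sigma> c = z @ [x] @ s" by (cases u rule: rev_cases) auto
next
  assume "\<exists>z x. \<sigma> c = z @ [x] @ s"
  then obtain z x where "\<sigma> c = (z @ [x]) @ s" by auto
  then show "c \<in> AL \<sigma> s" unfolding AL_def by blast
qed

lemma phiL_eq: "\<sigma> c = z @ [x] @ s \<Longrightarrow> phiL \<sigma> s c = x"
  by (simp add: phiL_def nth_append)

lemma AR_iff: "c \<in> AR \<sigma> p \<longleftrightarrow> (\<exists>z x. \<sigma> c @ ret_word \<sigma> = p @ [x] @ z)"
proof
  assume "c \<in> AR \<sigma> p"
  then obtain u where "u \<noteq> []" "\<sigma> c @ ret_word \<sigma> = p @ u" unfolding AR_def by auto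
  then show "\<exists>z x. \<sigma> c @ ret_word \<sigma> = p @ [x] @ z" by (cases u) auto
qed (auto simp: AR_def)

lemma phiR_eq: "\<sigma> c @ ret_word \<sigma> = p @ [x] @ z \<Longrightarrow> phiR \<sigma> p c = x"
  by (simp add: phiR_def nth_append)

locale image_step =
  fixes \<sigma> :: "'a::finite \<Rightarrow> 'a list" and F F0 :: "'a list set"
  assumes retw: "return_for \<sigma> (ret_word \<sigma>)" and bi: "biextendable F" and F0: "F0 = image_lang \<sigma> F"
begin

abbreviation w where "w \<equiv> ret_word \<sigma>"

sublocale return_mor \<sigma> w by standard (rule retw)

text \<open>After \<open>length w\<close> further letters of \<open>F\<close> the image is long
  enough to contain the \<open>w\<close> that must follow
  \<open>morph_app \<sigma> v\<close>.\<close>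

lemma image_w_mem:
  assumes "v \<in> F" shows "morph_app \<sigma> v @ w \<in> F0"
proof -
  obtain x y where y: "length y = length w" "x @ v @ y \<in> F" using biextendable_extend[OF bi assms] by blast
  then have vy: "v @ y \<in> F" using biextendable_factor[OF bi, of x "v @ y" "[]"] by simp
  obtain z where "morph_app \<sigma> y @ w = w @ z" using image_prefix by auto
  moreover have "length w \<le> length (morph_app \<sigma> y)" using length_image[of y] y by simp
  ultimately obtain t where "morph_app \<sigma> y = w @ t"
    using append_eq_longer[of w z "morph_app \<sigma> y" w] by metis
  then have "sublist (morph_app \<sigma> v @ w) (morph_app \<sigma> (v @ y))" by (simp add: sublist_append_leftI sublist_append_rightI)
  then show ?thesis using vy F0 unfolding image_lang_def by blast
qed

lemma mem_iff: "u \<in> F0 \<longleftrightarrow> (\<exists>V\<in>F. sublist u (morph_app \<sigma> V @ w))"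
proof
  assume "u \<in> F0"
  then obtain V where "V \<in> F" "sublist u (morph_app \<sigma> V)" unfolding F0 image_lang_def by auto
  then show "\<exists>V\<in>F. sublist u (morph_app \<sigma> V @ w)" by (meson sublist_append_rightI sublist_order.order.trans)
next
  assume "\<exists>V\<in>F. sublist u (morph_app \<sigma> V @ w)"
  then obtain V where V: "V \<in> F" "sublist u (morph_app \<sigma> V @ w)" by auto
  then obtain V' where "V' \<in> F" "sublist (morph_app \<sigma> V @ w) (morph_app \<sigma> V')"
    using image_w_mem[OF V(1)] unfolding F0 image_lang_def by auto
  then show "u \<in> F0" using V(2) sublist_order.order.trans unfolding F0 image_lang_def by blast
qed

lemma memE:
  assumes "u \<in> F0"
  obtains V a b where "V \<in> F" "morph_app \<sigma> V @ w = a @ u @ b"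
  using assms unfolding mem_iff sublist_def by metis

lemma memI: "V \<in> F \<Longrightarrow> morph_app \<sigma> V @ w = a @ u @ b \<Longrightarrow> u \<in> F0"
  unfolding mem_iff sublist_def by metis

lemma bi0: "biextendable F0"
  unfolding biextendable_def
proof (intro conjI allI impI ballI)
  have "morph_app \<sigma> [] @ w \<in> F0" using image_w_mem biextendable_Nil[OF bi] by blast
  then show "[] \<in> F0" unfolding F0 image_lang_def by auto
next
  fix u v assume "sublist v u \<and> u \<in> F0"
  then show "v \<in> F0" unfolding F0 image_lang_def by (auto intro: sublist_order.order.trans)
next
  fix u assume "u \<in> F0"
  then obtain V a b where V: "V \<in> F" "morph_app \<sigma> V = a @ u @ b"
    unfolding F0 image_lang_def sublist_def by auto
  obtain c d where cd: "[c] @ V @ [d] \<in> F" using bi V(1) unfolding biextendable_def by blast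
  obtain a' x where x: "\<sigma> c @ a = a' @ [x]" by (cases "\<sigma> c @ a" rule: rev_cases) auto
  obtain b' y where y: "b @ \<sigma> d = [y] @ b'" by (cases "b @ \<sigma> d") auto
  have "morph_app \<sigma> ([c] @ V @ [d]) = (\<sigma> c @ a) @ u @ (b @ \<sigma> d)" using V(2) by simp
  also have "\<dots> = a' @ ([x] @ u @ [y]) @ b'" unfolding x y by simp
  finally show "\<exists>c d. [c] @ u @ [d] \<in> F0" using cd unfolding F0 image_lang_def sublist_def by blast
qed

text \<open>By recognizability every occurrence of the long word comes from an occurrence of
  \<open>v\<close>: \<open>parse_image\<close> finds \<open>v\<close>, and the two outer letters are
  read in the neighbouring blocks by \<open>parse_left\<close> and
  \<open>parse_right\<close>.\<close>

lemma ext_image: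
  assumes s: "only_suffix s" and p: "only_prefix (w @ t)"
  shows "ext F0 (s @ morph_app \<sigma> v @ w @ t) =
    {(phiL \<sigma> s c, phiR \<sigma> (w @ t) d) | c d. (c, d) \<in> ext F v \<and> c \<in> AL \<sigma> s \<and> d \<in> AR \<sigma> (w @ t)}" (is "?A = ?B")
proof (intro set_eqI iffI)
  fix q assume "q \<in> ?A"
  then obtain x y where q: "q = (x, y)" and "[x] @ (s @ morph_app \<sigma> v @ w @ t) @ [y] \<in> F0"
    by (cases q) (auto simp: ext_def)
  then obtain V a b where V: "V \<in> F"
    "morph_app \<sigma> V @ w = a @ ([x] @ (s @ morph_app \<sigma> v @ w @ t) @ [y]) @ b" by (elim memE)
  then have "morph_app \<sigma> V @ w = (a @ [x] @ s) @ morph_app \<sigma> v @ w @ (t @ [y] @ b)" by simp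
  from parse_image[OF this] obtain V1 V2 where P: "V = V1 @ v @ V2" "a @ [x] @ s = morph_app \<sigma> V1"
    "w @ t @ [y] @ b = morph_app \<sigma> V2 @ w" by auto
  from parse_left[OF P(2)[symmetric] s] obtain V1' c z where c: "V1 = V1' @ [c]" "\<sigma> c = z @ [x] @ s" by auto
  have "morph_app \<sigma> V2 @ w = (w @ t) @ [y] @ b" using P(3) by simp
  from parse_right[OF this p] obtain d V2' z' where d: "V2 = d # V2'" "\<sigma> d @ w = (w @ t) @ [y] @ z'" by auto
  have "V = V1' @ ([c] @ v @ [d]) @ V2'" using P(1) c d by simp
  then have "(c, d) \<in> ext F v" using V(1) biextendable_factor[OF bi] unfolding in_ext by metis
  moreover have "c \<in> AL \<sigma> s" "phiL \<sigma> s c = x" using c(2) phiL_eq AL_iff by metis+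
  moreover have "d \<in> AR \<sigma> (w @ t)" "phiR \<sigma> (w @ t) d = y" using d(2) phiR_eq AR_iff by metis+
  ultimately show "q \<in> ?B" using q by blast
next
  fix q assume "q \<in> ?B"
  then obtain c d where q: "q = (phiL \<sigma> s c, phiR \<sigma> (w @ t) d)" and cd: "(c, d) \<in> ext F v"
    "c \<in> AL \<sigma> s" "d \<in> AR \<sigma> (w @ t)" by auto
  obtain z x where c: "\<sigma> c = z @ [x] @ s" using cd(2) AL_iff by metis
  obtain z' y where d: "\<sigma> d @ w = (w @ t) @ [y] @ z'" using cd(3) AR_iff by metis
  have "morph_app \<sigma> ([c] @ v @ [d]) @ w = z @ ([x] @ (s @ morph_app \<sigma> v @ w @ t) @ [y]) @ z'"
    using c d by simp
  then have "(x, y) \<in> ?A" using cd(1) memI unfolding in_ext by blast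
  then show "q \<in> ?A" using q phiL_eq[of \<sigma> c z x s] phiR_eq[of \<sigma> d "w @ t" y z'] c d by simp
qed

lemma first_occ:
  assumes "sublist w u" shows "\<exists>s b. u = s @ w @ b \<and> only_suffix s"
proof -
  let ?P = "\<lambda>n. \<exists>a b. u = a @ w @ b \<and> length a = n"
  have "\<exists>n. ?P n" using assms unfolding sublist_def by blast
  then obtain n where "?P n" "\<forall>m < n. \<not> ?P m" using exists_least_iff[of ?P] by blast
  then obtain s b where s: "u = s @ w @ b" "\<forall>m < length s. \<not> ?P m" by blast
  have "only_suffix s" unfolding only_suffix_def
  proof (intro allI impI)
    fix a' b' assume h: "s @ w = a' @ w @ b'"
    then have "u = a' @ w @ (b' @ b)" using s(1) by (metis append.assoc)
    then have "\<not> length a' < length s" using s(2) by blast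
    moreover have "length s + length w = length a' + length w + length b'" using h by (metis length_append add.assoc)
    ultimately show "b' = []" by simp
  qed
  then show ?thesis using s(1) by blast
qed

lemma last_occ:
  assumes "sublist w u" shows "\<exists>a t. u = a @ w @ t \<and> only_prefix (w @ t)"
proof -
  let ?Q = "\<lambda>n. \<exists>a b. u = a @ w @ b \<and> length b = n"
  have "\<exists>n. ?Q n" using assms unfolding sublist_def by blast
  then obtain n where "?Q n" "\<forall>m < n. \<not> ?Q m" using exists_least_iff[of ?Q] by blast
  then obtain a t where t: "u = a @ w @ t" "\<forall>m < length t. \<not> ?Q m" by blast
  have "only_prefix (w @ t)" unfolding only_prefix_def
  proof (intro allI impI)
    fix a' b' assume h: "w @ t = a' @ w @ b'"
    then have "u = (a @ a') @ w @ b'" using t(1) by simp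
    then have "\<not> length b' < length t" using t(2) by blast
    moreover have "length w + length t = length a' + length w + length b'" using h by (metis length_append add.assoc)
    ultimately show "a' = []" by simp
  qed
  then show ?thesis using t(1) by blast
qed

text \<open>The first and the last occurrence of \<open>w\<close> in \<open>u\<close> are block
  boundaries. The part between them is an image, and extremality makes the two remaining ends
  suitable for \<open>ext_image\<close>.\<close>

lemma decompose:
  assumes "u \<in> F0" "sublist w u"
  obtains s v t where "u = s @ morph_app \<sigma> v @ w @ t" "only_suffix s" "only_prefix (w @ t)" "v \<in> F"
proof -
  obtain V \<alpha> \<beta> where V: "V \<in> F" "morph_app \<sigma> V @ w = \<alpha> @ u @ \<beta>" using assms(1) by (elim memE)
  obtain s b where s: "u = s @ w @ b" "only_suffix s" using first_occ[OF assms(2)] by blast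
  obtain a t where t: "u = a @ w @ t" "only_prefix (w @ t)" using last_occ[OF assms(2)] by blast
  have "length s \<le> length a"
  proof (rule ccontr)
    assume l: "\<not> ?thesis"
    have "(a @ w) @ t = (s @ w) @ b" using s(1) t(1) by simp
    then obtain y where "s @ w = a @ w @ y" using append_eq_longer[of "a @ w" t "s @ w" b] l by auto
    moreover from this have "y = []" using s(2) unfolding only_suffix_def by blast
    ultimately show False using l by simp
  qed
  then obtain x where x: "a = s @ x" using s(1) t(1) append_eq_longer by metis
  have 1: "x @ w @ t @ \<beta> = w @ (b @ \<beta>)" using s(1) t(1) x by simp
  have "morph_app \<sigma> V @ w = (\<alpha> @ s) @ x @ w @ (t @ \<beta>)" using V(2) t(1) x by simp
  from parse_two[OF this 1] obtain V1 v V2 where P: "V = V1 @ v @ V2" "x = morph_app \<sigma> v" by auto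
  have "v \<in> F" using P(1) V(1) biextendable_factor[OF bi] by blast
  then show thesis using that[of s v t] s t x P(2) by simp
qed

lemma lang_morph_subset:
  assumes "\<forall>c. [c] \<in> F" shows "lang_morph \<sigma> \<subseteq> F0"
proof
  fix u assume "u \<in> lang_morph \<sigma>"
  then obtain c where "sublist u (\<sigma> c @ w)" unfolding lang_morph_def factors_eq by auto
  then have "sublist u (morph_app \<sigma> [c] @ w)" by simp
  then show "u \<in> F0" using assms mem_iff by blast
qed

lemma ext_initial:
  assumes "\<not> sublist w u" shows "ext F0 u \<subseteq> ext (lang_morph \<sigma>) u"
proof
  fix q assume "q \<in> ext F0 u"
  then obtain c d where q: "q = (c, d)" "[c] @ u @ [d] \<in> F0" by (cases q) (auto simp: ext_def)
  then obtain V where "sublist ([c] @ u @ [d]) (morph_app \<sigma> V @ w)" using mem_iff by blast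
  from initial_in_block[OF this assms] obtain e where "sublist ([c] @ u @ [d]) (\<sigma> e @ w)" by auto
  then show "q \<in> ext (lang_morph \<sigma>) u" unfolding q ext_def lang_morph_def factors_eq by auto
qed

end

section \<open>Linear orders on the alphabet\<close>

lemma lin_refl: "linear_order r \<Longrightarrow> (x, x) \<in> r"
  by (auto simp: linear_order_on_def partial_order_on_def preorder_on_def refl_on_def)

lemma lin_trans: "linear_order r \<Longrightarrow> (x, y) \<in> r \<Longrightarrow> (y, z) \<in> r \<Longrightarrow> (x, z) \<in> r"
  unfolding linear_order_on_def partial_order_on_def preorder_on_def trans_def by blast

lemma lin_antisym: "linear_order r \<Longrightarrow> (x, y) \<in> r \<Longrightarrow> (y, x) \<in> r \<Longrightarrow> x = y"
  unfolding linear_order_on_def partial_order_on_def antisym_def by blast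

lemma lin_total: "linear_order r \<Longrightarrow> (x, y) \<in> r \<or> (y, x) \<in> r"
  by (cases "x = y") (auto simp: lin_refl linear_order_on_def total_on_def)

lemma lt_iff: "linear_order r \<Longrightarrow> lt r x y \<longleftrightarrow> (y, x) \<notin> r"
  unfolding lt_def using lin_total lin_antisym lin_refl by metis

lemma lt_imp: "lt r x y \<Longrightarrow> (x, y) \<in> r"
  by (simp add: lt_def)

lemma lt_irrefl [simp]: "\<not> lt r x x"
  by (simp add: lt_def)

lemma lt_total: "linear_order r \<Longrightarrow> x \<noteq> y \<Longrightarrow> lt r x y \<or> lt r y x"
  unfolding lt_def using lin_total by metis

lemma lt_trans: "linear_order r \<Longrightarrow> lt r x y \<Longrightarrow> lt r y z \<Longrightarrow> lt r x z"
  unfolding lt_def using lin_trans lin_antisym by metis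

lemma lt_le_trans: "linear_order r \<Longrightarrow> lt r x y \<Longrightarrow> (y, z) \<in> r \<Longrightarrow> lt r x z"
  unfolding lt_def using lin_trans lin_antisym by metis

lemma le_lt_trans: "linear_order r \<Longrightarrow> (x, y) \<in> r \<Longrightarrow> lt r y z \<Longrightarrow> lt r x z"
  unfolding lt_def using lin_trans lin_antisym by metis

lemma lt_asym: "linear_order r \<Longrightarrow> lt r x y \<Longrightarrow> \<not> lt r y x"
  using lt_trans lt_irrefl by metis

lemma lt_converse [simp]: "lt (r\<inverse>) x y \<longleftrightarrow> lt r y x"
  by (auto simp: lt_def)

lemma linear_order_converse: "linear_order r \<Longrightarrow> linear_order (r\<inverse>)"
  by simp

lemma lin_max:
  assumes "linear_order r" "finite A" "A \<noteq> {}" shows "\<exists>m\<in>A. \<forall>x\<in>A. (x, m) \<in> r"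
  using assms(2,3)
proof (induction A rule: finite_ne_induct)
  case (singleton x)
  then show ?case using lin_refl[OF assms(1)] by auto
next
  case (insert x A)
  then obtain m where m: "m \<in> A" "\<forall>x\<in>A. (x, m) \<in> r" by auto
  show ?case
  proof (cases "(x, m) \<in> r")
    case True
    then show ?thesis using m by auto
  next
    case False
    then have "(m, x) \<in> r" using lin_total[OF assms(1)] by blast
    then show ?thesis using m lin_trans[OF assms(1)] lin_refl[OF assms(1)] by blast
  qed
qed

lemma lin_min:
  assumes "linear_order r" "finite A" "A \<noteq> {}" shows "\<exists>m\<in>A. \<forall>x\<in>A. (m, x) \<in> r"
  using lin_max[OF linear_order_converse[OF assms(1)] assms(2,3)] by simp

definition cover :: "('a \<times> 'a) set \<Rightarrow> 'a \<Rightarrow> 'a \<Rightarrow> bool" where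
  "cover r x y \<longleftrightarrow> lt r x y \<and> \<not> (\<exists>e. lt r x e \<and> lt r e y)"

definition nonmin :: "('a \<times> 'a) set \<Rightarrow> 'a set" where
  "nonmin r = {y. \<exists>x. lt r x y}"

definition pred_of :: "('a \<times> 'a) set \<Rightarrow> 'a \<Rightarrow> 'a" where
  "pred_of r y = (THE x. cover r x y)"

lemma cover_unique: "linear_order r \<Longrightarrow> cover r x y \<Longrightarrow> cover r x' y \<Longrightarrow> x = x'"
  unfolding cover_def using lt_total by metis

lemma cover_pr:
  fixes r :: "('a::finite \<times> 'a) set"
  assumes "linear_order r" "y \<in> nonmin r" shows "cover r (pred_of r y) y"
proof -
  have "{x. lt r x y} \<noteq> {}" using assms(2) by (auto simp: nonmin_def)
  then obtain m where m: "lt r m y" "\<forall>x. lt r x y \<longrightarrow> (x, m) \<in> r"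
    using lin_max[OF assms(1), of "{x. lt r x y}"] by auto
  then have "cover r m y" unfolding cover_def using lt_iff[OF assms(1)] by metis
  then show ?thesis unfolding pred_of_def using cover_unique[OF assms(1)] by (metis theI)
qed

lemma pr_eq: "linear_order r \<Longrightarrow> cover r x y \<Longrightarrow> pred_of r y = x"
  unfolding pred_of_def by (rule the_equality, assumption) (rule cover_unique)

lemma le_pr: "linear_order (r :: ('a::finite \<times> 'a) set) \<Longrightarrow> lt r x y \<Longrightarrow> (x, pred_of r y) \<in> r"
  using cover_pr[of r y] lt_iff[of r "pred_of r y" x] unfolding cover_def nonmin_def by fast

text \<open>Covering pairs are indexed by their upper ends; that any two linear orders have equally
  many of them drives the counting in \<open>lex_refine\<close>.\<close>

lemma card_nonmin:
  fixes r :: "('a::finite \<times> 'a) set"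
  assumes "linear_order r" shows "Suc (card (nonmin r)) = card (UNIV :: 'a set)"
proof -
  obtain m :: 'a where m: "\<forall>x. (m, x) \<in> r" using lin_min[OF assms, of UNIV] by auto
  then have "y \<in> nonmin r \<longleftrightarrow> y \<noteq> m" for y
    unfolding nonmin_def lt_def using lin_antisym[OF assms, of _ m] by blast
  then have "nonmin r = UNIV - {m}" by blast
  then show ?thesis using card_Suc_Diff1[of "UNIV :: 'a set" m] by simp
qed

text \<open>Indexing edges by their upper ends turns the multiset into a sum, which
  \<open>lex_cliques\<close> reindexes along a bijection of covering pairs.\<close>

lemma order_graph_sum:
  fixes r :: "('a::finite \<times> 'a) set"
  assumes "linear_order r"
  shows "order_graph r = (\<Sum>y\<in>nonmin r. {#{pred_of r y, y}#})"
proof -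
  have eq: "{{c, d} | c d. lt r c d \<and> \<not> (\<exists>e. lt r c e \<and> lt r e d)} = (\<lambda>y. {pred_of r y, y}) ` nonmin r" (is "?A = ?B")
  proof (intro set_eqI iffI)
    fix C assume "C \<in> ?A"
    then obtain c d where "C = {c, d}" "cover r c d" unfolding cover_def by blast
    moreover from this have "d \<in> nonmin r" "pred_of r d = c" using pr_eq[OF assms] by (auto simp: nonmin_def cover_def)
    ultimately show "C \<in> ?B" by blast
  next
    fix C assume "C \<in> ?B"
    then show "C \<in> ?A" using cover_pr[OF assms] unfolding cover_def by blast
  qed
  have inj: "inj_on (\<lambda>y. {pred_of r y, y}) (nonmin r)"
  proof (rule inj_onI)
    fix y z assume "y \<in> nonmin r" "z \<in> nonmin r" and e: "{pred_of r y, y} = {pred_of r z, z}"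
    then have "lt r (pred_of r y) y" "lt r (pred_of r z) z" using cover_pr[OF assms] by (auto simp: cover_def)
    then show "y = z" using e lt_asym[OF assms] by (auto simp: doubleton_eq_iff)
  qed
  have "mset_set ((\<lambda>y. {pred_of r y, y}) ` nonmin r) = sum (\<lambda>C. {#C#}) ((\<lambda>y. {pred_of r y, y}) ` nonmin r)"
    by (rule sum_multiset_singleton[symmetric])
  also have "\<dots> = (\<Sum>y\<in>nonmin r. {#{pred_of r y, y}#})"
    by (subst sum.reindex[OF inj]) (simp only: comp_def)
  finally show ?thesis unfolding order_graph_def eq .
qed

lemma order_graph_mem:
  fixes r :: "('a::finite \<times> 'a) set"
  shows "C \<in># order_graph r \<longleftrightarrow> (\<exists>x y. cover r x y \<and> C = {x, y})"
  unfolding order_graph_def cover_def by auto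

section \<open>Downsets, cuts and planarity\<close>

definition downset :: "('a \<times> 'a) set \<Rightarrow> 'a set \<Rightarrow> bool" where
  "downset r P \<longleftrightarrow> (\<forall>x y. y \<in> P \<and> (x, y) \<in> r \<longrightarrow> x \<in> P)"

definition planar :: "('a \<times> 'a) set \<Rightarrow> ('a \<times> 'a) set \<Rightarrow> ('a \<times> 'a) set \<Rightarrow> bool" where
  "planar rL rR E \<longleftrightarrow> (\<forall>c1 d1 c2 d2. (c1, d1) \<in> E \<and> (c2, d2) \<in> E \<and> lt rL c1 c2 \<longrightarrow> (d1, d2) \<in> rR)"

text \<open>For a planar relation this is connectedness of its bipartite graph, in a form that survives
  reversing both orders.\<close>

definition uncut :: "('a \<times> 'a) set \<Rightarrow> ('a \<times> 'a) set \<Rightarrow> ('a \<times> 'a) set \<Rightarrow> bool" where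
  "uncut rL rR E \<longleftrightarrow> (\<forall>P Q. downset rL P \<and> downset rR Q \<and> (\<forall>(c, d)\<in>E. c \<in> P \<longleftrightarrow> d \<in> Q) \<longrightarrow>
     (\<forall>(c, d)\<in>E. c \<in> P) \<or> (\<forall>(c, d)\<in>E. c \<notin> P))"

definition staircase :: "('a \<times> 'a) set \<Rightarrow> ('a \<times> 'a) set \<Rightarrow> 'a list set \<Rightarrow> bool" where
  "staircase rL rR F \<longleftrightarrow> (\<forall>u\<in>F. planar rL rR (ext F u) \<and> uncut rL rR (ext F u))"

lemma planar_word_iff: "planar_word rL rR F u \<longleftrightarrow> planar rL rR (ext F u)"
  unfolding planar_word_def planar_def ..

lemma downset_Compl:
  assumes "downset r P" shows "downset (r\<inverse>) (- P)"
  using assms unfolding downset_def by blast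

lemma uncut_converse: "uncut rL rR E \<Longrightarrow> uncut (rL\<inverse>) (rR\<inverse>) E"
  unfolding uncut_def
proof (intro allI impI)
  fix P Q assume U: "\<forall>P Q. downset rL P \<and> downset rR Q \<and> (\<forall>(c, d)\<in>E. c \<in> P \<longleftrightarrow> d \<in> Q) \<longrightarrow>
     (\<forall>(c, d)\<in>E. c \<in> P) \<or> (\<forall>(c, d)\<in>E. c \<notin> P)"
    and h: "downset (rL\<inverse>) P \<and> downset (rR\<inverse>) Q \<and> (\<forall>(c, d)\<in>E. c \<in> P \<longleftrightarrow> d \<in> Q)"
  have "downset rL (- P)" "downset rR (- Q)" using h downset_Compl[of "rL\<inverse>" P] downset_Compl[of "rR\<inverse>" Q] by auto
  moreover have "\<forall>(c, d)\<in>E. c \<in> - P \<longleftrightarrow> d \<in> - Q" using h by auto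
  ultimately have "(\<forall>(c, d)\<in>E. c \<in> - P) \<or> (\<forall>(c, d)\<in>E. c \<notin> - P)" using U by blast
  then show "(\<forall>(c, d)\<in>E. c \<in> P) \<or> (\<forall>(c, d)\<in>E. c \<notin> P)" by auto
qed

lemma planar_converse:
  assumes "planar rL rR E" shows "planar (rL\<inverse>) (rR\<inverse>) E"
  using assms unfolding planar_def by auto

lemma staircase_converse: "staircase rL rR F \<Longrightarrow> staircase (rL\<inverse>) (rR\<inverse>) F"
  unfolding staircase_def using planar_converse uncut_converse by blast

text \<open>Let \<open>d\<close> be the largest extension of \<open>x\<close> and \<open>d'\<close>
  the smallest of \<open>y\<close>. Planarity puts \<open>d\<close> at or below \<open>d'\<close>.
  If they differed, the letters up to \<open>x\<close> and the letters up to \<open>d\<close> would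
  cut \<open>E\<close>, because nothing lies between \<open>x\<close> and \<open>y\<close>.\<close>

lemma staircase_share:
  fixes rL rR :: "('a::finite \<times> 'a) set"
  assumes lL: "linear_order rL" and lR: "linear_order rR" and p: "planar rL rR E" and u: "uncut rL rR E"
    and xy: "cover rL x y" and x: "\<exists>d. (x, d) \<in> E" and y: "\<exists>d. (y, d) \<in> E"
  shows "\<exists>d. (x, d) \<in> E \<and> (y, d) \<in> E"
proof -
  obtain d where d: "(x, d) \<in> E" "\<forall>e. (x, e) \<in> E \<longrightarrow> (e, d) \<in> rR"
    using lin_max[OF lR, of "{d. (x, d) \<in> E}"] x by auto
  obtain d' where d': "(y, d') \<in> E" "\<forall>e. (y, e) \<in> E \<longrightarrow> (d', e) \<in> rR"
    using lin_min[OF lR, of "{d. (y, d) \<in> E}"] y by auto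
  have xy': "lt rL x y" using xy by (simp add: cover_def)
  then have dd: "(d, d') \<in> rR" using p d d' unfolding planar_def by blast
  have "d = d'"
  proof (rule ccontr)
    assume "d \<noteq> d'"
    then have l: "lt rR d d'" using dd by (simp add: lt_def)
    have cut: "c \<in> {c. (c, x) \<in> rL} \<longleftrightarrow> e \<in> {e. (e, d) \<in> rR}" if "(c, e) \<in> E" for c e
    proof (cases "(c, x) \<in> rL")
      case True
      then have "c = x \<or> lt rL c x" by (auto simp: lt_def)
      then have "(e, d) \<in> rR" using that d p unfolding planar_def by blast
      then show ?thesis using True by simp
    next
      case False
      then have "c = y \<or> lt rL y c" using xy lt_iff[OF lL] lt_total[OF lL] unfolding cover_def by metis
      then have "(d', e) \<in> rR" using that d' p unfolding planar_def by blast
      then have "(e, d) \<notin> rR" using l lt_iff[OF lR] lin_trans[OF lR] by metis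
      then show ?thesis using False by simp
    qed
    have "downset rL {c. (c, x) \<in> rL}" "downset rR {e. (e, d) \<in> rR}"
      unfolding downset_def using lin_trans[OF lL] lin_trans[OF lR] by blast+
    moreover have "\<forall>(c, e)\<in>E. c \<in> {c. (c, x) \<in> rL} \<longleftrightarrow> e \<in> {e. (e, d) \<in> rR}" using cut by blast
    ultimately have "(\<forall>(c, e)\<in>E. c \<in> {c. (c, x) \<in> rL}) \<or> (\<forall>(c, e)\<in>E. c \<notin> {c. (c, x) \<in> rL})"
      using u unfolding uncut_def by blast
    then show False using d(1) d'(1) xy' lt_iff[OF lL] lin_refl[OF lL] by blast
  qed
  then show ?thesis using d d' by auto
qed

lemma planar_swap:
  assumes lL: "linear_order rL" and lR: "linear_order rR" and "planar rL rR E"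
  shows "planar rR rL (E\<inverse>)"
  unfolding planar_def
proof (intro allI impI)
  fix d1 c1 d2 c2 assume h: "(d1, c1) \<in> E\<inverse> \<and> (d2, c2) \<in> E\<inverse> \<and> lt rR d1 d2"
  show "(c1, c2) \<in> rL"
  proof (rule ccontr)
    assume "(c1, c2) \<notin> rL"
    then have "lt rL c2 c1" using lt_iff[OF lL] by blast
    then have "(d2, d1) \<in> rR" using assms(3) h unfolding planar_def by blast
    then show False using h lt_iff[OF lR] by blast
  qed
qed

lemma uncut_swap:
  assumes "uncut rL rR E" shows "uncut rR rL (E\<inverse>)"
  unfolding uncut_def
proof (intro allI impI)
  fix Q P assume h: "downset rR Q \<and> downset rL P \<and> (\<forall>(d, c)\<in>E\<inverse>. d \<in> Q \<longleftrightarrow> c \<in> P)"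
  then have h': "\<forall>(c, d)\<in>E. c \<in> P \<longleftrightarrow> d \<in> Q" by blast
  then have "(\<forall>(c, d)\<in>E. c \<in> P) \<or> (\<forall>(c, d)\<in>E. c \<notin> P)" using assms h unfolding uncut_def by blast
  then show "(\<forall>(d, c)\<in>E\<inverse>. d \<in> Q) \<or> (\<forall>(d, c)\<in>E\<inverse>. d \<notin> Q)" using h' by blast
qed

section \<open>Lexicographic orders on prefix-free families\<close>

text \<open>One notion for both sides: with reversed blocks as \<open>W c\<close> it encodes
  \<open>AL\<close> and \<open>phiL\<close>, with \<open>W c = \<sigma> c @ w\<close> it encodes
  \<open>AR\<close> and \<open>phiR\<close>.\<close>

definition starts :: "('a \<Rightarrow> 'b list) \<Rightarrow> 'b list \<Rightarrow> 'a \<Rightarrow> 'b \<Rightarrow> bool" where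
  "starts W p c x \<longleftrightarrow> (\<exists>u. W c = p @ [x] @ u)"

lemma starts_nth:
  "starts W p c x \<longleftrightarrow> length p < length (W c) \<and> (\<forall>i<length p. W c ! i = p ! i) \<and> W c ! length p = x"
proof
  assume "starts W p c x"
  then show "length p < length (W c) \<and> (\<forall>i<length p. W c ! i = p ! i) \<and> W c ! length p = x"
    unfolding starts_def by (auto simp: nth_append)
next
  assume h: "length p < length (W c) \<and> (\<forall>i<length p. W c ! i = p ! i) \<and> W c ! length p = x"
  then have "take (length p) (W c) = p" by (intro nth_equalityI) auto
  then have "W c = p @ [x] @ drop (Suc (length p)) (W c)"
    using h id_take_nth_drop[of "length p" "W c"] by auto
  then show "starts W p c x" unfolding starts_def by blast
qed

definition prefix_free :: "('a \<Rightarrow> 'b list) \<Rightarrow> bool" where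
  "prefix_free W \<longleftrightarrow> (\<forall>c d x. W c @ x = W d \<longrightarrow> c = d)"

definition lex_order :: "('a \<Rightarrow> 'b list) \<Rightarrow> ('b \<times> 'b) set \<Rightarrow> ('a \<times> 'a) set" where
  "lex_order W r = {(c, d). c = d \<or> (\<exists>p x y. starts W p c x \<and> starts W p d y \<and> lt r x y)}"

lemma lcp_branch: "x \<noteq> y \<Longrightarrow> lcp (p @ [x] @ u) (p @ [y] @ v) = p"
  by (induction p) auto

lemma lcp_decomp:
  "\<exists>u' v'. u = lcp u v @ u' \<and> v = lcp u v @ v' \<and> (u' = [] \<or> v' = [] \<or> hd u' \<noteq> hd v')"
proof (induction u v rule: lcp.induct)
  case (1 x xs y ys)
  then show ?case by (cases "x = y") auto
qed auto

lemma starts_lcp: "starts W p c x \<Longrightarrow> starts W p d y \<Longrightarrow> x \<noteq> y \<Longrightarrow> lcp (W c) (W d) = p"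
  unfolding starts_def using lcp_branch by metis

lemma branch:
  assumes "prefix_free W" "c \<noteq> d"
  shows "\<exists>x y. starts W (lcp (W c) (W d)) c x \<and> starts W (lcp (W c) (W d)) d y \<and> x \<noteq> y"
proof -
  let ?p = "lcp (W c) (W d)"
  obtain u v where uv: "W c = ?p @ u" "W d = ?p @ v" "u = [] \<or> v = [] \<or> hd u \<noteq> hd v"
    using lcp_decomp by metis
  have "u \<noteq> []"
  proof
    assume "u = []"
    then have "W c @ v = W d" using uv by simp
    then show False using assms unfolding prefix_free_def by blast
  qed
  have "v \<noteq> []"
  proof
    assume "v = []"
    then have "W d @ u = W c" using uv by simp
    then show False using assms unfolding prefix_free_def by blast
  qed
  then show ?thesis using uv \<open>u \<noteq> []\<close> unfolding starts_def
    by (metis append_Cons append_Nil list.collapse)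
qed

lemma lt_lex:
  "linear_order r \<Longrightarrow> lt (lex_order W r) c d \<longleftrightarrow> (\<exists>p x y. starts W p c x \<and> starts W p d y \<and> lt r x y)"
  unfolding lt_def lex_order_def by (auto simp: starts_nth)

text \<open>The words of \<open>c\<close> and \<open>e\<close> separate at the shorter of the two
  branching prefixes; if these have equal length they coincide and transitivity of \<open>r\<close>
  applies.\<close>

lemma lex_trans_aux:
  assumes "linear_order r" "starts W p c x" "starts W p d y" "lt r x y"
    "starts W q d x'" "starts W q e y'" "lt r x' y'"
  shows "\<exists>p x y. starts W p c x \<and> starts W p e y \<and> lt r x y"
proof (cases "length p" "length q" rule: linorder_cases)
  case less
  then have "starts W p e y" using assms(3,5,6) unfolding starts_nth by (metis order.strict_trans)
  then show ?thesis using assms by blast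
next
  case equal
  then have "p = q" using assms(3,5) unfolding starts_nth by (metis nth_equalityI)
  then have "y = x'" using assms(3,5) unfolding starts_nth by simp
  then show ?thesis using assms \<open>p = q\<close> lt_trans[OF assms(1)] by metis
next
  case greater
  then have "starts W q c x'" using assms(2,3,5) unfolding starts_nth by (metis order.strict_trans)
  then show ?thesis using assms by blast
qed

lemma lex_linear:
  assumes r: "linear_order r" and W: "prefix_free W"
  shows "linear_order (lex_order W r)"
proof -
  have irr: "\<not> (starts W p c x \<and> starts W p c y \<and> lt r x y)" for p c x y
    by (auto simp: starts_nth)
  have "trans (lex_order W r)"
  proof (rule transI)
    fix c d e assume "(c, d) \<in> lex_order W r" "(d, e) \<in> lex_order W r"
    then show "(c, e) \<in> lex_order W r"
      using lex_trans_aux[OF r, of W _ c _ d _ _ _ e] unfolding lex_order_def by blast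
  qed
  moreover have "antisym (lex_order W r)"
  proof (rule antisymI)
    fix c d assume "(c, d) \<in> lex_order W r" "(d, c) \<in> lex_order W r"
    then show "c = d"
      using lex_trans_aux[OF r, of W _ c _ d _ _ _ c] irr unfolding lex_order_def by blast
  qed
  moreover have "total (lex_order W r)"
    unfolding total_on_def lex_order_def using branch[OF W] lt_total[OF r] by blast
  ultimately show ?thesis
    unfolding linear_order_on_def partial_order_on_def preorder_on_def refl_on_def by (auto simp: lex_order_def)
qed

lemma starts_unique: "starts W p c x \<Longrightarrow> starts W p c y \<Longrightarrow> x = y"
  by (simp add: starts_nth)

text \<open>Two words that both pass through \<open>p\<close> cannot separate before its end. If
  they separate at \<open>p\<close> the order is that of \<open>x\<close> and \<open>y\<close>; if
  later, \<open>x = y\<close>.\<close>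

lemma lex_mono:
  assumes r: "linear_order r" and "starts W p c x" "starts W p d y" "(c, d) \<in> lex_order W r"
  shows "(x, y) \<in> r"
proof (cases "c = d")
  case True
  then show ?thesis using assms starts_unique lin_refl[OF r] by metis
next
  case False
  then obtain q x' y' where q: "starts W q c x'" "starts W q d y'" "lt r x' y'"
    using assms(4) by (auto simp: lex_order_def)
  have "x = y \<or> x = x' \<and> y = y'"
  proof (cases "length q" "length p" rule: linorder_cases)
    case less
    then have "x' = y'" using q assms(2,3) unfolding starts_nth by metis
    then show ?thesis using q by simp
  next
    case equal
    then show ?thesis using q assms(2,3) unfolding starts_nth by auto
  next
    case greater
    then show ?thesis using q assms(2,3) unfolding starts_nth by auto
  qed
  then show ?thesis using q lt_imp lin_refl[OF r] by metis
qed

text \<open>A word leaving \<open>p\<close> early does so on one definite side, and \<open>c\<close>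
  and \<open>e\<close>, which both follow \<open>p\<close>, lie on the same side of it. This makes
  \<open>AL\<close> and \<open>AR\<close> intervals of the lexicographic orders.\<close>

lemma lex_interval:
  assumes r: "linear_order r" and c: "starts W p c x" and e: "starts W p e y"
    and cd: "(c, d) \<in> lex_order W r" and de: "(d, e) \<in> lex_order W r"
  shows "\<exists>z. starts W p d z"
proof (rule ccontr)
  assume n: "\<nexists>z. starts W p d z"
  then have "c \<noteq> d" "d \<noteq> e" using c e by auto
  then obtain q a b q' a' b' where q: "starts W q c a" "starts W q d b" "lt r a b"
    and q': "starts W q' d a'" "starts W q' e b'" "lt r a' b'"
    using cd de by (auto simp: lex_order_def)
  have 1: "length q < length p"
  proof (rule ccontr)
    assume "\<not> ?thesis"
    then have "starts W p d (W d ! length p)" using q c unfolding starts_nth by auto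
    then show False using n by blast
  qed
  have 2: "length q' < length p"
  proof (rule ccontr)
    assume "\<not> ?thesis"
    then have "starts W p d (W d ! length p)" using q' e unfolding starts_nth by auto
    then show False using n by blast
  qed
  show False
  proof (cases "length q" "length q'" rule: linorder_cases)
    case less
    then have "a = b" using q q' c e 1 2 unfolding starts_nth by metis
    then show ?thesis using q by simp
  next
    case equal
    then have "b = a'" "a = b'" using q q' c e 1 2 unfolding starts_nth by metis+
    then show ?thesis using q q' lt_asym[OF r] by blast
  next
    case greater
    then have "a' = b'" using q q' c e 1 2 unfolding starts_nth by metis
    then show ?thesis using q' by simp
  qed
qed

definition convex_in :: "('a \<times> 'a) set \<Rightarrow> 'a set \<Rightarrow> bool" where
  "convex_in r D \<longleftrightarrow> (\<forall>c d e. c \<in> D \<and> e \<in> D \<and> (c, d) \<in> r \<and> (d, e) \<in> r \<longrightarrow> d \<in> D)"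

text \<open>Sending each non-minimal letter y to the lexicographically first letter whose word follows
  the branch of y is injective, so counting forces all letters to be used and makes the
  correspondence between covering pairs bijective.\<close>

lemma lex_refine:
  fixes W :: "'a::finite \<Rightarrow> 'a list" and r :: "('a \<times> 'a) set"
  assumes r: "linear_order r" and W: "prefix_free W" and B: "B \<noteq> {}"
    and br: "\<And>x y. cover r x y \<Longrightarrow> \<exists>p. \<exists>c\<in>B. \<exists>d\<in>B. starts W p c x \<and> starts W p d y"
  shows "B = UNIV \<and> (\<exists>G P. bij_betw G (nonmin r) (nonmin (lex_order W r)) \<and>
    (\<forall>y\<in>nonmin r. starts W (P y) (G y) y \<and> starts W (P y) (pred_of (lex_order W r) (G y)) (pred_of r y)))"
proof -
  let ?L = "lex_order W r"
  have L: "linear_order ?L" using lex_linear[OF r W] .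
  define good where "good y p d \<longleftrightarrow> d \<in> B \<and> starts W p d y \<and> (\<exists>c\<in>B. starts W p c (pred_of r y)) \<and>
    (\<forall>d'\<in>B. starts W p d' y \<longrightarrow> (d, d') \<in> ?L)" for y p d
  have "\<exists>p d. good y p d" if y: "y \<in> nonmin r" for y
  proof -
    obtain p c d where p: "c \<in> B" "d \<in> B" "starts W p c (pred_of r y)" "starts W p d y"
      using br[OF cover_pr[OF r y]] by blast
    obtain m where m: "m \<in> {d \<in> B. starts W p d y}" "\<forall>x \<in> {d \<in> B. starts W p d y}. (m, x) \<in> ?L"
      using lin_min[OF L, of "{d \<in> B. starts W p d y}"] p by auto
    then have "good y p m" unfolding good_def using p by blast
    then show ?thesis by blast
  qed
  then obtain P G where PG: "\<And>y. y \<in> nonmin r \<Longrightarrow> good y (P y) (G y)" by metis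
  have ltpr: "lt r (pred_of r y) y" if "y \<in> nonmin r" for y using cover_pr[OF r that] by (simp add: cover_def)
  \<comment> \<open>Suppose \<open>P y\<close> is shorter. The witness \<open>c\<close> below
    \<open>G z\<close> at \<open>P z\<close> agrees with \<open>G z\<close> beyond
    \<open>P y\<close>, so it also follows the branch of \<open>y\<close> and precedes
    \<open>G y = G z\<close>, against minimality.\<close>
  have inj_aux: "length (P y) \<ge> length (P z)" if y: "y \<in> nonmin r" and z: "z \<in> nonmin r" and e: "G y = G z" for y z
  proof (rule ccontr)
    assume l: "\<not> ?thesis"
    obtain c where c: "c \<in> B" "starts W (P z) c (pred_of r z)" using PG[OF z] unfolding good_def by blast
    have gz: "starts W (P z) (G z) z" and gy: "starts W (P y) (G z) y"
      using PG[OF z] PG[OF y] e unfolding good_def by auto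
    have "starts W (P y) c y" using c(2) gz gy l unfolding starts_nth by auto
    then have "(G z, c) \<in> ?L" using PG[OF y] c(1) e unfolding good_def by auto
    moreover have "lt ?L c (G z)" using c(2) gz ltpr[OF z] lt_lex[OF r] by metis
    ultimately show False using lt_iff[OF L] by blast
  qed
  have inj: "inj_on G (nonmin r)"
  proof (rule inj_onI)
    fix y z assume yz: "y \<in> nonmin r" "z \<in> nonmin r" and e: "G y = G z"
    then have l: "length (P y) = length (P z)" using inj_aux le_antisym by metis
    have "starts W (P z) (G z) z" using PG[OF yz(2)] unfolding good_def by blast
    moreover have "starts W (P y) (G z) y" using PG[OF yz(1)] unfolding good_def e by blast
    ultimately show "y = z" using l unfolding starts_nth by simp
  qed
  obtain m where m: "m \<in> B" "\<forall>x\<in>B. (m, x) \<in> ?L" using lin_min[OF L _ B] by auto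
  \<comment> \<open>Every value of \<open>G\<close> has a letter of \<open>B\<close> below it, so
    the least letter of \<open>B\<close> is missed; together with injectivity this makes
    \<open>B\<close> as large as the alphabet.\<close>
  have sub: "G ` nonmin r \<subseteq> B - {m}"
  proof
    fix d assume "d \<in> G ` nonmin r"
    then obtain y where y: "y \<in> nonmin r" "d = G y" by auto
    obtain c where c: "c \<in> B" "starts W (P y) c (pred_of r y)" using PG[OF y(1)] unfolding good_def by blast
    have d: "d \<in> B" "starts W (P y) d y" using PG[OF y(1)] y unfolding good_def by auto
    have "lt ?L c d" using c(2) d(2) ltpr[OF y(1)] lt_lex[OF r] by metis
    then have "d \<noteq> m" using m(2) c(1) lt_iff[OF L] by metis
    then show "d \<in> B - {m}" using d by simp
  qed
  have "card (nonmin r) \<le> card (B - {m})" using card_mono[OF _ sub] card_image[OF inj] by simp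
  then have "card (UNIV :: 'a set) \<le> card B" using card_nonmin[OF r] m(1) card_Suc_Diff1[of B m] by simp
  then have BU: "B = UNIV" by (meson card_seteq finite subset_UNIV)
  have sub2: "G ` nonmin r \<subseteq> nonmin ?L"
    using sub m(2) unfolding BU nonmin_def lt_def by auto
  have "card (nonmin r) = card (nonmin ?L)" using card_nonmin[OF r] card_nonmin[OF L] by simp
  then have "G ` nonmin r = nonmin ?L" using sub2 card_image[OF inj] by (intro card_subset_eq) auto
  then have bij: "bij_betw G (nonmin r) (nonmin ?L)" using inj by (simp add: bij_betw_def)
  moreover have "starts W (P y) (G y) y \<and> starts W (P y) (pred_of ?L (G y)) (pred_of r y)" if y: "y \<in> nonmin r" for y
  proof -
    have gy: "starts W (P y) (G y) y" using PG[OF y] unfolding good_def by auto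
    obtain c where c: "starts W (P y) c (pred_of r y)" using PG[OF y] unfolding good_def by blast
    have cl: "lt ?L c (G y)" using c gy ltpr[OF y] lt_lex[OF r] by metis
    let ?e = "pred_of ?L (G y)"
    have "lt ?L ?e (G y)" using cover_pr[OF L, of "G y"] y sub2 by (auto simp: cover_def)
    have ce: "(c, ?e) \<in> ?L" using le_pr[OF L cl] .
    \<comment> \<open>By convexity the predecessor of \<open>G y\<close> still passes through
      \<open>P y\<close>. Its letter \<open>z\<close> there lies between \<open>pred_of r y\<close>
      and \<open>y\<close>, and minimality of \<open>G y\<close> excludes
      \<open>z = y\<close>.\<close>
    obtain z where z: "starts W (P y) ?e z"
      using lex_interval[OF r c gy ce] lt_imp[OF \<open>lt ?L ?e (G y)\<close>] by blast
    have 1: "(pred_of r y, z) \<in> r" using lex_mono[OF r c z ce] .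
    have 2: "(z, y) \<in> r" using lex_mono[OF r z gy] lt_imp[OF \<open>lt ?L ?e (G y)\<close>] by blast
    have "z \<noteq> y"
    proof
      assume "z = y"
      then have "(G y, ?e) \<in> ?L" using PG[OF y] z BU unfolding good_def by auto
      then show False using \<open>lt ?L ?e (G y)\<close> lt_iff[OF L] by blast
    qed
    then have "lt r z y" using 2 by (simp add: lt_def)
    then have "(z, pred_of r y) \<in> r" using le_pr[OF r] by blast
    then have "z = pred_of r y" using 1 lin_antisym[OF r] by blast
    then show ?thesis using gy z by simp
  qed
  ultimately show ?thesis using BU by blast
qed

lemma filter_mset_sum: "filter_mset Q (sum f A) = (\<Sum>a\<in>A. filter_mset Q (f a))"
  by (induction A rule: infinite_finite_induct) auto

lemma image_mset_sum: "image_mset g (sum f A) = (\<Sum>a\<in>A. image_mset g (f a))"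
  by (induction A rule: infinite_finite_induct) auto

lemma card_doubleton_ge: "2 \<le> card {x, y} \<longleftrightarrow> x \<noteq> y"
  by (cases "x = y") auto

lemma order_graph_filter:
  fixes r :: "('a::finite \<times> 'a) set"
  assumes "linear_order r"
  shows "filter_mset (\<lambda>C. 2 \<le> card C) (order_graph r) = order_graph r"
proof -
  have "filter_mset (\<lambda>C. 2 \<le> card C) {#{pred_of r y, y}#} = {#{pred_of r y, y}#}" if "y \<in> nonmin r" for y
    using cover_pr[OF assms that] by (auto simp: cover_def card_doubleton_ge)
  then show ?thesis unfolding order_graph_sum[OF assms] filter_mset_sum by (intro sum.cong) auto
qed

text \<open>A covering pair of \<open>L\<close> yields an edge only at the prefix where its two
  words separate; at every other prefix it has at most one image and is filtered out. The bijection
  \<open>G\<close> matches these edges with those of \<open>order_graph r\<close>.\<close>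

lemma lex_cliques:
  fixes W :: "'a::finite \<Rightarrow> 'a list" and r :: "('a \<times> 'a) set"
  defines "L \<equiv> lex_order W r"
  defines "T \<equiv> {lcp (W c) (W d) | c d. c \<noteq> d}"
  defines "f \<equiv> (\<lambda>p C. (\<lambda>c. W c ! length p) ` (C \<inter> {c. \<exists>x. starts W p c x}))"
  assumes r: "linear_order r" and W: "prefix_free W"
    and G: "bij_betw G (nonmin r) (nonmin L)"
    and P: "\<forall>y\<in>nonmin r. starts W (P y) (G y) y \<and> starts W (P y) (pred_of L (G y)) (pred_of r y)"
  shows "filter_mset (\<lambda>C. 2 \<le> card C) (\<Sum>p\<in>T. image_mset (f p) (order_graph L)) = order_graph r"
proof -
  have L: "linear_order L" using lex_linear[OF r W] L_def by simp
  have finT: "finite T"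
  proof -
    have "T \<subseteq> (\<lambda>(c, d). lcp (W c) (W d)) ` UNIV" unfolding T_def by auto
    then show ?thesis using finite_surj[of UNIV] by (metis finite)
  qed
  have f2: "f p {c, d} = {x, y}" if "starts W p c x" "starts W p d y" for p c d x y
  proof -
    have eq: "{c, d} \<inter> {c. \<exists>x. starts W p c x} = {c, d}" using that by blast
    show ?thesis unfolding f_def eq using that by (simp add: starts_nth)
  qed
  let ?pi = "\<lambda>d. lcp (W (pred_of L d)) (W d)"
  let ?h = "\<lambda>d. f (?pi d) {pred_of L d, d}"
  have ne: "pred_of L d \<noteq> d" if "d \<in> nonmin L" for d using cover_pr[OF L that] by (auto simp: cover_def)
  have single: "filter_mset (\<lambda>C. 2 \<le> card C) {#f p {pred_of L d, d}#} = (if p = ?pi d then {#?h d#} else {#})"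
    if d: "d \<in> nonmin L" for p d
  proof -
    obtain x y where xy: "starts W (?pi d) (pred_of L d) x" "starts W (?pi d) d y" "x \<noteq> y"
      using branch[OF W ne[OF d]] by blast
    have "?h d = {x, y}" using f2[OF xy(1,2)] .
    then have c1: "2 \<le> card (?h d)" using xy(3) by (simp add: card_doubleton_ge)
    moreover have "p = ?pi d" if "2 \<le> card (f p {pred_of L d, d})"
    proof -
      let ?D = "{c. \<exists>x. starts W p c x}"
      have "2 \<le> card ({pred_of L d, d} \<inter> ?D)" using that card_image_le[of "{pred_of L d, d} \<inter> ?D" "\<lambda>c. W c ! length p"]
        unfolding f_def by simp
      moreover have "card {pred_of L d, d} = 2" using ne[OF d] by simp
      ultimately have "{pred_of L d, d} \<inter> ?D = {pred_of L d, d}" by (intro card_seteq) auto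
      then have "pred_of L d \<in> ?D" "d \<in> ?D" by blast+
      then obtain x' y' where x': "starts W p (pred_of L d) x'" "starts W p d y'" by blast
      have "f p {pred_of L d, d} = {x', y'}" using f2[OF x'] .
      then have "x' \<noteq> y'" using that by (simp add: card_doubleton_ge)
      then show ?thesis using starts_lcp[OF x'] by simp
    qed
    moreover have "filter_mset (\<lambda>C. 2 \<le> card C) {#C#} = (if 2 \<le> card C then {#C#} else {#})" for C :: "'a set"
      by simp
    ultimately show ?thesis by metis
  qed
  have "filter_mset (\<lambda>C. 2 \<le> card C) (\<Sum>p\<in>T. image_mset (f p) (order_graph L)) =
      (\<Sum>p\<in>T. \<Sum>d\<in>nonmin L. filter_mset (\<lambda>C. 2 \<le> card C) {#f p {pred_of L d, d}#})"
    unfolding order_graph_sum[OF L] filter_mset_sum image_mset_sum image_mset_single ..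
  also have "\<dots> = (\<Sum>p\<in>T. \<Sum>d\<in>nonmin L. if p = ?pi d then {#?h d#} else {#})"
    by (rule sum.cong[OF refl], rule sum.cong[OF refl], rule single)
  also have "\<dots> = (\<Sum>d\<in>nonmin L. \<Sum>p\<in>T. if p = ?pi d then {#?h d#} else {#})" by (rule sum.swap)
  also have "\<dots> = (\<Sum>d\<in>nonmin L. {#?h d#})"
  proof (intro sum.cong refl)
    fix d assume "d \<in> nonmin L"
    then have "?pi d \<in> T" unfolding T_def using ne by blast
    then show "(\<Sum>p\<in>T. if p = ?pi d then {#?h d#} else {#}) = {#?h d#}" using finT by simp
  qed
  also have "\<dots> = (\<Sum>y\<in>nonmin r. {#?h (G y)#})" by (rule sum.reindex_bij_betw[OF G, symmetric])
  also have "\<dots> = (\<Sum>y\<in>nonmin r. {#{pred_of r y, y}#})"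
  proof (intro sum.cong refl)
    fix y assume y: "y \<in> nonmin r"
    then have s: "starts W (P y) (G y) y" "starts W (P y) (pred_of L (G y)) (pred_of r y)" using P by auto
    have "pred_of r y \<noteq> y" using cover_pr[OF r y] by (auto simp: cover_def)
    then have "?pi (G y) = P y" using starts_lcp[OF s(2,1)] by simp
    then have "?h (G y) = {pred_of r y, y}" using f2[OF s(2,1)] by simp
    then show "{#?h (G y)#} = {#{pred_of r y, y}#}" by simp
  qed
  also have "\<dots> = order_graph r" by (rule order_graph_sum[OF r, symmetric])
  finally show ?thesis .
qed

section \<open>Multi-cliques of order graphs\<close>

lemma rtrancl_sym: "sym r \<Longrightarrow> (x, y) \<in> r\<^sup>* \<Longrightarrow> (y, x) \<in> r\<^sup>*"
  using sym_rtrancl symD by metis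

text \<open>Descend from the upper letter through predecessors; convexity keeps them in
  \<open>D\<close>.\<close>

lemma connected_convex:
  fixes r :: "('a::finite \<times> 'a) set"
  assumes r: "linear_order r" and D: "convex_in r D"
  shows "mc_connected D (mc_induced D (order_graph r))"
proof -
  let ?R = "{(p, q). p \<noteq> q \<and> (\<exists>C\<in>#mc_induced D (order_graph r). p \<in> C \<and> q \<in> C)}"
  have path: "x \<in> D \<Longrightarrow> z \<in> D \<Longrightarrow> (x, z) \<in> r \<Longrightarrow> (x, z) \<in> ?R\<^sup>*" for x z
  proof (induction "card {e. lt r e z}" arbitrary: z rule: less_induct)
    case less
    show ?case
    proof (cases "x = z")
      case False
      then have lt: "lt r x z" using less.prems by (simp add: lt_def)
      then have zn: "z \<in> nonmin r" by (auto simp: nonmin_def)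
      have cov: "cover r (pred_of r z) z" using cover_pr[OF r zn] .
      have xp: "(x, pred_of r z) \<in> r" using le_pr[OF r lt] .
      have pz: "lt r (pred_of r z) z" using cov by (simp add: cover_def)
      then have pD: "pred_of r z \<in> D" using D xp less.prems lt_imp unfolding convex_in_def by metis
      have "{e. lt r e (pred_of r z)} \<subseteq> {e. lt r e z}" using lt_trans[OF r _ pz] by blast
      moreover have "pred_of r z \<in> {e. lt r e z}" "pred_of r z \<notin> {e. lt r e (pred_of r z)}" using pz by auto
      ultimately have "{e. lt r e (pred_of r z)} \<subset> {e. lt r e z}" by blast
      then have "card {e. lt r e (pred_of r z)} < card {e. lt r e z}" by (intro psubset_card_mono) auto
      then have "(x, pred_of r z) \<in> ?R\<^sup>*" using less.hyps pD less.prems xp by blast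
      moreover have "(pred_of r z, z) \<in> ?R"
      proof -
        have "{pred_of r z, z} \<in># order_graph r" using cov order_graph_mem by blast
        then have "{pred_of r z, z} \<inter> D \<in># mc_induced D (order_graph r)" unfolding mc_induced_def by auto
        moreover have "pred_of r z \<in> {pred_of r z, z} \<inter> D" "z \<in> {pred_of r z, z} \<inter> D" using pD less.prems by auto
        moreover have "pred_of r z \<noteq> z" using pz by auto
        ultimately show ?thesis by (intro CollectI case_prodI conjI bexI[of _ "{pred_of r z, z} \<inter> D"])
      qed
      ultimately show ?thesis by (rule rtrancl.rtrancl_into_rtrancl)
    qed simp
  qed
  have "sym ?R" by (rule symI) auto
  then have "(x, z) \<in> ?R\<^sup>*" if "x \<in> D" "z \<in> D" for x z
  proof (cases "(x, z) \<in> r")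
    case True
    show ?thesis by (rule path[OF that True])
  next
    case False
    then have "(z, x) \<in> r" using lin_total[OF r] by blast
    from path[OF that(2,1) this] show ?thesis by (rule rtrancl_sym[OF \<open>sym ?R\<close>])
  qed
  then show ?thesis unfolding mc_connected_def by blast
qed

text \<open>An edge of the induced graph joins neighbours in the order, so a path inside
  \<open>D\<close> cannot jump over a letter outside \<open>D\<close>.\<close>

lemma convex_connected:
  fixes r :: "('a::finite \<times> 'a) set"
  assumes r: "linear_order r" and C: "mc_connected D (mc_induced D (order_graph r))"
  shows "convex_in r D"
  unfolding convex_in_def
proof (intro allI impI)
  fix c d e assume h: "c \<in> D \<and> e \<in> D \<and> (c, d) \<in> r \<and> (d, e) \<in> r"
  show "d \<in> D"
  proof (rule ccontr)
    assume nd: "d \<notin> D"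
    let ?R = "{(p, q). p \<noteq> q \<and> (\<exists>C\<in>#mc_induced D (order_graph r). p \<in> C \<and> q \<in> C)}"
    have "(c, e) \<in> ?R\<^sup>*" using C h unfolding mc_connected_def by blast
    then have "lt r e d"
    proof (induction)
      case base
      then show ?case using h nd unfolding lt_def by auto
    next
      case (step p q)
      then obtain x y where xy: "cover r x y" "p \<in> {x, y} \<inter> D" "q \<in> {x, y} \<inter> D" "p \<noteq> q"
        unfolding mc_induced_def using order_graph_mem[of _ r] by auto
      show ?case
      proof (rule ccontr)
        assume "\<not> lt r q d"
        moreover have "q \<noteq> d" using xy(3) nd by blast
        ultimately have "lt r d q" using lt_total[OF r, of q d] by simp
        then have "lt r p q" using lt_trans[OF r step.IH] by blast
        then have "p = x" "q = y" using xy lt_asym[OF r] unfolding cover_def by auto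
        then show False using xy(1) step.IH \<open>lt r d q\<close> unfolding cover_def by blast
      qed
    qed
    then show False using h lt_iff[OF r] by blast
  qed
qed

lemma order_graph_connected:
  fixes r :: "('a::finite \<times> 'a) set"
  assumes r: "linear_order r" and M: "filter_mset (\<lambda>C. 2 \<le> card C) M = order_graph r"
  shows "mc_connected UNIV M"
proof -
  have "mc_connected UNIV (mc_induced UNIV (order_graph r))"
    by (rule connected_convex[OF r]) (simp add: convex_in_def)
  then have "mc_connected UNIV (order_graph r)" by (simp add: mc_induced_def)
  moreover have "C \<in># M" if "C \<in># order_graph r" for C
  proof -
    have "C \<in># filter_mset (\<lambda>C. 2 \<le> card C) M" using that M by simp
    then show ?thesis by simp
  qed
  then have "{(p, q). p \<noteq> q \<and> (\<exists>C\<in>#order_graph r. p \<in> C \<and> q \<in> C)} \<subseteq> {(p, q). p \<noteq> q \<and> (\<exists>C\<in>#M. p \<in> C \<and> q \<in> C)}"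
    by blast
  then have "{(p, q). p \<noteq> q \<and> (\<exists>C\<in>#order_graph r. p \<in> C \<and> q \<in> C)}\<^sup>* \<subseteq> {(p, q). p \<noteq> q \<and> (\<exists>C\<in>#M. p \<in> C \<and> q \<in> C)}\<^sup>*"
    by (rule rtrancl_mono)
  ultimately show ?thesis unfolding mc_connected_def by (meson subsetD)
qed

lemma count_order_graph_le: "count (order_graph r) C \<le> 1"
  unfolding order_graph_def by (cases "finite {{c, d} |c d. lt r c d \<and> (\<nexists>e. lt r c e \<and> lt r e d)}") (auto simp: count_mset_set')

text \<open>Look at the largest vertex of a cycle. Both its neighbours on the cycle are its unique
  predecessor, so the cycle has two vertices and uses two colors for the same pair, but each pair
  occurs in \<open>order_graph r\<close> at most once.\<close>

lemma order_graph_acyclic: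
  fixes r :: "('a::finite \<times> 'a) set"
  assumes r: "linear_order r" and M: "filter_mset (\<lambda>C. 2 \<le> card C) M = order_graph r"
  shows "mc_acyclic M"
  unfolding mc_acyclic_def
proof (intro allI impI)
  fix xs assume xs: "mset xs = M"
  have False if k: "2 \<le> length vs" "length cs = length vs" "distinct vs"
    and e: "\<forall>j<length vs. cs ! j < length xs \<and> vs ! j \<in> xs ! (cs ! j) \<and> vs ! ((j + 1) mod length vs) \<in> xs ! (cs ! j)"
    and dist: "distinct (map (\<lambda>j. (cs ! j, {vs ! j, vs ! ((j + 1) mod length vs)})) [0..<length vs])" for vs cs
  proof -
    let ?k = "length vs"
    have clique: "cover r (vs ! j) (vs ! ((j + 1) mod ?k)) \<or> cover r (vs ! ((j + 1) mod ?k)) (vs ! j)"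
      and cl2: "xs ! (cs ! j) = {vs ! j, vs ! ((j + 1) mod ?k)}" if j: "j < ?k" for j
    proof -
      have "(j + 1) mod ?k \<noteq> j" using j k(1) by (cases "j + 1 = ?k") auto
      moreover have jm: "(j + 1) mod ?k < ?k" using j by (intro mod_less_divisor) auto
      ultimately have ne: "vs ! j \<noteq> vs ! ((j + 1) mod ?k)" using j k(3) nth_eq_iff_index_eq by metis
      have "{vs ! j, vs ! ((j + 1) mod ?k)} \<subseteq> xs ! (cs ! j)" using e j by blast
      then have "2 \<le> card (xs ! (cs ! j))" using ne card_mono[of "xs ! (cs ! j)" "{vs ! j, vs ! ((j + 1) mod ?k)}"] by simp
      moreover have "xs ! (cs ! j) \<in># M" using e j xs nth_mem_mset by blast
      ultimately have "xs ! (cs ! j) \<in># order_graph r" using M by (metis (no_types, lifting) mem_Collect_eq set_mset_filter)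
      then obtain x y where xy: "cover r x y" "xs ! (cs ! j) = {x, y}" using order_graph_mem by metis
      then have "vs ! j \<in> {x, y}" "vs ! ((j + 1) mod ?k) \<in> {x, y}" using e j by auto
      then show "cover r (vs ! j) (vs ! ((j + 1) mod ?k)) \<or> cover r (vs ! ((j + 1) mod ?k)) (vs ! j)"
        and "xs ! (cs ! j) = {vs ! j, vs ! ((j + 1) mod ?k)}" using xy ne by auto
    qed
    obtain x where x: "x \<in> set vs" "\<forall>y\<in>set vs. (y, x) \<in> r" using lin_max[OF r, of "set vs"] k(1) by fastforce
    then obtain m where m: "m < ?k" "vs ! m = x" by (auto simp: in_set_conv_nth)
    \<comment> \<open>The cyclic predecessor of \<open>m\<close>; adding \<open>?k\<close> first
      avoids truncated subtraction at \<open>m = 0\<close>.\<close>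
    define m' where "m' = (m + ?k - 1) mod ?k"
    have m'k: "m' < ?k" unfolding m'_def using m by (intro mod_less_divisor) auto
    have m'1: "(m' + 1) mod ?k = m"
    proof (cases m)
      case 0
      then show ?thesis unfolding m'_def using k(1) by (cases "length vs") auto
    next
      case (Suc i)
      then have "m' = i" unfolding m'_def using m by simp
      then show ?thesis using Suc m by simp
    qed
    let ?n = "(m + 1) mod ?k"
    have nk: "?n < ?k" using m by (intro mod_less_divisor) auto
    have "\<not> cover r x (vs ! ?n)" "\<not> cover r x (vs ! m')"
      using x nk m'k lt_iff[OF r] unfolding cover_def by (metis nth_mem)+
    then have "cover r (vs ! ?n) x" "cover r (vs ! m') x" using clique[OF m(1)] clique[OF m'k] m'1 m(2) by auto
    then have "vs ! ?n = vs ! m'" using cover_unique[OF r] by blast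
    then have nm: "?n = m'" using nk m'k k(3) nth_eq_iff_index_eq by metis
    have sets: "xs ! (cs ! m) = xs ! (cs ! m')" using cl2[OF m(1)] cl2[OF m'k] m'1 nm by auto
    have "m \<noteq> m'" using m'1 m k(1) by (cases "m + 1 = ?k") auto
    moreover have "{vs ! m, vs ! ((m + 1) mod ?k)} = {vs ! m', vs ! ((m' + 1) mod ?k)}" using m'1 nm by auto
    moreover have "inj_on (\<lambda>j. (cs ! j, {vs ! j, vs ! ((j + 1) mod ?k)})) {0..<?k}"
      using dist by (simp add: distinct_map)
    ultimately have cne: "cs ! m \<noteq> cs ! m'" using m m'k unfolding inj_on_def by auto
    let ?C = "xs ! (cs ! m)"
    have "{cs ! m, cs ! m'} \<subseteq> {i. i < length xs \<and> xs ! i = ?C}" using e m m'k sets by auto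
    then have "card {cs ! m, cs ! m'} \<le> card {i. i < length xs \<and> xs ! i = ?C}" by (intro card_mono) auto
    then have "2 \<le> count M ?C" using cne xs count_mset[of xs ?C]
      by (simp add: count_list_eq_length_filter length_filter_conv_card eq_commute)
    moreover have "2 \<le> card ?C"
      using cl2[OF m(1)] clique[OF m(1)] by (auto simp: card_doubleton_ge cover_def)
    ultimately have "2 \<le> count (order_graph r) ?C" using M by (metis (no_types, lifting) count_filter_mset)
    then show False using count_order_graph_le[of r ?C] by simp
  qed
  then show "col_acyclic_list xs" unfolding col_acyclic_list_def Let_def by blast
qed

section \<open>Transfer of planarity and connectedness\<close>

lemma convex_in_converse: "convex_in r D \<Longrightarrow> convex_in (r\<inverse>) D"
  unfolding convex_in_def by blast

text \<open>A cut of the image is pulled back to the initial segments generated by the edges between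
  \<open>D\<close> and \<open>D'\<close> that land in it. By convexity and planarity an edge leaving
  \<open>D\<close> or \<open>D'\<close> lies below \<open>(c1, d1)\<close> or above
  \<open>(c2, d2)\<close>, hence on one side of the pulled-back cut. Convexity is asked for only
  where \<open>f\<close> or \<open>g\<close> is not constant, which is where the graph conditions
  provide it.\<close>

lemma staircase_image:
  fixes qL qR rL rR E :: "('a::finite \<times> 'a) set" and f g :: "'a \<Rightarrow> 'a" and D D' :: "'a set"
  defines "E' \<equiv> {(f c, g d) | c d. (c, d) \<in> E \<and> c \<in> D \<and> d \<in> D'}"
  assumes lin: "linear_order qL" "linear_order qR" "linear_order rL" "linear_order rR"
    and pl: "planar qL qR E" and un: "uncut qL qR E"
    and f: "\<And>c c'. c \<in> D \<Longrightarrow> c' \<in> D \<Longrightarrow> (c, c') \<in> qL \<Longrightarrow> (f c, f c') \<in> rL"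
    and g: "\<And>d d'. d \<in> D' \<Longrightarrow> d' \<in> D' \<Longrightarrow> (d, d') \<in> qR \<Longrightarrow> (g d, g d') \<in> rR"
    and D: "\<And>c c'. c \<in> D \<Longrightarrow> c' \<in> D \<Longrightarrow> f c \<noteq> f c' \<Longrightarrow> convex_in qL D"
    and D': "\<And>d d'. d \<in> D' \<Longrightarrow> d' \<in> D' \<Longrightarrow> g d \<noteq> g d' \<Longrightarrow> convex_in qR D'"
  shows "planar rL rR E' \<and> uncut rL rR E'"
proof
  note ltL = lt_iff[OF lin(1)] and ltR = lt_iff[OF lin(2)] and ltL' = lt_iff[OF lin(3)] and ltR' = lt_iff[OF lin(4)]
  have f': "lt qL c c'" if "c \<in> D" "c' \<in> D" "lt rL (f c) (f c')" for c c'
    using that f ltL ltL' by blast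
  have g': "lt qR d d'" if "d \<in> D'" "d' \<in> D'" "lt rR (g d) (g d')" for d d'
    using that g ltR ltR' by blast
  show "planar rL rR E'"
    unfolding planar_def
  proof (intro allI impI)
    fix x1 y1 x2 y2 assume h: "(x1, y1) \<in> E' \<and> (x2, y2) \<in> E' \<and> lt rL x1 x2"
    then obtain c1 d1 c2 d2 where c: "(c1, d1) \<in> E" "c1 \<in> D" "d1 \<in> D'" "x1 = f c1" "y1 = g d1"
      "(c2, d2) \<in> E" "c2 \<in> D" "d2 \<in> D'" "x2 = f c2" "y2 = g d2" unfolding E'_def by blast
    then have "lt qL c1 c2" using f' h by blast
    then have "(d1, d2) \<in> qR" using pl c unfolding planar_def by blast
    then show "(y1, y2) \<in> rR" using g c by blast
  qed
  show "uncut rL rR E'"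
    unfolding uncut_def
  proof (intro allI impI, rule ccontr)
    fix P' Q' assume h: "downset rL P' \<and> downset rR Q' \<and> (\<forall>(x, y)\<in>E'. x \<in> P' \<longleftrightarrow> y \<in> Q')"
      and n: "\<not> ((\<forall>(x, y)\<in>E'. x \<in> P') \<or> (\<forall>(x, y)\<in>E'. x \<notin> P'))"
    then obtain x1 y1 x2 y2 where e: "(x1, y1) \<in> E'" "x1 \<in> P'" "(x2, y2) \<in> E'" "x2 \<notin> P'" by blast
    then have y: "y1 \<in> Q'" "y2 \<notin> Q'" using h by blast+
    obtain c1 d1 c2 d2 where c: "(c1, d1) \<in> E" "c1 \<in> D" "d1 \<in> D'" "x1 = f c1" "y1 = g d1"
      "(c2, d2) \<in> E" "c2 \<in> D" "d2 \<in> D'" "x2 = f c2" "y2 = g d2" using e unfolding E'_def by blast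
    have "f c1 \<noteq> f c2" "g d1 \<noteq> g d2" using c e y by metis+
    then have cvL: "convex_in qL D" and cvR: "convex_in qR D'" using D D' c by blast+
    have iff: "f c0 \<in> P' \<longleftrightarrow> g d0 \<in> Q'" if "(c0, d0) \<in> E" "c0 \<in> D" "d0 \<in> D'" for c0 d0
      using h that unfolding E'_def by blast
    have dnL: "f c \<in> P'" if "c \<in> D" "c' \<in> D" "(c, c') \<in> qL" "f c' \<in> P'" for c c'
      using f[OF that(1-3)] that(4) h unfolding downset_def by blast
    have dnR: "g d \<in> Q'" if "d \<in> D'" "d' \<in> D'" "(d, d') \<in> qR" "g d' \<in> Q'" for d d'
      using g[OF that(1-3)] that(4) h unfolding downset_def by blast
    define P where "P = {c. \<exists>c0 d0. (c0, d0) \<in> E \<and> c0 \<in> D \<and> d0 \<in> D' \<and> f c0 \<in> P' \<and> (c, c0) \<in> qL}"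
    define Q where "Q = {d. \<exists>c0 d0. (c0, d0) \<in> E \<and> c0 \<in> D \<and> d0 \<in> D' \<and> g d0 \<in> Q' \<and> (d, d0) \<in> qR}"
    have PI: "c \<in> P" if "(c0, d0) \<in> E" "c0 \<in> D" "d0 \<in> D'" "f c0 \<in> P'" "(c, c0) \<in> qL" for c c0 d0
      using that unfolding P_def by blast
    have QI: "d \<in> Q" if "(c0, d0) \<in> E" "c0 \<in> D" "d0 \<in> D'" "g d0 \<in> Q'" "(d, d0) \<in> qR" for d c0 d0
      using that unfolding Q_def by blast
    have PD: "f c \<in> P'" if "c \<in> P" "c \<in> D" for c using that dnL unfolding P_def by blast
    have QD: "g d \<in> Q'" if "d \<in> Q" "d \<in> D'" for d using that dnR unfolding Q_def by blast
    \<comment> \<open>\<open>c2\<close> stays above the generated segment: otherwise monotonicity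
      would put \<open>f c2\<close> into the downset \<open>P'\<close>.\<close>
    have P_lt: "lt qL c c2" if cP: "c \<in> P" for c
    proof -
      obtain c0 where "c0 \<in> D" "f c0 \<in> P'" "(c, c0) \<in> qL" using cP unfolding P_def by blast
      moreover from this have "lt qL c0 c2" using dnL c e ltL by metis
      ultimately show ?thesis using le_lt_trans[OF lin(1)] by metis
    qed
    have Q_lt: "lt qR d d2" if dQ: "d \<in> Q" for d
    proof -
      obtain d0 where "d0 \<in> D'" "g d0 \<in> Q'" "(d, d0) \<in> qR" using dQ unfolding Q_def by blast
      moreover from this have "lt qR d0 d2" using dnR c y ltR by metis
      ultimately show ?thesis using le_lt_trans[OF lin(2)] by metis
    qed
    have plR: "(c, c') \<in> qL" if "(c, d) \<in> E" "(c', d') \<in> E" "lt qR d d'" for c d c' d'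
      using pl that ltL ltR unfolding planar_def by metis
    have plL: "(d, d') \<in> qR" if "(c, d) \<in> E" "(c', d') \<in> E" "lt qL c c'" for c d c' d'
      using pl that unfolding planar_def by metis
    have outL: "lt qL c c1 \<or> lt qL c2 c" if "c \<notin> D" for c
      using cvL c that ltL lt_total[OF lin(1)] lt_imp unfolding convex_in_def by metis
    have outR: "lt qR d d1 \<or> lt qR d2 d" if "d \<notin> D'" for d
      using cvR c that ltR lt_total[OF lin(2)] lt_imp unfolding convex_in_def by metis
    have fc1: "f c1 \<in> P'" "g d1 \<in> Q'" "f c2 \<notin> P'" "g d2 \<notin> Q'" using c e y by auto
    have "c \<in> P \<longleftrightarrow> d \<in> Q" if ed: "(c, d) \<in> E" for c d
    proof (cases "c \<in> D")
      case False
      from outL[OF this] show ?thesis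
      proof
        assume l: "lt qL c c1"
        have "c \<in> P" using PI[OF c(1-3) fc1(1)] lt_imp[OF l] .
        moreover have "d \<in> Q" using QI[OF c(1-3) fc1(2)] plL[OF ed c(1) l] .
        ultimately show ?thesis by simp
      next
        assume l: "lt qL c2 c"
        have "c \<notin> P" using P_lt l lt_asym[OF lin(1)] by blast
        moreover have "d \<notin> Q" using Q_lt plL[OF c(6) ed l] ltR by blast
        ultimately show ?thesis by simp
      qed
    next
      case cD: True
      show ?thesis
      proof (cases "d \<in> D'")
        case False
        from outR[OF this] show ?thesis
        proof
          assume l: "lt qR d d1"
          have "d \<in> Q" using QI[OF c(1-3) fc1(2)] lt_imp[OF l] .
          moreover have "c \<in> P" using PI[OF c(1-3) fc1(1)] plR[OF ed c(1) l] .
          ultimately show ?thesis by simp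
        next
          assume l: "lt qR d2 d"
          have "d \<notin> Q" using Q_lt l lt_asym[OF lin(2)] by blast
          moreover have "c \<notin> P" using P_lt plR[OF c(6) ed l] ltL by blast
          ultimately show ?thesis by simp
        qed
      next
        case True
        then show ?thesis
          using iff[OF ed cD True] PD[OF _ cD] QD[OF _ True] PI[OF ed cD True] QI[OF ed cD True]
            lin_refl[OF lin(1)] lin_refl[OF lin(2)] by blast
      qed
    qed
    then have "\<forall>(c, d)\<in>E. c \<in> P \<longleftrightarrow> d \<in> Q" by blast
    moreover have "downset qL P" "downset qR Q"
      unfolding downset_def P_def Q_def using lin_trans[OF lin(1)] lin_trans[OF lin(2)] by blast+
    ultimately have "(\<forall>(c, d)\<in>E. c \<in> P) \<or> (\<forall>(c, d)\<in>E. c \<notin> P)" using un unfolding uncut_def by blast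
    moreover have "c1 \<in> P" using PI[OF c(1-3) fc1(1)] lin_refl[OF lin(1)] by blast
    moreover have "c2 \<notin> P" using P_lt[of c2] by auto
    ultimately show False using c by blast
  qed
qed

lemma lcs_branch: "x \<noteq> y \<Longrightarrow> lcs (u @ [x] @ s) (v @ [y] @ s) = s"
  unfolding lcs_def using lcp_branch[of x y "rev s" "rev u" "rev v"] by simp

text \<open>Words ending in different letters followed by the same \<open>s\<close> separate exactly
  at \<open>s\<close>. For \<open>s\<close> outside \<open>TL \<sigma>\<close> the map
  \<open>phiL \<sigma> s\<close> is therefore constant, so conditions indexed by
  \<open>TL \<sigma>\<close> control all \<open>s\<close>.\<close>

lemma TL_I:
  assumes "c \<in> AL \<sigma> s" "d \<in> AL \<sigma> s" "phiL \<sigma> s c \<noteq> phiL \<sigma> s d" shows "s \<in> TL \<sigma>"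
proof -
  obtain z x z' x' where "\<sigma> c = z @ [x] @ s" "\<sigma> d = z' @ [x'] @ s" using assms AL_iff by metis
  moreover from this have "x \<noteq> x'" using assms(3) phiL_eq by metis
  moreover from this have "c \<noteq> d" using assms(3) by auto
  ultimately show ?thesis unfolding TL_def using lcs_branch by (metis (mono_tags, lifting) mem_Collect_eq)
qed

lemma TR_I:
  assumes "c \<in> AR \<sigma> p" "d \<in> AR \<sigma> p" "phiR \<sigma> p c \<noteq> phiR \<sigma> p d" shows "p \<in> TR \<sigma>"
proof -
  obtain z x z' x' where "\<sigma> c @ ret_word \<sigma> = p @ [x] @ z" "\<sigma> d @ ret_word \<sigma> = p @ [x'] @ z'"
    using assms AR_iff by metis
  moreover from this have "x \<noteq> x'" using assms(3) phiR_eq by metis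
  moreover from this have "c \<noteq> d" using assms(3) by auto
  ultimately show ?thesis unfolding TR_def using lcp_branch by (metis (mono_tags, lifting) mem_Collect_eq)
qed

text \<open>A cut is closed under the edges of the bipartite extension graph, and that graph is
  connected.\<close>

lemma ext_graph_uncut:
  assumes tree: "ext_graph_tree G u" and fac: "\<And>v x. v \<in> G \<Longrightarrow> sublist x v \<Longrightarrow> x \<in> G"
  shows "uncut rL rR (ext G u)"
  unfolding uncut_def
proof (intro allI impI, rule ccontr)
  fix P Q assume h: "downset rL P \<and> downset rR Q \<and> (\<forall>(c, d)\<in>ext G u. c \<in> P \<longleftrightarrow> d \<in> Q)"
    and n: "\<not> ((\<forall>(c, d)\<in>ext G u. c \<in> P) \<or> (\<forall>(c, d)\<in>ext G u. c \<notin> P))"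
  then obtain c1 d1 c2 d2 where e: "(c1, d1) \<in> ext G u" "c1 \<in> P" "(c2, d2) \<in> ext G u" "c2 \<notin> P" by blast
  let ?E = "{{Inl c, Inr d} | c d. (c, d) \<in> ext G u}"
  have V: "c \<in> ext_L G u" if "(c, d) \<in> ext G u" for c d
  proof -
    have "[c] @ u @ [d] \<in> G" using that by (simp add: ext_def)
    then show ?thesis using fac[of "[c] @ u @ [d]" "[c] @ u"] unfolding ext_L_def by (auto simp: sublist_def)
  qed
  have "(Inl c1, Inl c2) \<in> {(p, q). {p, q} \<in> ?E \<and> p \<noteq> q}\<^sup>*"
    using tree V[OF e(1)] V[OF e(3)] unfolding ext_graph_tree_def ug_tree_def ug_connected_def by blast
  then have "Inl c2 \<in> Inl ` P \<union> Inr ` Q"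
  proof (induction rule: rtrancl_induct)
    case base
    then show ?case using e by blast
  next
    case (step p q)
    then obtain c d where cd: "{p, q} = {Inl c, Inr d}" "(c, d) \<in> ext G u" by blast
    then have "c \<in> P \<longleftrightarrow> d \<in> Q" using h by blast
    then show ?case using cd(1) step.IH by (auto simp: doubleton_eq_iff)
  qed
  then show False using e by auto
qed

lemma lang_morph_factorial: "v \<in> lang_morph \<sigma> \<Longrightarrow> sublist x v \<Longrightarrow> x \<in> lang_morph \<sigma>"
  unfolding lang_morph_def factors_eq by (auto intro: sublist_order.order.trans)

context image_step
begin

text \<open>Words without \<open>w\<close> are governed by the morphism itself, words with
  \<open>w\<close> by an extension set upstairs. The hypothesis \<open>IH\<close> concerns only
  those \<open>v\<close> whose image followed by \<open>w\<close> fits into \<open>u\<close>, which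
  makes an induction on length possible.\<close>

lemma staircase_step:
  assumes full: "\<forall>c. [c] \<in> F" and dend: "dendric_morph \<sigma>"
    and lin: "linear_order qL" "linear_order qR" "linear_order rL" "linear_order rR"
    and pm: "planar_morph rL rR \<sigma>" and pp: "planar_preserving \<sigma> qL qR rL rR"
    and cL: "\<forall>s\<in>TL \<sigma>. convex_in qL (AL \<sigma> s)" and cR: "\<forall>p\<in>TR \<sigma>. convex_in qR (AR \<sigma> p)"
    and u: "u \<in> F0"
    and IH: "\<And>v. v \<in> F \<Longrightarrow> sublist w u \<Longrightarrow> length (morph_app \<sigma> v) + length w \<le> length u \<Longrightarrow>
       planar qL qR (ext F v) \<and> uncut qL qR (ext F v)"
  shows "planar rL rR (ext F0 u) \<and> uncut rL rR (ext F0 u)"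
proof (cases "sublist w u")
  case False
  have eq: "ext F0 u = ext (lang_morph \<sigma>) u"
    using ext_initial[OF False] lang_morph_subset[OF full] unfolding ext_def by blast
  obtain c d where "[c] @ u @ [d] \<in> F0" using u bi0 unfolding biextendable_def by blast
  then have "(c, d) \<in> ext F0 u" by (simp add: ext_def)
  then have "(c, d) \<in> ext (lang_morph \<sigma>) u" unfolding eq .
  then have "[c] @ u @ [d] \<in> lang_morph \<sigma>" by (simp add: ext_def)
  then have "u \<in> lang_morph \<sigma>" by (rule lang_morph_factorial) (rule sublist_appendI)
  then have init: "sigma_initial \<sigma> u" unfolding sigma_initial_def factors_eq using False by simp
  then have "planar rL rR (ext (lang_morph \<sigma>) u)" using pm unfolding planar_morph_def planar_word_iff by blast
  moreover have "uncut rL rR (ext (lang_morph \<sigma>) u)"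
    using dend init lang_morph_factorial unfolding dendric_morph_def by (intro ext_graph_uncut) auto
  ultimately show ?thesis using eq by simp
next
  case True
  obtain s v t where d: "u = s @ morph_app \<sigma> v @ w @ t" "only_suffix s" "only_prefix (w @ t)" "v \<in> F"
    using decompose[OF u True] .
  have "planar qL qR (ext F v)" "uncut qL qR (ext F v)" using IH[OF d(4) True] d(1) by auto
  moreover have "(phiL \<sigma> s c, phiL \<sigma> s c') \<in> rL"
    if "c \<in> AL \<sigma> s" "c' \<in> AL \<sigma> s" "(c, c') \<in> qL" for c c'
  proof (cases "phiL \<sigma> s c = phiL \<sigma> s c'")
    case False
    then have "s \<in> TL \<sigma>" "lt qL c c'" using TL_I that by (auto simp: lt_def)
    then show ?thesis using pp that unfolding planar_preserving_def order_preserving_def by blast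
  qed (simp add: lin_refl lin)
  moreover have "(phiR \<sigma> (w @ t) c, phiR \<sigma> (w @ t) c') \<in> rR"
    if "c \<in> AR \<sigma> (w @ t)" "c' \<in> AR \<sigma> (w @ t)" "(c, c') \<in> qR" for c c'
  proof (cases "phiR \<sigma> (w @ t) c = phiR \<sigma> (w @ t) c'")
    case False
    then have "w @ t \<in> TR \<sigma>" "lt qR c c'" using TR_I that by (auto simp: lt_def)
    then show ?thesis using pp that unfolding planar_preserving_def order_preserving_def by blast
  qed (simp add: lin_refl lin)
  moreover have "convex_in qL (AL \<sigma> s)" if "c \<in> AL \<sigma> s" "c' \<in> AL \<sigma> s" "phiL \<sigma> s c \<noteq> phiL \<sigma> s c'" for c c'
    using TL_I[OF that] cL by blast
  moreover have "convex_in qR (AR \<sigma> (w @ t))"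
    if "c \<in> AR \<sigma> (w @ t)" "c' \<in> AR \<sigma> (w @ t)" "phiR \<sigma> (w @ t) c \<noteq> phiR \<sigma> (w @ t) c'" for c c'
    using TR_I[OF that] cR by blast
  ultimately show ?thesis
    unfolding d(1) ext_image[OF d(2,3)]
    using staircase_image[OF lin, of "ext F v" "AL \<sigma> s" "phiL \<sigma> s" "AR \<sigma> (w @ t)" "phiR \<sigma> (w @ t)"] by blast
qed

section \<open>The words carrying the two lexicographic orders\<close>

abbreviation WL where "WL \<equiv> \<lambda>c. rev (\<sigma> c)"
abbreviation WR where "WR \<equiv> \<lambda>c. \<sigma> c @ w"

lemma prefix_free_WR: "prefix_free WR"
  unfolding prefix_free_def
proof (intro allI impI)
  fix c d x assume "(\<sigma> c @ w) @ x = \<sigma> d @ w"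
  then have "\<sigma> c = \<sigma> d" using occ_block[of d "\<sigma> c" x] by auto
  then have "morph_app \<sigma> [c] = morph_app \<sigma> [d]" by simp
  then show "c = d" using inj by blast
qed

text \<open>If \<open>\<sigma> c\<close> were a proper suffix of \<open>\<sigma> d\<close>, the
  \<open>w\<close> at the start of \<open>\<sigma> c @ w\<close> would be a third occurrence in
  \<open>\<sigma> d @ w\<close>.\<close>

lemma prefix_free_WL: "prefix_free WL"
  unfolding prefix_free_def
proof (intro allI impI)
  fix c d x assume "rev (\<sigma> c) @ x = rev (\<sigma> d)"
  then have d: "\<sigma> d = rev x @ \<sigma> c" by (metis rev_append rev_rev_ident)
  obtain z where z: "\<sigma> c @ w = w @ z" using block_prefix by auto
  then have "\<sigma> d @ w = rev x @ w @ z" using d by simp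
  then have "rev x = [] \<or> z = []" using occ_block[of d "rev x" z] by auto
  moreover have "z \<noteq> []" using z by auto
  ultimately have "\<sigma> c = \<sigma> d" using d by simp
  then have "morph_app \<sigma> [c] = morph_app \<sigma> [d]" by simp
  then show "c = d" using inj by blast
qed

lemma starts_WL: "starts WL p c x \<longleftrightarrow> (\<exists>z. \<sigma> c = z @ [x] @ rev p)"
proof
  assume "starts WL p c x"
  then obtain u where "rev (\<sigma> c) = p @ [x] @ u" unfolding starts_def by auto
  then have "\<sigma> c = rev u @ [x] @ rev p" by (simp add: rev_swap)
  then show "\<exists>z. \<sigma> c = z @ [x] @ rev p" by blast
qed (auto simp: starts_def)

lemma starts_WR: "starts WR p c x \<longleftrightarrow> (\<exists>z. \<sigma> c @ w = p @ [x] @ z)"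
  by (simp add: starts_def)

lemma AL_starts: "AL \<sigma> s = {c. \<exists>x. starts WL (rev s) c x}"
  using AL_iff[of _ \<sigma> s] unfolding starts_WL by auto

lemma AR_starts: "AR \<sigma> p = {c. \<exists>x. starts WR p c x}"
  using AR_iff[of _ \<sigma> p] unfolding starts_WR by auto

lemma phiL_starts: "starts WL (rev s) c x \<Longrightarrow> phiL \<sigma> s c = x"
  unfolding starts_WL using phiL_eq[of \<sigma> c _ x s] by auto

lemma phiR_starts: "starts WR p c x \<Longrightarrow> phiR \<sigma> p c = x"
  unfolding starts_WR using phiR_eq[of \<sigma> c p x] by auto

lemma TL_rev: "TL \<sigma> = rev ` {lcp (WL c) (WL d) | c d. c \<noteq> d}"
  unfolding TL_def lcs_def by auto

end

section \<open>Derivation of a staircase language\<close>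

text \<open>The validity conditions are thus blind to reversing an order, so the orientation can be
  chosen afterwards by looking at \<open>a\<close> and \<open>b\<close>.\<close>

lemma order_graph_converse: "order_graph (r\<inverse>) = order_graph r"
proof -
  have "{{c, d} | c d. lt (r\<inverse>) c d \<and> \<not> (\<exists>e. lt (r\<inverse>) c e \<and> lt (r\<inverse>) e d)} =
    {{c, d} | c d. lt r c d \<and> \<not> (\<exists>e. lt r c e \<and> lt r e d)}" (is "?A = ?B")
  proof (intro set_eqI iffI)
    fix C assume "C \<in> ?A"
    then obtain c d where "C = {c, d}" "lt r d c" "\<not> (\<exists>e. lt r e c \<and> lt r d e)" by auto
    then have "C = {d, c} \<and> lt r d c \<and> \<not> (\<exists>e. lt r d e \<and> lt r e c)" by auto
    then show "C \<in> ?B" by blast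
  next
    fix C assume "C \<in> ?B"
    then obtain c d where "C = {c, d}" "lt r c d" "\<not> (\<exists>e. lt r c e \<and> lt r e d)" by auto
    then have "C = {d, c} \<and> lt (r\<inverse>) d c \<and> \<not> (\<exists>e. lt (r\<inverse>) d e \<and> lt (r\<inverse>) e c)" by auto
    then show "C \<in> ?A" by blast
  qed
  then show ?thesis unfolding order_graph_def by simp
qed

locale derive_step = image_step \<sigma> F F0
  for \<sigma> :: "'a::finite \<Rightarrow> 'a list" and F F0 :: "'a list set" +
  fixes rL rR :: "('a \<times> 'a) set"
  assumes linL: "linear_order rL" and linR: "linear_order rR"
    and full0: "\<forall>c. [c] \<in> F0" and st: "staircase rL rR F0"
begin

abbreviation pL where "pL \<equiv> lex_order WL rL"
abbreviation pR where "pR \<equiv> lex_order WR rR"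

lemma lin_pL: "linear_order pL" by (rule lex_linear[OF linL prefix_free_WL])
lemma lin_pR: "linear_order pR" by (rule lex_linear[OF linR prefix_free_WR])

lemma only_suffix_starts: "starts WL q c x \<Longrightarrow> only_suffix (rev q)"
  unfolding starts_WL using only_suffixI[of c "_ @ [_]" "rev q"] by auto

lemma only_prefix_starts: "starts WR p c x \<Longrightarrow> only_prefix p"
  unfolding starts_WR using only_prefixI[of c p] by auto

text \<open>All words \<open>\<sigma> c @ w\<close> begin with \<open>w\<close>, so two of them can
  only separate behind it. Branching prefixes on the right therefore have the form treated in
  \<open>ext_image\<close>.\<close>

lemma branch_has_w:
  assumes "starts WR p c x" "starts WR p d y" "x \<noteq> y"
  shows "\<exists>t. p = w @ t"
proof -
  obtain z z' where z: "\<sigma> c @ w = w @ z" "\<sigma> d @ w = w @ z'" using block_prefix by metis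
  obtain u u' where u: "\<sigma> c @ w = p @ [x] @ u" "\<sigma> d @ w = p @ [y] @ u'" using assms unfolding starts_WR by auto
  have "length w \<le> length p"
  proof (rule ccontr)
    assume l: "\<not> ?thesis"
    have "(w @ z) ! length p = x" unfolding z(1)[symmetric] u(1) by (simp add: nth_append)
    moreover have "(w @ z') ! length p = y" unfolding z(2)[symmetric] u(2) by (simp add: nth_append)
    ultimately show False using l assms(3) by (simp add: nth_append)
  qed
  moreover have "w @ z = p @ [x] @ u" using z u by simp
  ultimately show ?thesis using append_eq_longer by blast
qed

lemma mem_ext:
  assumes "(c, d) \<in> ext F v" "starts WL q c x" "starts WR (w @ t) d y"
  shows "(x, y) \<in> ext F0 (rev q @ morph_app \<sigma> v @ w @ t)"
proof -
  have "c \<in> AL \<sigma> (rev q)" "phiL \<sigma> (rev q) c = x"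
    using assms(2) phiL_starts[of "rev q"] by (auto simp: AL_starts)
  moreover have "d \<in> AR \<sigma> (w @ t)" "phiR \<sigma> (w @ t) d = y"
    using assms(3) phiR_starts by (auto simp: AR_starts)
  ultimately show ?thesis
    unfolding ext_image[OF only_suffix_starts[OF assms(2)] only_prefix_starts[OF assms(3)]]
    using assms(1) by blast
qed

lemma ext_nonempty_mem: "(x, y) \<in> ext F0 u \<Longrightarrow> u \<in> F0"
  using biextendable_factor[OF bi0, of "[x]" u "[y]"] by (simp add: ext_def)

text \<open>Take the prefixes at which the two left letters and the two right letters separate.
  Placed around \<open>morph_app \<sigma> v\<close> they form a word downstairs whose extension set
  shows the same inversion.\<close>

lemma planar_F: "planar pL pR (ext F v)"
  unfolding planar_def
proof (intro allI impI)
  fix c1 d1 c2 d2 assume h: "(c1, d1) \<in> ext F v \<and> (c2, d2) \<in> ext F v \<and> lt pL c1 c2"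
  show "(d1, d2) \<in> pR"
  proof (rule ccontr)
    assume "(d1, d2) \<notin> pR"
    then have "lt pR d2 d1" using lt_iff[OF lin_pR] by blast
    then obtain p y2 y1 where p: "starts WR p d2 y2" "starts WR p d1 y1" "lt rR y2 y1"
      unfolding lt_lex[OF linR] by blast
    obtain q x1 x2 where q: "starts WL q c1 x1" "starts WL q c2 x2" "lt rL x1 x2"
      using h unfolding lt_lex[OF linL] by blast
    obtain t where t: "p = w @ t" using branch_has_w[OF p(1,2)] p(3) by (auto simp: lt_def)
    let ?u = "rev q @ morph_app \<sigma> v @ w @ t"
    have 1: "(x1, y1) \<in> ext F0 ?u" using mem_ext h q p unfolding t by blast
    have 2: "(x2, y2) \<in> ext F0 ?u" using mem_ext h q p unfolding t by blast
    have "planar rL rR (ext F0 ?u)" using st ext_nonempty_mem[OF 1] unfolding staircase_def by blast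
    then have "(y1, y2) \<in> rR" using 1 2 q(3) unfolding planar_def by blast
    then show False using p(3) lt_iff[OF linR] by blast
  qed
qed

text \<open>Among the letters occurring in edges, let \<open>c1\<close>, \<open>d1\<close> be the
  last below the cut and \<open>c2\<close>, \<open>d2\<close> the first above it. At the prefixes
  where \<open>c1\<close> separates from \<open>c2\<close> and \<open>d1\<close> from
  \<open>d2\<close>, monotonicity carries the cut to an extension set downstairs, with the images of
  \<open>(c1, d1)\<close> and \<open>(c2, d2)\<close> on different sides.\<close>

lemma uncut_F: "uncut pL pR (ext F v)"
  unfolding uncut_def
proof (intro allI impI, rule ccontr)
  fix P Q assume h: "downset pL P \<and> downset pR Q \<and> (\<forall>(c, d)\<in>ext F v. c \<in> P \<longleftrightarrow> d \<in> Q)"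
    and n: "\<not> ((\<forall>(c, d)\<in>ext F v. c \<in> P) \<or> (\<forall>(c, d)\<in>ext F v. c \<notin> P))"
  let ?E = "ext F v"
  have iff: "c \<in> P \<longleftrightarrow> d \<in> Q" if "(c, d) \<in> ?E" for c d using h that by blast
  obtain a1 b1 a2 b2 where ab: "(a1, b1) \<in> ?E" "a1 \<in> P" "(a2, b2) \<in> ?E" "a2 \<notin> P" using n by blast
  then have b: "b1 \<in> Q" "b2 \<notin> Q" using iff by blast+
  obtain c1 where c1: "c1 \<in> P" "\<exists>d. (c1, d) \<in> ?E" "\<forall>c d. (c, d) \<in> ?E \<and> c \<in> P \<longrightarrow> (c, c1) \<in> pL"
    using lin_max[OF lin_pL, of "{c \<in> P. \<exists>d. (c, d) \<in> ?E}"] ab by auto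
  obtain c2 where c2: "c2 \<notin> P" "\<exists>d. (c2, d) \<in> ?E" "\<forall>c d. (c, d) \<in> ?E \<and> c \<notin> P \<longrightarrow> (c2, c) \<in> pL"
    using lin_min[OF lin_pL, of "{c. c \<notin> P \<and> (\<exists>d. (c, d) \<in> ?E)}"] ab by auto
  obtain d1 where d1: "d1 \<in> Q" "\<exists>c. (c, d1) \<in> ?E" "\<forall>c d. (c, d) \<in> ?E \<and> d \<in> Q \<longrightarrow> (d, d1) \<in> pR"
    using lin_max[OF lin_pR, of "{d \<in> Q. \<exists>c. (c, d) \<in> ?E}"] ab b by auto
  obtain d2 where d2: "d2 \<notin> Q" "\<exists>c. (c, d2) \<in> ?E" "\<forall>c d. (c, d) \<in> ?E \<and> d \<notin> Q \<longrightarrow> (d2, d) \<in> pR"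
    using lin_min[OF lin_pR, of "{d. d \<notin> Q \<and> (\<exists>c. (c, d) \<in> ?E)}"] ab b by auto
  \<comment> \<open>If the edge ending at \<open>d1\<close> starts below \<open>c1\<close>,
    planarity pushes the edges at \<open>c1\<close> up to \<open>d1\<close>, which is already the
    largest end below the cut.\<close>
  have E1: "(c1, d1) \<in> ?E"
  proof -
    obtain e where e: "(c1, e) \<in> ?E" using c1(2) by blast
    then have eQ: "(e, d1) \<in> pR" using iff c1(1) d1(3) by blast
    obtain f where f: "(f, d1) \<in> ?E" using d1(2) by blast
    then have fP: "(f, c1) \<in> pL" using iff d1(1) c1(3) by blast
    show ?thesis
    proof (cases "f = c1")
      case False
      then have "lt pL f c1" using fP by (simp add: lt_def)
      then have "(d1, e) \<in> pR" using planar_F e f unfolding planar_def by blast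
      then have "e = d1" using eQ lin_antisym[OF lin_pR] by blast
      then show ?thesis using e by simp
    qed (use f in simp)
  qed
  have E2: "(c2, d2) \<in> ?E"
  proof -
    obtain e where e: "(c2, e) \<in> ?E" using c2(2) by blast
    then have eQ: "(d2, e) \<in> pR" using iff c2(1) d2(3) by blast
    obtain f where f: "(f, d2) \<in> ?E" using d2(2) by blast
    then have fP: "(c2, f) \<in> pL" using iff d2(1) c2(3) by blast
    show ?thesis
    proof (cases "f = c2")
      case False
      then have "lt pL c2 f" using fP by (simp add: lt_def)
      then have "(e, d2) \<in> pR" using planar_F e f unfolding planar_def by blast
      then have "e = d2" using eQ lin_antisym[OF lin_pR] by blast
      then show ?thesis using e by simp
    qed (use f in simp)
  qed
  have lc: "lt pL c1 c2" using h c1(1) c2(1) lt_iff[OF lin_pL] unfolding downset_def by blast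
  have ld: "lt pR d1 d2" using h d1(1) d2(1) lt_iff[OF lin_pR] unfolding downset_def by blast
  obtain q x1 x2 where q: "starts WL q c1 x1" "starts WL q c2 x2" "lt rL x1 x2"
    using lc unfolding lt_lex[OF linL] by blast
  obtain p y1 y2 where p: "starts WR p d1 y1" "starts WR p d2 y2" "lt rR y1 y2"
    using ld unfolding lt_lex[OF linR] by blast
  obtain t where t: "p = w @ t" using branch_has_w[OF p(1,2)] p(3) by (auto simp: lt_def)
  note p = p[unfolded t]
  let ?u = "rev q @ morph_app \<sigma> v @ w @ t"
  have u1: "(x1, y1) \<in> ext F0 ?u" by (rule mem_ext[OF E1 q(1) p(1)])
  have u2: "(x2, y2) \<in> ext F0 ?u" by (rule mem_ext[OF E2 q(2) p(2)])
  have "x \<in> {x. (x, x1) \<in> rL} \<longleftrightarrow> y \<in> {y. (y, y1) \<in> rR}" if xy: "(x, y) \<in> ext F0 ?u" for x y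
  proof -
    obtain c d where cd: "x = phiL \<sigma> (rev q) c" "y = phiR \<sigma> (w @ t) d" "(c, d) \<in> ?E"
      "c \<in> AL \<sigma> (rev q)" "d \<in> AR \<sigma> (w @ t)"
      using xy unfolding ext_image[OF only_suffix_starts[OF q(1)] only_prefix_starts[OF p(1)]] by blast
    have c: "starts WL q c x" using cd(4) unfolding AL_starts cd(1) using phiL_starts[of "rev q" c] by auto
    have d: "starts WR (w @ t) d y" using cd(5) unfolding AR_starts cd(2) using phiR_starts[of "w @ t" d] by auto
    show ?thesis
    proof (cases "c \<in> P")
      case True
      then have "(c, c1) \<in> pL" "(d, d1) \<in> pR" using cd(3) c1(3) d1(3) iff by blast+
      then show ?thesis using lex_mono[OF linL c q(1)] lex_mono[OF linR d p(1)] by simp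
    next
      case False
      then have "(c2, c) \<in> pL" "(d2, d) \<in> pR" using cd(3) c2(3) d2(3) iff by blast+
      then have "(x2, x) \<in> rL" "(y2, y) \<in> rR" using lex_mono[OF linL q(2) c] lex_mono[OF linR p(2) d] by simp_all
      then have "lt rL x1 x" "lt rR y1 y" using q(3) p(3) lt_le_trans[OF linL] lt_le_trans[OF linR] by blast+
      then show ?thesis using lt_iff[OF linL] lt_iff[OF linR] by blast
    qed
  qed
  then have "\<forall>(x, y)\<in>ext F0 ?u. x \<in> {x. (x, x1) \<in> rL} \<longleftrightarrow> y \<in> {y. (y, y1) \<in> rR}" by blast
  moreover have "downset rL {x. (x, x1) \<in> rL}" "downset rR {y. (y, y1) \<in> rR}"
    unfolding downset_def using lin_trans[OF linL] lin_trans[OF linR] by blast+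
  moreover have "uncut rL rR (ext F0 ?u)" using st ext_nonempty_mem[OF u1] unfolding staircase_def by blast
  ultimately have "(\<forall>(x, y)\<in>ext F0 ?u. x \<in> {x. (x, x1) \<in> rL}) \<or> (\<forall>(x, y)\<in>ext F0 ?u. x \<notin> {x. (x, x1) \<in> rL})"
    unfolding uncut_def by blast
  then show False using u1 u2 q(3) lt_iff[OF linL] lin_refl[OF linL] by blast
qed

section \<open>Covering pairs of letters downstairs and branching blocks upstairs\<close>

lemma share_right:
  assumes "cover rL x y" shows "\<exists>u. length u = n \<and> [x] @ u \<in> F0 \<and> [y] @ u \<in> F0"
proof (induction n)
  case 0
  then show ?case using full0 by simp
next
  case (Suc n)
  then obtain u where u: "length u = n" "[x] @ u \<in> F0" "[y] @ u \<in> F0" by blast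
  then have uF: "u \<in> F0" using biextendable_factor[OF bi0, of "[x]" u "[]"] by simp
  have "\<exists>d. (x, d) \<in> ext F0 u" "\<exists>d. (y, d) \<in> ext F0 u"
    using biextendable_ext_right[OF bi0 u(2)] biextendable_ext_right[OF bi0 u(3)] by (auto simp: ext_def)
  then obtain d where "(x, d) \<in> ext F0 u" "(y, d) \<in> ext F0 u"
    using staircase_share[OF linL linR _ _ assms, of "ext F0 u"] st uF unfolding staircase_def by blast
  then show ?case using u(1) by (intro exI[of _ "u @ [d]"]) (simp add: ext_def)
qed

lemma share_left:
  assumes "cover rR x y" shows "\<exists>u. length u = n \<and> u @ [x] \<in> F0 \<and> u @ [y] \<in> F0"
proof (induction n)
  case 0
  then show ?case using full0 by simp
next
  case (Suc n)
  then obtain u where u: "length u = n" "u @ [x] \<in> F0" "u @ [y] \<in> F0" by blast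
  then have uF: "u \<in> F0" using biextendable_factor[OF bi0, of "[]" u "[x]"] by simp
  have "planar rR rL ((ext F0 u)\<inverse>)" "uncut rR rL ((ext F0 u)\<inverse>)"
    using st uF planar_swap[OF linL linR] uncut_swap unfolding staircase_def by blast+
  moreover have "\<exists>d. (x, d) \<in> (ext F0 u)\<inverse>" "\<exists>d. (y, d) \<in> (ext F0 u)\<inverse>"
    using biextendable_ext_left[OF bi0 u(2)] biextendable_ext_left[OF bi0 u(3)] by (auto simp: ext_def)
  ultimately obtain d where "(x, d) \<in> (ext F0 u)\<inverse>" "(y, d) \<in> (ext F0 u)\<inverse>"
    using staircase_share[OF linR linL _ _ assms, of "(ext F0 u)\<inverse>"] by blast
  then show ?case using u(1) by (intro exI[of _ "[d] @ u"]) (simp add: ext_def)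
qed

lemma left_letter:
  assumes "[x] @ s @ w \<in> F0" "only_suffix s"
  shows "\<exists>c. [c] \<in> F \<and> starts WL (rev s) c x"
proof -
  obtain V a b where V: "V \<in> F" "morph_app \<sigma> V @ w = a @ ([x] @ s @ w) @ b" using assms(1) by (elim memE)
  then have "morph_app \<sigma> V @ w = (a @ [x] @ s) @ w @ b" by simp
  from parse_one[OF this] obtain V1 V2 where P: "V = V1 @ V2" "a @ [x] @ s = morph_app \<sigma> V1" by auto
  from parse_left[OF P(2)[symmetric] assms(2)] obtain V' c z where "V1 = V' @ [c]" "\<sigma> c = z @ [x] @ s" by auto
  moreover from this have "[c] \<in> F" using P(1) V(1) biextendable_factor[OF bi, of V' "[c]" V2] by simp
  ultimately show ?thesis unfolding starts_WL by auto
qed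

lemma right_letter:
  assumes "w @ t @ [y] \<in> F0" "only_prefix (w @ t)"
  shows "\<exists>d. [d] \<in> F \<and> starts WR (w @ t) d y"
proof -
  obtain V a b where V: "V \<in> F" "morph_app \<sigma> V @ w = a @ (w @ t @ [y]) @ b" using assms(1) by (elim memE)
  then have "morph_app \<sigma> V @ w = a @ w @ (t @ [y] @ b)" by simp
  from parse_one[OF this] obtain V1 V2 where P: "V = V1 @ V2" "w @ t @ [y] @ b = morph_app \<sigma> V2 @ w" by auto
  then have "morph_app \<sigma> V2 @ w = (w @ t) @ [y] @ b" by simp
  from parse_right[OF this assms(2)] obtain d V' z where "V2 = d # V'" "\<sigma> d @ w = (w @ t) @ [y] @ z" by auto
  moreover from this have "[d] \<in> F" using P(1) V(1) biextendable_factor[OF bi, of V1 "[d]" V'] by simp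
  ultimately show ?thesis unfolding starts_WR by auto
qed

lemma long_has_w: "\<exists>K. \<forall>u\<in>F0. K \<le> length u \<longrightarrow> sublist w u"
proof -
  obtain K where "\<forall>e. length (\<sigma> e @ w) \<le> K" using return_bound by blast
  then show ?thesis using long_contains mem_iff by blast
qed

text \<open>Neighbouring letters have common right extensions of every length, by
  \<open>share_right\<close>. One that contains \<open>w\<close> exposes, before its first
  \<open>w\<close>, two blocks ending in \<open>[x] @ s\<close> and \<open>[y] @ s\<close>.\<close>

lemma branch_left:
  assumes "cover rL x y"
  shows "\<exists>p. \<exists>c\<in>{c. [c] \<in> F}. \<exists>d\<in>{c. [c] \<in> F}. starts WL p c x \<and> starts WL p d y"
proof -
  obtain K where K: "\<forall>u\<in>F0. K \<le> length u \<longrightarrow> sublist w u" using long_has_w by blast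
  obtain u where u: "length u = K" "[x] @ u \<in> F0" "[y] @ u \<in> F0" using share_right[OF assms] by blast
  then have "u \<in> F0" using biextendable_factor[OF bi0, of "[x]" u "[]"] by simp
  then obtain s b where s: "u = s @ w @ b" "only_suffix s" using K u(1) first_occ by blast
  have "[x] @ s @ w \<in> F0" "[y] @ s @ w \<in> F0"
    using u(2,3) s(1) biextendable_factor[OF bi0, of "[]" _ b] by auto
  then show ?thesis using left_letter[OF _ s(2)] by blast
qed

lemma branch_right:
  assumes "cover rR x y"
  shows "\<exists>p. \<exists>c\<in>{c. [c] \<in> F}. \<exists>d\<in>{c. [c] \<in> F}. starts WR p c x \<and> starts WR p d y"
proof -
  obtain K where K: "\<forall>u\<in>F0. K \<le> length u \<longrightarrow> sublist w u" using long_has_w by blast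
  obtain u where u: "length u = K" "u @ [x] \<in> F0" "u @ [y] \<in> F0" using share_left[OF assms] by blast
  then have "u \<in> F0" using biextendable_factor[OF bi0, of "[]" u "[x]"] by simp
  then obtain a t where s: "u = a @ w @ t" "only_prefix (w @ t)" using K u(1) last_occ by blast
  have "w @ t @ [x] \<in> F0" "w @ t @ [y] \<in> F0"
    using u(2,3) s(1) biextendable_factor[OF bi0, of a _ "[]"] by auto
  then show ?thesis using right_letter[OF _ s(2)] by blast
qed

lemma letters_nonempty: "{c. [c] \<in> F} \<noteq> {}"
  using biextendable_ext_left[OF bi biextendable_Nil[OF bi]] by auto

lemmas refine_left = lex_refine[OF linL prefix_free_WL letters_nonempty branch_left]
lemmas refine_right = lex_refine[OF linR prefix_free_WR letters_nonempty branch_right]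

text \<open>The counting of covering pairs in \<open>lex_refine\<close>, applied to the set of
  letters occurring in \<open>F\<close>, forces that set to be the whole alphabet.\<close>

lemma full: "\<forall>c. [c] \<in> F"
  using refine_left by blast

lemma convex_left: "convex_in pL (AL \<sigma> s)"
  unfolding convex_in_def AL_starts
  by (auto dest: lex_interval[OF linL, where W = WL])

lemma convex_right: "convex_in pR (AR \<sigma> p)"
  unfolding convex_in_def AR_starts
  by (auto dest: lex_interval[OF linR, where W = WR])

lemma cliques_left: "filter_mset (\<lambda>C. 2 \<le> card C) (sigmaL \<sigma> (order_graph pL)) = order_graph rL"
proof -
  obtain G P where G: "bij_betw G (nonmin rL) (nonmin pL)"
    "\<forall>y\<in>nonmin rL. starts WL (P y) (G y) y \<and> starts WL (P y) (pred_of pL (G y)) (pred_of rL y)"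
    using refine_left by blast
  have im: "phiL \<sigma> (rev p) ` (C \<inter> AL \<sigma> (rev p)) = (\<lambda>c. WL c ! length p) ` (C \<inter> {c. \<exists>x. starts WL p c x})" for p C
    unfolding AL_starts rev_rev_ident
  proof (rule image_cong)
    fix c assume "c \<in> C \<inter> {c. \<exists>x. starts WL p c x}"
    then obtain x where x: "starts WL p c x" by blast
    then have "phiL \<sigma> (rev p) c = x" using phiL_starts[of "rev p" c x] by simp
    then show "phiL \<sigma> (rev p) c = WL c ! length p" using x unfolding starts_nth by simp
  qed simp
  have "sigmaL \<sigma> (order_graph pL) = (\<Sum>p\<in>{lcp (WL c) (WL d) | c d. c \<noteq> d}.
     image_mset (\<lambda>C. (\<lambda>c. WL c ! length p) ` (C \<inter> {c. \<exists>x. starts WL p c x})) (order_graph pL))"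
    unfolding sigmaL_def TL_rev by (subst sum.reindex) (simp_all add: im)
  then show ?thesis using lex_cliques[OF linL prefix_free_WL G] by simp
qed

lemma cliques_right: "filter_mset (\<lambda>C. 2 \<le> card C) (sigmaR \<sigma> (order_graph pR)) = order_graph rR"
proof -
  obtain G P where G: "bij_betw G (nonmin rR) (nonmin pR)"
    "\<forall>y\<in>nonmin rR. starts WR (P y) (G y) y \<and> starts WR (P y) (pred_of pR (G y)) (pred_of rR y)"
    using refine_right by blast
  have im: "phiR \<sigma> p ` (C \<inter> AR \<sigma> p) = (\<lambda>c. WR c ! length p) ` (C \<inter> {c. \<exists>x. starts WR p c x})" for p C
    unfolding AR_starts phiR_def ..
  have "sigmaR \<sigma> (order_graph pR) = (\<Sum>p\<in>{lcp (WR c) (WR d) | c d. c \<noteq> d}.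
     image_mset (\<lambda>C. (\<lambda>c. WR c ! length p) ` (C \<inter> {c. \<exists>x. starts WR p c x})) (order_graph pR))"
    unfolding sigmaR_def TR_def im ..
  then show ?thesis using lex_cliques[OF linR prefix_free_WR G] by simp
qed

lemma derived_left_valid: "left_valid (order_graph rL) \<sigma> (order_graph pL)"
  unfolding left_valid_def mc_same_def
  using order_graph_acyclic[OF lin_pL order_graph_filter[OF lin_pL]]
    order_graph_connected[OF lin_pL order_graph_filter[OF lin_pL]]
    connected_convex[OF lin_pL convex_left] order_graph_filter[OF linL] cliques_left
    order_graph_acyclic[OF linL cliques_left] order_graph_connected[OF linL cliques_left]
  by simp

lemma derived_right_valid: "right_valid (order_graph rR) \<sigma> (order_graph pR)"
  unfolding right_valid_def mc_same_def
  using order_graph_acyclic[OF lin_pR order_graph_filter[OF lin_pR]]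
    order_graph_connected[OF lin_pR order_graph_filter[OF lin_pR]]
    connected_convex[OF lin_pR convex_right] order_graph_filter[OF linR] cliques_right
    order_graph_acyclic[OF linR cliques_right] order_graph_connected[OF linR cliques_right]
  by simp

lemma derived_planar_morph: "planar_morph rL rR \<sigma>"
  unfolding planar_morph_def planar_word_iff
proof (intro allI impI)
  fix u assume "sigma_initial \<sigma> u"
  then have "u \<in> F0" using lang_morph_subset[OF full] unfolding sigma_initial_def by blast
  then have "planar rL rR (ext F0 u)" using st unfolding staircase_def by blast
  moreover have "ext (lang_morph \<sigma>) u \<subseteq> ext F0 u" using lang_morph_subset[OF full] unfolding ext_def by blast
  ultimately show "planar rL rR (ext (lang_morph \<sigma>) u)" unfolding planar_def by blast
qed

lemma derived_planar_preserving: "planar_preserving \<sigma> pL pR rL rR"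
  unfolding planar_preserving_def order_preserving_def
proof (intro conjI ballI impI)
  fix s x y assume "x \<in> AL \<sigma> s" "y \<in> AL \<sigma> s" and lt: "lt pL x y"
  then obtain x' y' where x': "starts WL (rev s) x x'" "starts WL (rev s) y y'" unfolding AL_starts by blast
  then show "(phiL \<sigma> s x, phiL \<sigma> s y) \<in> rL"
    using lex_mono[OF linL x' lt_imp[OF lt]] phiL_starts[OF x'(1)] phiL_starts[OF x'(2)] by simp
next
  fix p x y assume "x \<in> AR \<sigma> p" "y \<in> AR \<sigma> p" and lt: "lt pR x y"
  then obtain x' y' where x': "starts WR p x x'" "starts WR p y y'" unfolding AR_starts by blast
  then show "(phiR \<sigma> p x, phiR \<sigma> p y) \<in> rR"
    using lex_mono[OF linR x' lt_imp[OF lt]] phiR_starts[OF x'(1)] phiR_starts[OF x'(2)] by simp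
qed

lemma derived_staircase: "staircase pL pR F"
  unfolding staircase_def using planar_F uncut_F by blast

end

section \<open>Directive sequences\<close>

lemma mprod_append: "mprod \<sigma> n k (u @ v) = mprod \<sigma> n k u @ mprod \<sigma> n k v"
  by (induction k arbitrary: n) auto

lemma mprod_Nil [simp]: "mprod \<sigma> n k [] = []"
  by (induction k arbitrary: n) auto

lemma mprod_add: "mprod \<sigma> n (j + k) v = mprod \<sigma> n j (mprod \<sigma> (n + j) k v)"
  by (induction j arbitrary: n) auto

lemma mprod_Suc_right: "mprod \<sigma> n (Suc k) v = mprod \<sigma> n k (morph_app (\<sigma> (n + k)) v)"
  using mprod_add[of \<sigma> n k 1 v] by simp

lemma mprod_morph: "mprod \<sigma> n k v = morph_app (\<lambda>c. mprod \<sigma> n k [c]) v"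
proof (induction v)
  case (Cons c v)
  then show ?case using mprod_append[of \<sigma> n k "[c]" v] by simp
qed simp

lemma sublist_mprod: "sublist u v \<Longrightarrow> sublist (mprod \<sigma> n k u) (mprod \<sigma> n k v)"
  unfolding sublist_def by (metis mprod_append)

lemma length_morph_app_ge: "\<forall>c. \<tau> c \<noteq> [] \<Longrightarrow> length v \<le> length (morph_app \<tau> v)"
proof (induction v)
  case (Cons c v)
  have "1 \<le> length (\<tau> c)" using Cons.prems by (simp add: Suc_leI)
  then show ?case using Cons by simp
qed simp

lemma length_mprod_ge: "\<forall>n c. \<sigma> n c \<noteq> [] \<Longrightarrow> length v \<le> length (mprod \<sigma> n k v)"
proof (induction k arbitrary: n)
  case (Suc k)
  have "length v \<le> length (mprod \<sigma> (Suc n) k v)" using Suc by blast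
  also have "\<dots> \<le> length (mprod \<sigma> n (Suc k) v)" using length_morph_app_ge[of "\<sigma> n"] Suc.prems by simp
  finally show ?case .
qed simp

lemma lang_n_iff: "u \<in> lang_n \<sigma> n \<longleftrightarrow> (\<exists>k c. 1 \<le> k \<and> sublist u (mprod \<sigma> n k [c]))"
proof
  assume "u \<in> lang_n \<sigma> n"
  then obtain N c where "n < N" "sublist u (mprod \<sigma> n (N - n) [c])" unfolding lang_n_def factors_eq by auto
  then show "\<exists>k c. 1 \<le> k \<and> sublist u (mprod \<sigma> n k [c])" by (intro exI[of _ "N - n"] exI[of _ c]) auto
next
  assume "\<exists>k c. 1 \<le> k \<and> sublist u (mprod \<sigma> n k [c])"
  then obtain k c where k: "1 \<le> k" "sublist u (mprod \<sigma> n k [c])" by auto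
  then have "n < n + k" "u \<in> factors (mprod \<sigma> n (n + k - n) [c])" unfolding factors_eq by auto
  then show "u \<in> lang_n \<sigma> n" unfolding lang_n_def by blast
qed

lemma primitive_iff: "primitive \<sigma> \<longleftrightarrow> (\<forall>n. \<exists>k\<ge>1. \<forall>c d. d \<in> set (mprod \<sigma> n k [c]))"
proof
  assume p: "primitive \<sigma>"
  show "\<forall>n. \<exists>k\<ge>1. \<forall>c d. d \<in> set (mprod \<sigma> n k [c])"
  proof
    fix n
    obtain N where "N > n" "\<forall>c d. d \<in> set (mprod \<sigma> n (N - n) [c])" using p unfolding primitive_def by blast
    then show "\<exists>k\<ge>1. \<forall>c d. d \<in> set (mprod \<sigma> n k [c])" by (intro exI[of _ "N - n"]) auto
  qed
next
  assume p: "\<forall>n. \<exists>k\<ge>1. \<forall>c d. d \<in> set (mprod \<sigma> n k [c])"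
  show "primitive \<sigma>" unfolding primitive_def
  proof
    fix n
    obtain k where "1 \<le> k" "\<forall>c d. d \<in> set (mprod \<sigma> n k [c])" using p by blast
    then show "\<exists>N>n. \<forall>c d. d \<in> set (mprod \<sigma> n (N - n) [c])" by (intro exI[of _ "n + k"]) auto
  qed
qed

text \<open>After the rest of the block in which \<open>v\<close> starts, more than \<open>M\<close>
  letters of \<open>v\<close> remain, enough for the whole next block.\<close>

lemma sublist_block:
  assumes "\<forall>x. length (f x) \<le> M" "2 * M < length v" "sublist v (morph_app f V)"
  shows "\<exists>x. sublist (f x) v"
  using assms(3)
proof (induction V)
  case Nil
  then show ?case using assms(2) by simp
next
  case (Cons x V)
  then obtain \<alpha> \<beta> where eq: "f x @ morph_app f V = \<alpha> @ v @ \<beta>" by (auto simp: sublist_def)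
  show ?case
  proof (cases "length (f x) \<le> length \<alpha>")
    case True
    then obtain \<alpha>' where "\<alpha> = f x @ \<alpha>'" using append_eq_longer[OF eq] by auto
    then have "morph_app f V = \<alpha>' @ v @ \<beta>" using eq by simp
    then show ?thesis using Cons.IH by (auto simp: sublist_def)
  next
    case False
    then obtain r where r: "f x = \<alpha> @ r" using append_eq_longer[of \<alpha> "v @ \<beta>" "f x" "morph_app f V"] eq by auto
    then have eq2: "r @ morph_app f V = v @ \<beta>" using eq by simp
    have rM: "length r \<le> M" using r assms(1) by (metis le_trans length_append le_add2)
    then obtain v2 where v2: "v = r @ v2" "morph_app f V = v2 @ \<beta>"
      using append_eq_longer[OF eq2] assms(2) by auto
    have lv2: "M < length v2" using v2(1) rM assms(2) by simp
    then obtain y V' where y: "V = y # V'" using v2(2) by (cases V) auto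
    then have "f y @ morph_app f V' = v2 @ \<beta>" using v2(2) by simp
    moreover have "length (f y) \<le> length v2" using lv2 assms(1) by (meson le_trans less_imp_le)
    ultimately obtain z where "v2 = f y @ z" using append_eq_longer by blast
    then show ?thesis using v2(1) by (auto simp: sublist_def)
  qed
qed

locale primitive_seq =
  fixes \<sigma> :: "nat \<Rightarrow> 'a::finite \<Rightarrow> 'a list" and a b :: 'a
  assumes ab: "a \<noteq> b" and ne: "\<forall>n c. \<sigma> n c \<noteq> []" and prim: "primitive \<sigma>"
begin

lemma prim_block: "\<exists>k\<ge>1. \<forall>c d. d \<in> set (mprod \<sigma> n k [c])"
  using prim primitive_iff by blast

text \<open>Three rounds of primitivity: \<open>k2\<close> produces two letters \<open>f\<close> and
  \<open>g\<close>, \<open>k1\<close> produces a letter \<open>e2\<close> in the block of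
  \<open>f\<close> with neighbours on both sides, and \<open>k0\<close> places \<open>c\<close> into
  the block of \<open>e2\<close>.\<close>

lemma interior: "\<exists>k\<ge>1. \<forall>c e. \<exists>x y. x \<noteq> [] \<and> y \<noteq> [] \<and> mprod \<sigma> n k [e] = x @ [c] @ y"
proof -
  obtain k0 where k0: "1 \<le> k0" "\<forall>c d. d \<in> set (mprod \<sigma> n k0 [c])" using prim_block by blast
  obtain k1 where k1: "\<forall>c d. d \<in> set (mprod \<sigma> (n + k0) k1 [c])" using prim_block by blast
  obtain k2 where k2: "\<forall>c d. d \<in> set (mprod \<sigma> (n + k0 + k1) k2 [c])" using prim_block by blast
  have two: "2 \<le> length v" if "\<forall>d. d \<in> set v" for v :: "'a list"
  proof -
    have "{a, b} \<subseteq> set v" using that by blast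
    then have "card {a, b} \<le> card (set v)" by (intro card_mono) auto
    then show ?thesis using ab card_length[of v] by simp
  qed
  have "\<exists>x y. x \<noteq> [] \<and> y \<noteq> [] \<and> mprod \<sigma> n (k0 + (k1 + k2)) [e] = x @ [c] @ y" for c e
  proof -
    let ?W = "mprod \<sigma> (n + k0) (k1 + k2) [e]"
    let ?V = "mprod \<sigma> (n + k0 + k1) k2 [e]"
    have W: "?W = mprod \<sigma> (n + k0) k1 ?V" by (rule mprod_add)
    have "2 \<le> length ?V" using two k2 by blast
    then obtain f g V' where V: "?V = [f] @ [g] @ V'" by (metis Suc_le_length_iff append_Cons append_Nil numeral_2_eq_2)
    have "2 \<le> length (mprod \<sigma> (n + k0) k1 [f])" using two k1 by blast
    then obtain e1 e2 U where U: "mprod \<sigma> (n + k0) k1 [f] = [e1] @ [e2] @ U"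
      by (metis Suc_le_length_iff append_Cons append_Nil numeral_2_eq_2)
    have W': "?W = [e1] @ [e2] @ U @ mprod \<sigma> (n + k0) k1 ([g] @ V')" unfolding W V mprod_append U by simp
    let ?Z = "U @ mprod \<sigma> (n + k0) k1 ([g] @ V')"
    have "2 \<le> length (mprod \<sigma> (n + k0) k1 [g])" using two k1 by blast
    then have Z: "?Z \<noteq> []" unfolding mprod_append by auto
    have eq: "mprod \<sigma> n (k0 + (k1 + k2)) [e] = mprod \<sigma> n k0 [e1] @ mprod \<sigma> n k0 [e2] @ mprod \<sigma> n k0 ?Z"
      unfolding mprod_add[of \<sigma> n k0] W' mprod_append by simp
    obtain x y where xy: "mprod \<sigma> n k0 [e2] = x @ [c] @ y" using k0(2) by (metis append_Cons append_Nil in_set_conv_decomp)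
    have "1 \<le> length (mprod \<sigma> n k0 [e1])" using length_mprod_ge[OF ne, of "[e1]" n k0] by simp
    moreover have "1 \<le> length (mprod \<sigma> n k0 ?Z)"
      using length_mprod_ge[OF ne, of ?Z n k0] Z by (meson le_trans length_0_conv less_one not_le)
    ultimately show ?thesis unfolding eq xy
      by (intro exI[of _ "mprod \<sigma> n k0 [e1] @ x"] exI[of _ "y @ mprod \<sigma> n k0 ?Z"]) auto
  qed
  moreover have "1 \<le> k0 + (k1 + k2)" using k0(1) by simp
  ultimately show ?thesis by blast
qed

lemma lang_n_letter: "[c] \<in> lang_n \<sigma> n"
proof -
  obtain k where "1 \<le> k" "c \<in> set (mprod \<sigma> n k [c])" using prim_block by blast
  moreover from this have "sublist [c] (mprod \<sigma> n k [c])"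
    by (metis append_Cons append_Nil in_set_conv_decomp sublist_appendI)
  ultimately show ?thesis using lang_n_iff by blast
qed

lemma lang_n_biextendable: "biextendable (lang_n \<sigma> n)"
  unfolding biextendable_def
proof (intro conjI allI impI ballI)
  show "[] \<in> lang_n \<sigma> n" unfolding lang_n_iff by (intro exI[of _ 1]) auto
next
  fix u v assume "sublist v u \<and> u \<in> lang_n \<sigma> n"
  then show "v \<in> lang_n \<sigma> n" unfolding lang_n_iff by (meson sublist_order.order.trans)
next
  fix u assume "u \<in> lang_n \<sigma> n"
  then obtain k c where k: "1 \<le> k" "sublist u (mprod \<sigma> n k [c])" unfolding lang_n_iff by blast
  obtain k' x y e where xy: "x \<noteq> []" "y \<noteq> []" "mprod \<sigma> (n + k) k' [e] = x @ [c] @ y"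
    using interior[of "n + k"] by blast
  have eq: "mprod \<sigma> n (k + k') [e] = mprod \<sigma> n k x @ mprod \<sigma> n k [c] @ mprod \<sigma> n k y"
    unfolding mprod_add xy(3) mprod_append ..
  have "mprod \<sigma> n k x \<noteq> []" "mprod \<sigma> n k y \<noteq> []"
    using length_mprod_ge[OF ne, of x n k] length_mprod_ge[OF ne, of y n k] xy by auto
  moreover obtain p q where pq: "mprod \<sigma> n k [c] = p @ u @ q" using k(2) unfolding sublist_def by blast
  ultimately obtain p' c' d' q' where "mprod \<sigma> n k x @ p = p' @ [c']" "q @ mprod \<sigma> n k y = [d'] @ q'"
    by (metis append_is_Nil_conv rev_exhaust list.exhaust append_Cons append_Nil)
  then have "mprod \<sigma> n (k + k') [e] = p' @ ([c'] @ u @ [d']) @ q'" unfolding eq pq by (metis append.assoc)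
  then have "sublist ([c'] @ u @ [d']) (mprod \<sigma> n (k + k') [e])" by (metis sublist_appendI)
  then show "\<exists>c d. [c] @ u @ [d] \<in> lang_n \<sigma> n" unfolding lang_n_iff using k(1) by (meson trans_le_add1)
qed

lemma lang_n_image: "lang_n \<sigma> n = image_lang (\<sigma> n) (lang_n \<sigma> (Suc n))"
proof (intro set_eqI iffI)
  fix u assume "u \<in> lang_n \<sigma> n"
  then obtain k c where k: "1 \<le> k" "sublist u (mprod \<sigma> n k [c])" unfolding lang_n_iff by blast
  then obtain k' where k': "k = Suc k'" by (cases k) auto
  have "mprod \<sigma> (Suc n) k' [c] \<in> lang_n \<sigma> (Suc n)"
  \<comment> \<open>\<open>lang_n\<close> begins with products of length one; the empty product, a
    single letter, is in it by primitivity.\<close>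
  proof (cases k')
    case 0
    then show ?thesis using lang_n_letter by simp
  next
    case (Suc i)
    then show ?thesis unfolding lang_n_iff by (intro exI[of _ k'] exI[of _ c]) auto
  qed
  then show "u \<in> image_lang (\<sigma> n) (lang_n \<sigma> (Suc n))" using k(2) unfolding image_lang_def k' by auto
next
  fix u assume "u \<in> image_lang (\<sigma> n) (lang_n \<sigma> (Suc n))"
  then obtain v where v: "v \<in> lang_n \<sigma> (Suc n)" "sublist u (morph_app (\<sigma> n) v)"
    unfolding image_lang_def by blast
  then obtain k c where k: "sublist u (morph_app (\<sigma> n) v)" "sublist v (mprod \<sigma> (Suc n) k [c])"
    unfolding lang_n_iff by blast
  then have "sublist u (mprod \<sigma> n (Suc k) [c])"
    using sublist_morph_app[OF k(2)] sublist_order.order.trans by fastforce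
  then show "u \<in> lang_n \<sigma> n" unfolding lang_n_iff by (intro exI[of _ "Suc k"]) auto
qed

lemma lang_n_uniformly_recurrent: "uniformly_recurrent (lang_n \<sigma> n)"
  unfolding uniformly_recurrent_def
proof
  fix u assume "u \<in> lang_n \<sigma> n"
  then obtain k c where k: "sublist u (mprod \<sigma> n k [c])" unfolding lang_n_iff by blast
  obtain k' where k': "\<forall>e d. d \<in> set (mprod \<sigma> (n + k) k' [e])" using prim_block by blast
  let ?K = "k + k'"
  have uK: "sublist u (mprod \<sigma> n ?K [e])" for e
  proof -
    have "sublist [c] (mprod \<sigma> (n + k) k' [e])" using k' by (metis append_Cons append_Nil in_set_conv_decomp sublist_appendI)
    then show ?thesis unfolding mprod_add using sublist_mprod k sublist_order.order.trans by blast
  qed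
  obtain M where M: "\<forall>e. length (mprod \<sigma> n ?K [e]) \<le> M" using bound_family by blast
  have "\<exists>M. \<forall>e. length (mprod \<sigma> n j [e]) \<le> M" for j using bound_family by blast
  then obtain B where B: "\<forall>j e. length (mprod \<sigma> n j [e]) \<le> B j" by metis
  \<comment> \<open>More than \<open>2 * M\<close> letters force a whole block of depth
    \<open>?K\<close> inside \<open>v\<close>, and the sum of the \<open>B j\<close> bounds every
    word that comes from fewer than \<open>?K\<close> levels.\<close>
  let ?R = "2 * M + sum B {..<?K} + 1"
  have "sublist u v" if v: "v \<in> lang_n \<sigma> n" "?R \<le> length v" for v
  proof -
    obtain j e where j: "sublist v (mprod \<sigma> n j [e])" using v(1) unfolding lang_n_iff by blast
    have "?K \<le> j"
    proof (rule ccontr)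
      assume "\<not> ?thesis"
      then have "B j \<le> sum B {..<?K}" by (intro member_le_sum) auto
      moreover have "length v \<le> B j" using j B sublist_length_le le_trans by blast
      ultimately show False using v(2) by simp
    qed
    then have "mprod \<sigma> n j [e] = mprod \<sigma> n ?K (mprod \<sigma> (n + ?K) (j - ?K) [e])" using mprod_add[of \<sigma> n ?K "j - ?K"] by simp
    then have "sublist v (morph_app (\<lambda>x. mprod \<sigma> n ?K [x]) (mprod \<sigma> (n + ?K) (j - ?K) [e]))"
      using j mprod_morph[of \<sigma> n ?K] by metis
    then obtain x where "sublist (mprod \<sigma> n ?K [x]) v" using sublist_block[OF M] v(2) by fastforce
    then show ?thesis using uK sublist_order.order.trans by blast
  qed
  then show "\<exists>R. \<forall>v\<in>lang_n \<sigma> n. R \<le> length v \<longrightarrow> sublist u v" by blast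
qed

end

section \<open>Derivation along a directive sequence\<close>

text \<open>Unlike \<open>lang_n\<close> this admits the empty product: stripping one morphism may
  leave a single letter, and it is this larger set that desubstitution preserves.\<close>

definition prelang :: "(nat \<Rightarrow> 'a \<Rightarrow> 'a list) \<Rightarrow> nat \<Rightarrow> 'a list set" where
  "prelang \<sigma> n = {u. \<exists>k c. sublist u (mprod \<sigma> n k [c])}"

locale derivation =
  fixes \<sigma> :: "nat \<Rightarrow> 'a::finite \<Rightarrow> 'a list" and n :: nat and F0 :: "'a list set"
  assumes retn: "return_for (\<sigma> n) (ret_word (\<sigma> n))"
    and biF0: "biextendable F0" and pre: "F0 \<subseteq> prelang \<sigma> n"
begin

abbreviation \<tau> where "\<tau> \<equiv> \<sigma> n"
abbreviation w where "w \<equiv> ret_word \<tau>"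

sublocale return_mor \<tau> w by standard (rule retn)

text \<open>The derived language. The appended \<open>w\<close> marks the last block boundary, which
  lets \<open>parse_image\<close> recover \<open>v\<close> from its image.\<close>

definition F1 where "F1 = {v. morph_app \<tau> v @ w \<in> F0}"

lemma desubst:
  assumes "u \<in> F0"
  shows "\<exists>V \<alpha> \<beta>. morph_app \<tau> V @ w = \<alpha> @ u @ \<beta> \<and> V \<in> prelang \<sigma> (Suc n)"
proof -
  obtain x y where xy: "length x = 1" "length y = 1" "x @ u @ y \<in> F0" using biextendable_extend[OF biF0 assms] by blast
  then obtain k c where k: "sublist (x @ u @ y) (mprod \<sigma> n k [c])" using pre unfolding prelang_def by blast
  \<comment> \<open>With a letter added on either side the word has length at least two and is no
    factor of a single letter.\<close>
  have "k \<noteq> 0" using k sublist_length_le[OF k] xy by (intro notI) simp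
  then obtain k' where k': "k = Suc k'" by (cases k) auto
  then obtain p q where "morph_app \<tau> (mprod \<sigma> (Suc n) k' [c]) = p @ (x @ u @ y) @ q"
    using k unfolding sublist_def by auto
  then have "morph_app \<tau> (mprod \<sigma> (Suc n) k' [c]) @ w = (p @ x) @ u @ (y @ q @ w)" by simp
  moreover have "mprod \<sigma> (Suc n) k' [c] \<in> prelang \<sigma> (Suc n)" unfolding prelang_def by blast
  ultimately show ?thesis by blast
qed

lemma prelang_sublist: "v \<in> prelang \<sigma> m \<Longrightarrow> sublist u v \<Longrightarrow> u \<in> prelang \<sigma> m"
  unfolding prelang_def by (auto intro: sublist_order.order.trans)

lemma F1_prelang: "F1 \<subseteq> prelang \<sigma> (Suc n)"
proof
  fix v assume "v \<in> F1"
  then obtain V \<alpha> \<beta> where V: "morph_app \<tau> V @ w = \<alpha> @ (morph_app \<tau> v @ w) @ \<beta>" "V \<in> prelang \<sigma> (Suc n)"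
    using desubst unfolding F1_def by blast
  then have "morph_app \<tau> V @ w = \<alpha> @ morph_app \<tau> v @ w @ \<beta>" by simp
  from parse_image[OF this] show "v \<in> prelang \<sigma> (Suc n)" using V(2) prelang_sublist by (metis sublist_appendI)
qed

text \<open>Extended far enough, \<open>u\<close> has an occurrence of \<open>w\<close> on either
  side. These are block boundaries, and the word from the left one up to the right one is the image
  of a word of \<open>F1\<close>. The spare letters \<open>c\<close> and \<open>d\<close> next to
  \<open>u\<close> keep both margins nonempty.\<close>

lemma cover_by_image:
  assumes "u \<in> F0"
  shows "\<exists>v\<in>F1. \<exists>x y. x \<noteq> [] \<and> y \<noteq> [] \<and> morph_app \<tau> v = x @ u @ y"
proof -
  obtain K where K: "\<forall>e. length (\<tau> e @ w) \<le> K" using return_bound by blast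
  have Kl: "sublist w u" if ku: "K \<le> length u" "u \<in> F0" for u
  proof -
    obtain V \<alpha> \<beta> where "morph_app \<tau> V @ w = \<alpha> @ u @ \<beta>" using desubst[OF ku(2)] by blast
    then have "sublist u (morph_app \<tau> V @ w)" by (metis sublist_appendI)
    then show ?thesis using long_contains[of K u V] K ku(1) by blast
  qed
  obtain x y where xy: "length x = Suc K" "length y = Suc K" "x @ u @ y \<in> F0" using biextendable_extend[OF biF0 assms] by blast
  then obtain x' c where x: "x = x' @ [c]" "length x' = K" by (cases x rule: rev_cases) auto
  have "x' \<in> F0" "y \<in> F0"
    using xy(3) x(1) biextendable_factor[OF biF0, of "[]" x' "[c] @ u @ y"] biextendable_factor[OF biF0, of "x @ u" y "[]"] by auto
  then obtain x1 x2 y1 y2 where xs: "x' = x1 @ w @ x2" and ys: "tl y = y1 @ w @ y2"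
    using Kl[of x'] Kl[of "tl y"] x(2) xy(2) biextendable_factor[OF biF0, of "[hd y]" "tl y" "[]"]
    unfolding sublist_def by (cases y) auto
  obtain d where y: "y = [d] @ y1 @ w @ y2" using ys xy(2) by (cases y) auto
  obtain V \<alpha> \<beta> where V: "morph_app \<tau> V @ w = \<alpha> @ (x @ u @ y) @ \<beta>" using desubst[OF xy(3)] by blast
  let ?X = "w @ x2 @ [c] @ u @ [d] @ y1"
  have "morph_app \<tau> V @ w = (\<alpha> @ x1) @ ?X @ w @ (y2 @ \<beta>)" using V x xs y by simp
  moreover have "?X @ w @ (y2 @ \<beta>) = w @ (x2 @ [c] @ u @ [d] @ y1 @ w @ y2 @ \<beta>)" by simp
  ultimately obtain v where v: "?X = morph_app \<tau> v" using parse_two by blast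
  have "x @ u @ y = x1 @ (?X @ w) @ y2" using x xs y by simp
  then have "?X @ w \<in> F0" using biextendable_factor[OF biF0] xy(3) by metis
  then have "v \<in> F1" unfolding F1_def v by simp
  moreover have "morph_app \<tau> v = (w @ x2 @ [c]) @ u @ ([d] @ y1)" using v by simp
  ultimately show ?thesis by (metis append_is_Nil_conv not_Cons_self2)
qed

lemma F1_sublist: "v \<in> F1 \<Longrightarrow> sublist u v \<Longrightarrow> u \<in> F1"
proof -
  assume v: "v \<in> F1" and "sublist u v"
  then obtain p q where "v = p @ u @ q" unfolding sublist_def by auto
  moreover obtain z where "morph_app \<tau> q @ w = w @ z" using image_prefix by blast
  ultimately have "morph_app \<tau> v @ w = morph_app \<tau> p @ (morph_app \<tau> u @ w) @ z" by simp
  then show "u \<in> F1" using v biextendable_factor[OF biF0] unfolding F1_def by (metis mem_Collect_eq)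
qed

text \<open>Covering \<open>morph_app \<tau> v @ w\<close> with nonempty margins by an image from
  \<open>F1\<close> exposes a letter before and a letter after \<open>v\<close> upstairs.\<close>

lemma F1_biextendable: "biextendable F1"
  unfolding biextendable_def
proof (intro conjI allI impI ballI)
  show "[] \<in> F1" using cover_by_image[OF biextendable_Nil[OF biF0]] F1_sublist by (meson sublist_Nil_left)
next
  fix u v assume "sublist v u \<and> u \<in> F1"
  then show "v \<in> F1" using F1_sublist by blast
next
  fix v assume v: "v \<in> F1"
  then obtain V x y where V: "V \<in> F1" "x \<noteq> []" "y \<noteq> []" "morph_app \<tau> V = x @ (morph_app \<tau> v @ w) @ y"
    using cover_by_image[of "morph_app \<tau> v @ w"] unfolding F1_def by blast
  then have "morph_app \<tau> V @ w = x @ morph_app \<tau> v @ w @ (y @ w)" by simp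
  from parse_image[OF this] obtain V1 V2 where P: "V = V1 @ v @ V2" "x = morph_app \<tau> V1"
    "w @ y @ w = morph_app \<tau> V2 @ w" by auto
  have "V1 \<noteq> []" using P(2) V(2) by auto
  moreover have "V2 \<noteq> []" using P(3) V(3) by (auto dest: arg_cong[where f = length])
  ultimately obtain V1' c d V2' where "V1 = V1' @ [c]" "V2 = d # V2'" by (metis rev_exhaust list.exhaust)
  then have "V = V1' @ ([c] @ v @ [d]) @ V2'" using P(1) by simp
  then show "\<exists>c d. [c] @ v @ [d] \<in> F1" using V(1) F1_sublist by (metis sublist_appendI)
qed

lemma F0_image: "F0 = image_lang \<tau> F1"
proof (intro set_eqI iffI)
  fix u assume "u \<in> F0"
  then show "u \<in> image_lang \<tau> F1" using cover_by_image unfolding image_lang_def by (auto simp: sublist_def) metis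
next
  fix u assume "u \<in> image_lang \<tau> F1"
  then obtain v where "v \<in> F1" "sublist u (morph_app \<tau> v)" unfolding image_lang_def by auto
  then show "u \<in> F0" using biF0 unfolding F1_def biextendable_def
    by (metis mem_Collect_eq sublist_append_rightI sublist_order.order.trans)
qed

lemma F1_uniformly_recurrent:
  assumes "uniformly_recurrent F0" shows "uniformly_recurrent F1"
  unfolding uniformly_recurrent_def
proof
  fix u assume "u \<in> F1"
  then have "morph_app \<tau> u @ w \<in> F0" unfolding F1_def by simp
  then obtain R where R: "\<forall>v\<in>F0. R \<le> length v \<longrightarrow> sublist (morph_app \<tau> u @ w) v" using assms unfolding uniformly_recurrent_def by blast
  have "sublist u v" if v: "v \<in> F1" "R \<le> length v" for v
  proof -
    have "R \<le> length (morph_app \<tau> v @ w)" using length_image[of v] v(2) by simp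
    then have "sublist (morph_app \<tau> u @ w) (morph_app \<tau> v @ w)" using R v(1) unfolding F1_def by blast
    then obtain a b where "morph_app \<tau> v @ w = a @ morph_app \<tau> u @ w @ b" unfolding sublist_def by auto
    from parse_image[OF this] show ?thesis by (auto simp: sublist_def)
  qed
  then show "\<exists>R. \<forall>v\<in>F1. R \<le> length v \<longrightarrow> sublist u v" by blast
qed

end

section \<open>Primitivity from uniform recurrence\<close>

lemma replicate_of_commute: "x # w = w @ [y] \<Longrightarrow> w = replicate (length w) x"
proof (induction w)
  case (Cons z w)
  then have "x = z" "z # w = w @ [y]" by auto
  then show ?case using Cons.IH by simp
qed simp

locale uniformly_recurrent_sequence =
  fixes \<sigma> :: "nat \<Rightarrow> 'a::finite \<Rightarrow> 'a list" and Fs :: "nat \<Rightarrow> 'a list set" and a b :: 'a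
  assumes ab: "a \<noteq> b"
    and rets: "\<And>n. return_for (\<sigma> n) (ret_word (\<sigma> n))"
    and bis: "\<And>n. biextendable (Fs n)" and uniformly_recurrents: "\<And>n. uniformly_recurrent (Fs n)" and fulls: "\<And>n c. [c] \<in> Fs n"
    and images: "\<And>n. Fs n = image_lang (\<sigma> n) (Fs (Suc n))" and pres: "\<And>n. Fs n \<subseteq> prelang \<sigma> n"
begin

lemma nes: "\<forall>n c. \<sigma> n c \<noteq> []"
  using rets unfolding return_for_def by blast

lemma mprod_mem: "v \<in> Fs (n + k) \<Longrightarrow> mprod \<sigma> n k v \<in> Fs n"
proof (induction k arbitrary: n)
  case (Suc k)
  then have "mprod \<sigma> (Suc n) k v \<in> Fs (Suc n)" by simp
  then show ?case using images[of n] unfolding image_lang_def by auto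
qed simp

lemma letters_bound: "\<exists>R. \<forall>v\<in>Fs n. R \<le> length v \<longrightarrow> set v = UNIV"
proof -
  have "\<forall>d. \<exists>R. \<forall>v\<in>Fs n. R \<le> length v \<longrightarrow> sublist [d] v" using uniformly_recurrents[of n] fulls unfolding uniformly_recurrent_def by blast
  then obtain R where R: "\<forall>d. \<forall>v\<in>Fs n. R d \<le> length v \<longrightarrow> sublist [d] v" by metis
  obtain K where "\<forall>d. R d \<le> K" using bound_family by blast
  then have "\<forall>v\<in>Fs n. K \<le> length v \<longrightarrow> set v = UNIV" using R le_trans
    by (metis UNIV_eq_I list.set_intros(1) set_mono_sublist subsetD)
  then show ?thesis by blast
qed

text \<open>A morphism with empty return word has blocks of length one, because the empty word
  occurs at every position. If this held at all levels from \<open>M\<close> on, all words of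
  \<open>Fs M\<close> would have length at most one.\<close>

lemma return_nonempty_inf: "\<exists>m\<ge>M. ret_word (\<sigma> m) \<noteq> []"
proof (rule ccontr)
  assume "\<not> ?thesis"
  then have e: "ret_word (\<sigma> m) = []" if "m \<ge> M" for m using that by blast
  have one: "length (\<sigma> m c) = 1" if "m \<ge> M" for m c
  proof -
    have "occ [] (\<sigma> m c) = {0, length (\<sigma> m c)}" using rets[of m] e[OF that] unfolding return_for_def by auto
    moreover have "1 \<in> occ [] (\<sigma> m c)" using nes by (auto simp: occ_def Suc_leI)
    ultimately show ?thesis by auto
  qed
  have len1: "length (mprod \<sigma> m k [c]) = 1" if "m \<ge> M" for m k c
    using that
  proof (induction k arbitrary: m)
    case (Suc k)
    then have "length (mprod \<sigma> (Suc m) k [c]) = 1" by simp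
    then obtain d where "mprod \<sigma> (Suc m) k [c] = [d]" by (metis One_nat_def length_0_conv length_Suc_conv)
    then show ?case using one Suc.prems by simp
  qed simp
  have "length u \<le> 1" if uF: "u \<in> Fs M" for u
  proof -
    obtain k c where "sublist u (mprod \<sigma> M k [c])" using pres[of M] uF unfolding prelang_def by blast
    then show ?thesis using sublist_length_le[of u "mprod \<sigma> M k [c]"] len1[of M k c] by simp
  qed
  moreover obtain x y where "length x = 1" "length y = 1" "x @ [] @ y \<in> Fs M"
    using biextendable_extend[OF bis biextendable_Nil[OF bis]] by blast
  ultimately show False by fastforce
qed

text \<open>If the shortest blocks had bounded length, every non-trivial return morphism would increase
  by one the exponent of a power of a single letter, against uniform recurrence.\<close>

lemma blocks_unbounded: "\<exists>k\<ge>1. \<forall>c. R \<le> length (mprod \<sigma> n k [c])"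
proof (rule ccontr)
  assume neg: "\<not> ?thesis"
  define l where "l k = Min (range (\<lambda>c. length (mprod \<sigma> n k [c])))" for k
  have l_le: "l k \<le> length (mprod \<sigma> n k [c])" for k c unfolding l_def by (intro Min_le) auto
  have l_ex: "\<exists>c. length (mprod \<sigma> n k [c]) = l k" for k
  proof -
    have "l k \<in> range (\<lambda>c. length (mprod \<sigma> n k [c]))" unfolding l_def by (intro Min_in) auto
    then show ?thesis by auto
  qed
  have l_list: "length v * l k \<le> length (mprod \<sigma> n k v)" for v k
  proof (induction v)
    case (Cons c v)
    have "mprod \<sigma> n k (c # v) = mprod \<sigma> n k [c] @ mprod \<sigma> n k v" using mprod_append[of \<sigma> n k "[c]" v] by simp
    then show ?case using Cons l_le[of k c] by simp
  qed simp
  have l_pos: "1 \<le> l k" for k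
  proof -
    obtain c where "length (mprod \<sigma> n k [c]) = l k" using l_ex by blast
    then show ?thesis using length_mprod_ge[OF nes, of "[c]" n k] by simp
  qed
  \<comment> \<open>The negated claim bounds the shortest blocks only for positive depth; the
    summand \<open>l 0\<close> covers depth zero.\<close>
  have l_bd: "l k < R + l 0" for k
  proof (cases "k = 0")
    case True
    then show ?thesis using neg by (cases "R = 0") auto
  next
    case False
    then obtain c where "length (mprod \<sigma> n k [c]) < R" using neg by (metis One_nat_def Suc_leI neq0_conv not_le)
    then show ?thesis using l_le[of k c] by simp
  qed
  \<comment> \<open>\<open>l\<close> is bounded and nondecreasing, so it is constant from the depth
    \<open>K\<close> of its maximum on.\<close>
  obtain K where K: "\<forall>k. l k \<le> l K"
    using ex_has_greatest_nat[of "\<lambda>k. True" 0 l "R + l 0"] l_bd by (auto simp: less_imp_le)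
  have l_Suc: "l k \<le> l (Suc k)" for k
  proof -
    obtain c where c: "length (mprod \<sigma> n (Suc k) [c]) = l (Suc k)" using l_ex by blast
    have "length (\<sigma> (n + k) c) * l k \<le> l (Suc k)" using l_list[of "\<sigma> (n + k) c" k] c unfolding mprod_Suc_right by simp
    moreover have "1 \<le> length (\<sigma> (n + k) c)" using nes by (simp add: Suc_leI)
    ultimately show ?thesis by (metis le_trans mult_le_mono1 mult_1)
  qed
  have l_const: "l (K + j) = l K" for j
  proof (induction j)
    case (Suc j)
    then show ?case using l_Suc[of "K + j"] K by (metis add_Suc_right le_antisym)
  qed simp
  let ?N = "\<lambda>j. card {t. t < j \<and> ret_word (\<sigma> (n + K + t)) \<noteq> []}"
  \<comment> \<open>As \<open>l\<close> no longer grows, a shortest block of depth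
    \<open>K + Suc j\<close> comes from a letter \<open>c\<close> whose image is a single letter
    \<open>x\<close>. Since \<open>[x] @ w\<close> starts with \<open>w\<close>, the return word is
    a power of \<open>x\<close>, and the power of \<open>c\<close> turns into a power of
    \<open>x\<close> longer by \<open>length w\<close>.\<close>
  have power: "length (mprod \<sigma> n (K + j) [c]) = l K \<Longrightarrow> replicate i c \<in> Fs (n + K + j) \<Longrightarrow>
      \<exists>x. replicate (i + ?N j) x \<in> Fs (n + K)" for j c i
  proof (induction j arbitrary: c i)
    case 0
    then show ?case by auto
  next
    case (Suc j)
    let ?t = "\<sigma> (n + K + j)"
    let ?w = "ret_word ?t"
    interpret return_mor ?t ?w by standard (rule rets)
    have eq: "mprod \<sigma> n (K + Suc j) [c] = mprod \<sigma> n (K + j) (?t c)"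
      using mprod_Suc_right[of \<sigma> n "K + j" "[c]"] by (simp add: add.assoc)
    then have "length (?t c) * l K \<le> l K" using l_list[of "?t c" "K + j"] Suc.prems(1) l_const by simp
    then have "length (?t c) \<le> 1" using l_pos[of K] by simp
    moreover have "1 \<le> length (?t c)" using nes by (simp add: Suc_leI)
    ultimately have "length (?t c) = 1" by simp
    then obtain x where x: "?t c = [x]" by (metis One_nat_def length_0_conv length_Suc_conv)
    have lx: "length (mprod \<sigma> n (K + j) [x]) = l K" using eq x Suc.prems(1) by simp
    have im: "morph_app ?t (replicate i c) = replicate i x" by (induction i) (auto simp: x)
    interpret image_step ?t "Fs (Suc (n + K + j))" "Fs (n + K + j)"
      by standard (rule rets, rule bis, rule images)
    have "replicate i x @ ?w \<in> Fs (n + K + j)" using image_w_mem[of "replicate i c"] Suc.prems(2) im by simp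
    moreover obtain z where z: "[x] @ ?w = ?w @ z" using block_prefix[of c] x by auto
    then have "length ([x] @ ?w) = length (?w @ z)" by (rule arg_cong)
    then have "length z = 1" by simp
    then obtain y where "z = [y]" by (metis One_nat_def length_0_conv length_Suc_conv)
    then have "?w = replicate (length ?w) x" using z replicate_of_commute by simp
    ultimately have rep: "replicate (i + length ?w) x \<in> Fs (n + K + j)" by (metis replicate_add)
    have "\<exists>x. replicate (i + length ?w + ?N j) x \<in> Fs (n + K)" by (rule Suc.IH[OF lx rep])
    then obtain y where y: "replicate (i + length ?w + ?N j) y \<in> Fs (n + K)" by blast
    have "?N (Suc j) \<le> length ?w + ?N j"
    proof (cases "?w = []")
      case True
      have "{t. t < Suc j \<and> ret_word (\<sigma> (n + K + t)) \<noteq> []} = {t. t < j \<and> ret_word (\<sigma> (n + K + t)) \<noteq> []}"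
        using True by (auto simp: less_Suc_eq)
      then show ?thesis by simp
    next
      case False
      have "{t. t < Suc j \<and> ret_word (\<sigma> (n + K + t)) \<noteq> []} \<subseteq> insert j {t. t < j \<and> ret_word (\<sigma> (n + K + t)) \<noteq> []}"
        by (auto simp: less_Suc_eq)
      then have "?N (Suc j) \<le> card (insert j {t. t < j \<and> ret_word (\<sigma> (n + K + t)) \<noteq> []})" by (intro card_mono) auto
      also have "\<dots> \<le> Suc (?N j)" by (simp add: card_insert_if)
      finally have "?N (Suc j) \<le> Suc (?N j)" .
      moreover have "1 \<le> length ?w" using False by (simp add: Suc_leI)
      ultimately show ?thesis by linarith
    qed
    then have "i + ?N (Suc j) \<le> i + length ?w + ?N j" by linarith
    from le_Suc_ex[OF this] obtain e where e: "i + length ?w + ?N j = (i + ?N (Suc j)) + e" by blast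
    have "replicate (i + ?N (Suc j)) y \<in> Fs (n + K)"
    proof (rule biextendable_factor[OF bis])
      show "[] @ replicate (i + ?N (Suc j)) y @ replicate e y \<in> Fs (n + K)"
        using y unfolding e replicate_add[of "i + ?N (Suc j)" e] append_Nil .
    qed
    then show ?case by blast
  qed
  have Ninf: "\<exists>j. m \<le> ?N j" for m
  proof (induction m)
    case (Suc m)
    then obtain j where j: "m \<le> ?N j" by blast
    obtain q where q: "q \<ge> n + K + j" "ret_word (\<sigma> q) \<noteq> []" using return_nonempty_inf by blast
    define t where "t = q - (n + K)"
    have t: "t \<ge> j" "ret_word (\<sigma> (n + K + t)) \<noteq> []" using q unfolding t_def by auto
    have "insert t {t. t < j \<and> ret_word (\<sigma> (n + K + t)) \<noteq> []} \<subseteq> {s. s < Suc t \<and> ret_word (\<sigma> (n + K + s)) \<noteq> []}"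
      using t by auto
    then have "card (insert t {t. t < j \<and> ret_word (\<sigma> (n + K + t)) \<noteq> []}) \<le> ?N (Suc t)" by (intro card_mono) auto
    moreover have "card (insert t {t. t < j \<and> ret_word (\<sigma> (n + K + t)) \<noteq> []}) = Suc (?N j)" using t(1) by simp
    ultimately have "Suc m \<le> ?N (Suc t)" using j by linarith
    then show ?case by blast
  qed simp
  obtain R' where R': "\<forall>v\<in>Fs (n + K). R' \<le> length v \<longrightarrow> set v = UNIV" using letters_bound by blast
  obtain j where j: "R' \<le> ?N j" using Ninf by blast
  obtain c where c: "length (mprod \<sigma> n (K + j) [c]) = l K" using l_ex[of "K + j"] l_const by auto
  have "replicate 0 c \<in> Fs (n + K + j)" using biextendable_Nil[OF bis] by simp
  from power[OF c this] obtain x where x: "replicate (0 + ?N j) x \<in> Fs (n + K)" ..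
  have "R' \<le> length (replicate (0 + ?N j) x)" unfolding length_replicate add_0 by (rule j)
  from R'[rule_format, OF x this] have "set (replicate (0 + ?N j) x) = UNIV" .
  then have "a \<in> set (replicate (0 + ?N j) x)" "b \<in> set (replicate (0 + ?N j) x)" by blast+
  then show False using ab unfolding in_set_replicate by simp
qed

text \<open>Words of level \<open>n\<close> beyond a fixed length contain all letters, so it
  suffices that all blocks reach that length together.\<close>

lemma primitive_directive: "primitive \<sigma>"
  unfolding primitive_iff
proof
  fix n
  obtain R where R: "\<forall>v\<in>Fs n. R \<le> length v \<longrightarrow> set v = UNIV" using letters_bound by blast
  obtain k where k: "1 \<le> k" "\<forall>c. R \<le> length (mprod \<sigma> n k [c])" using blocks_unbounded by blast
  have "set (mprod \<sigma> n k [c]) = UNIV" for c using R k(2) mprod_mem[of "[c]" n k] fulls by blast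
  then show "\<exists>k\<ge>1. \<forall>c d. d \<in> set (mprod \<sigma> n k [c])" using k(1) by blast
qed

end

section \<open>Geometry of interval exchanges\<close>

lemma funpow_in: "bij_betw f A A \<Longrightarrow> x \<in> A \<Longrightarrow> (f ^^ n) x \<in> A"
  by (induction n) (auto dest: bij_betwE)

lemma funpow_inj: "bij_betw f A A \<Longrightarrow> x \<in> A \<Longrightarrow> y \<in> A \<Longrightarrow> (f ^^ n) x = (f ^^ n) y \<Longrightarrow> x = y"
proof (induction n)
  case (Suc n)
  then have "f ((f ^^ n) x) = f ((f ^^ n) y)" by simp
  then have "(f ^^ n) x = (f ^^ n) y"
    using Suc.prems funpow_in[of f A] unfolding bij_betw_def inj_on_def by blast
  then show ?case using Suc by blast
qed simp

lemma funpow_cancel: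
  assumes "bij_betw f A A" "x \<in> A" "y \<in> A" "(f ^^ m) x = (f ^^ n) y" "m \<le> n"
  shows "x = (f ^^ (n - m)) y"
proof -
  have "(f ^^ n) y = (f ^^ m) ((f ^^ (n - m)) y)" using assms(5) by (metis funpow_add comp_apply le_add_diff_inverse)
  then show ?thesis using funpow_inj[OF assms(1,2), of "(f ^^ (n - m)) y" m] funpow_in[OF assms(1,3)] assms(4) by simp
qed

locale iet =
  fixes r1 r2 :: "('a::finite \<times> 'a) set" and I :: "'a \<Rightarrow> real set" and T :: "real \<Rightarrow> real"
  assumes lin1: "linear_order r1" and lin2: "linear_order r2" and iet: "IET r1 r2 I T"
begin

definition lo where "lo c = Inf (I c)"
definition hi where "hi c = Sup (I c)"
definition tr where "tr c = (SOME t. \<forall>x\<in>I c. T x = x + t)"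
definition J where "J c = T ` I c"

abbreviation glo where "glo c \<equiv> T (lo c)"

lemma iet_parts:
  "\<forall>c. \<exists>l r. l < r \<and> I c = {l..<r}"
  "(\<Union>c. I c) = {0..<1}"
  "\<forall>c d. c \<noteq> d \<longrightarrow> I c \<inter> I d = {}"
  "\<forall>c d. lt r1 c d \<longrightarrow> (\<forall>x\<in>I c. \<forall>y\<in>I d. x < y)"
  "bij_betw T {0..<1} {0..<1}"
  "\<forall>c. \<exists>t. \<forall>x\<in>I c. T x = x + t"
  "\<forall>c d. lt r2 c d \<longrightarrow> (\<forall>x\<in>T ` I c. \<forall>y\<in>T ` I d. x < y)"
  using iet[unfolded IET_def] by - (elim conjE, assumption)+

lemma I_eq: "I c = {lo c..<hi c}" and lo_hi: "lo c < hi c"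
proof -
  obtain l r where "l < r" "I c = {l..<r}" using iet_parts(1) by metis
  moreover from this have "lo c = l" "hi c = r" unfolding lo_def hi_def by simp_all
  ultimately show "I c = {lo c..<hi c}" "lo c < hi c" by simp_all
qed

lemma lo_in: "lo c \<in> I c"
  using I_eq[of c] lo_hi[of c] by simp

lemma I_Union: "(\<Union>c. I c) = {0..<1}" and I_disj: "c \<noteq> d \<Longrightarrow> I c \<inter> I d = {}"
  and T_bij: "bij_betw T {0..<1} {0..<1}"
  using iet_parts(2,3,5) by simp_all

lemma I_sub: "x \<in> I c \<Longrightarrow> x \<in> {0..<1}"
  using I_Union by blast

lemma ex_letter: "x \<in> {0..<1} \<Longrightarrow> \<exists>c. x \<in> I c"
  using I_Union by blast

lemma I_unique: "x \<in> I c \<Longrightarrow> x \<in> I d \<Longrightarrow> c = d"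
  using I_disj by blast

lemma T_tr: "x \<in> I c \<Longrightarrow> T x = x + tr c"
proof -
  have "\<exists>t. \<forall>x\<in>I c. T x = x + t" using iet_parts(6) by simp
  then have "\<forall>x\<in>I c. T x = x + tr c" unfolding tr_def by (rule someI_ex)
  then show "x \<in> I c \<Longrightarrow> T x = x + tr c" by blast
qed

lemma glo_tr: "glo c = lo c + tr c"
  using T_tr lo_in by blast

lemma J_eq: "J c = {glo c..<hi c + tr c}"
proof -
  have "J c = (\<lambda>x. x + tr c) ` {lo c..<hi c}" unfolding J_def using T_tr I_eq by (metis (no_types, lifting) image_cong)
  then show ?thesis unfolding glo_tr by simp
qed

lemma glo_in: "glo c \<in> J c"
  unfolding J_def using lo_in by blast

lemma T_in: "x \<in> {0..<1} \<Longrightarrow> T x \<in> {0..<1}"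
  using T_bij bij_betwE by blast

lemma T_inj: "x \<in> {0..<1} \<Longrightarrow> y \<in> {0..<1} \<Longrightarrow> T x = T y \<Longrightarrow> x = y"
  using T_bij unfolding bij_betw_def inj_on_def by blast

lemma T_surj: "y \<in> {0..<1} \<Longrightarrow> \<exists>x\<in>{0..<1}. T x = y"
  using T_bij unfolding bij_betw_def by (metis imageE)

lemma J_sub: "x \<in> J c \<Longrightarrow> x \<in> {0..<1}"
  unfolding J_def using T_in I_sub by blast

lemma ex_jletter: "x \<in> {0..<1} \<Longrightarrow> \<exists>c. x \<in> J c"
  using T_surj ex_letter unfolding J_def by blast

lemma J_unique: "x \<in> J c \<Longrightarrow> x \<in> J d \<Longrightarrow> c = d"
  unfolding J_def using T_inj I_sub I_unique by blast

lemma lo_ge: "0 \<le> lo c" and glo_ge: "0 \<le> glo c"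
  using I_sub[OF lo_in[of c]] J_sub[OF glo_in[of c]] by auto

lemma I_order: "x \<in> I c \<Longrightarrow> y \<in> I d \<Longrightarrow> x \<le> y \<Longrightarrow> (c, d) \<in> r1"
proof -
  assume h: "x \<in> I c" "y \<in> I d" "x \<le> y"
  have "\<not> lt r1 d c" using iet_parts(4) h by (meson not_le)
  then show "(c, d) \<in> r1" using lt_iff[OF lin1] by blast
qed

lemma J_order: "x \<in> J c \<Longrightarrow> y \<in> J d \<Longrightarrow> x \<le> y \<Longrightarrow> (c, d) \<in> r2"
proof -
  assume h: "x \<in> J c" "y \<in> J d" "x \<le> y"
  have "\<not> lt r2 d c" using iet_parts(7) h unfolding J_def by (meson not_le)
  then show "(c, d) \<in> r2" using lt_iff[OF lin2] by blast
qed

lemma lt_lo: "x \<in> I c \<Longrightarrow> lt r1 c d \<Longrightarrow> x < lo d"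
  using I_order[OF lo_in, of x c d] lt_iff[OF lin1] by (metis not_le)

lemma lt_glo: "x \<in> J c \<Longrightarrow> lt r2 c d \<Longrightarrow> x < glo d"
  using J_order[OF glo_in, of x c d] lt_iff[OF lin2] by (metis not_le)

lemma ex_lo_0: "\<exists>c. lo c = 0"
proof -
  obtain c where "0 \<in> I c" using ex_letter[of 0] by auto
  then show ?thesis using I_eq[of c] lo_ge[of c] by (intro exI[of _ c]) auto
qed

lemma ex_glo_0: "\<exists>c. glo c = 0"
proof -
  obtain c where "0 \<in> J c" using ex_jletter[of 0] by auto
  then show ?thesis using J_eq[of c] glo_ge[of c] by (intro exI[of _ c]) auto
qed

lemma Tn_Suc: "(T ^^ Suc n) x = (T ^^ n) (T x)"
  by (simp only: funpow_Suc_right comp_apply)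

lemma Tn_in: "x \<in> {0..<1} \<Longrightarrow> (T ^^ n) x \<in> {0..<1}"
  using funpow_in[OF T_bij] .

definition cyl where "cyl u = {z \<in> {0..<1}. \<forall>i<length u. (T ^^ i) z \<in> I (u ! i)}"

lemma cyl_Nil [simp]: "cyl [] = {0..<1}"
  unfolding cyl_def by auto

lemma cyl_snoc: "z \<in> cyl (u @ [d]) \<longleftrightarrow> z \<in> cyl u \<and> (T ^^ length u) z \<in> I d"
  unfolding cyl_def by (auto simp: nth_append less_Suc_eq)

lemma cyl_Cons: "z \<in> cyl (c # u) \<longleftrightarrow> z \<in> I c \<and> T z \<in> cyl u"
proof
  assume z: "z \<in> cyl (c # u)"
  have "z \<in> I c" using z unfolding cyl_def by auto
  moreover have "(T ^^ i) (T z) \<in> I (u ! i)" if "i < length u" for i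
  proof -
    have "Suc i < length (c # u)" using that by simp
    then have "(T ^^ Suc i) z \<in> I ((c # u) ! Suc i)" using z unfolding cyl_def by blast
    then show ?thesis by (simp only: Tn_Suc nth_Cons_Suc)
  qed
  ultimately show "z \<in> I c \<and> T z \<in> cyl u" using z T_in unfolding cyl_def by blast
next
  assume z: "z \<in> I c \<and> T z \<in> cyl u"
  have "(T ^^ i) z \<in> I ((c # u) ! i)" if "i < length (c # u)" for i
  proof (cases i)
    case 0
    then show ?thesis using z by simp
  next
    case (Suc k)
    then have "(T ^^ k) (T z) \<in> I (u ! k)" using z that unfolding cyl_def by simp
    then show ?thesis unfolding Suc by (simp only: Tn_Suc nth_Cons_Suc)
  qed
  then show "z \<in> cyl (c # u)" using z I_sub unfolding cyl_def by blast
qed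

lemma cyl_sub: "z \<in> cyl u \<Longrightarrow> z \<in> {0..<1}"
  unfolding cyl_def by blast

lemma cyl_trans: "i \<le> length u \<Longrightarrow> \<exists>\<tau>. \<forall>z\<in>cyl u. (T ^^ i) z = z + \<tau>"
proof (induction i)
  case 0
  then show ?case by (intro exI[of _ 0]) simp
next
  case (Suc i)
  then obtain \<tau> where \<tau>: "\<forall>z\<in>cyl u. (T ^^ i) z = z + \<tau>" by auto
  have "(T ^^ Suc i) z = z + (\<tau> + tr (u ! i))" if "z \<in> cyl u" for z
  proof -
    have "(T ^^ i) z \<in> I (u ! i)" using that Suc.prems unfolding cyl_def by auto
    then show ?thesis using T_tr \<tau> that by simp
  qed
  then show ?case by blast
qed

text \<open>All points of \<open>cyl u\<close> are moved by \<open>T ^^ length u\<close> through one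
  translation, so prescribing one more letter intersects two intervals.\<close>

lemma cyl_interval: "\<exists>a b. 0 \<le> a \<and> b \<le> 1 \<and> cyl u = {a..<b}"
proof (induction u rule: rev_induct)
  case Nil
  show ?case by (intro exI[of _ 0] exI[of _ 1]) simp
next
  case (snoc d u)
  then obtain a b where ab: "0 \<le> a" "b \<le> 1" "cyl u = {a..<b}" by blast
  obtain \<tau> where \<tau>: "\<forall>z\<in>cyl u. (T ^^ length u) z = z + \<tau>" using cyl_trans by blast
  have "cyl (u @ [d]) = {a..<b} \<inter> {lo d - \<tau>..<hi d - \<tau>}"
    using \<tau> ab(3) by (auto simp: cyl_snoc I_eq)
  then have "cyl (u @ [d]) = {max a (lo d - \<tau>)..<min b (hi d - \<tau>)}" by auto
  then show ?case using ab by (intro exI[of _ "max a (lo d - \<tau>)"] exI[of _ "min b (hi d - \<tau>)"]) auto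
qed

lemma cyl_convex: "x \<in> cyl u \<Longrightarrow> z \<in> cyl u \<Longrightarrow> x \<le> y \<Longrightarrow> y \<le> z \<Longrightarrow> y \<in> cyl u"
proof -
  assume h: "x \<in> cyl u" "z \<in> cyl u" "x \<le> y" "y \<le> z"
  obtain a b where "cyl u = {a..<b}" using cyl_interval by blast
  then show "y \<in> cyl u" using h by simp
qed

definition code_lang where "code_lang = {u. cyl u \<noteq> {}}"

lemma natural_coding_eq: "natural_coding I T = {x. lang x \<subseteq> code_lang}"
  unfolding natural_coding_def code_lang_def cyl_def by auto

text \<open>The witness is the point after the first step: the left letter is read in the images
  \<open>J c\<close>, which follow the bottom order, the right letter in the intervals
  \<open>I d\<close>, which follow the top order.\<close>

lemma ext_code: "(c, d) \<in> ext code_lang u \<longleftrightarrow> (\<exists>y\<in>cyl u. y \<in> J c \<and> (T ^^ length u) y \<in> I d)"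
proof -
  have "z \<in> cyl ([c] @ u @ [d]) \<longleftrightarrow> z \<in> I c \<and> T z \<in> cyl u \<and> (T ^^ length u) (T z) \<in> I d" for z
    using cyl_Cons[of z c "u @ [d]"] cyl_snoc[of "T z" u d] by simp
  then show ?thesis unfolding ext_def code_lang_def J_def by blast
qed

lemma code_ext: "z \<in> cyl u \<Longrightarrow> \<exists>c d. [c] @ u @ [d] \<in> code_lang"
proof -
  assume z: "z \<in> cyl u"
  obtain c where "z \<in> J c" using ex_jletter cyl_sub[OF z] by blast
  moreover obtain d where "(T ^^ length u) z \<in> I d" using ex_letter Tn_in cyl_sub[OF z] by blast
  ultimately have "(c, d) \<in> ext code_lang u" using ext_code z by blast
  then show ?thesis by (auto simp: ext_def)
qed

lemma cyl_append: "z \<in> cyl (u @ v) \<longleftrightarrow> z \<in> cyl u \<and> (T ^^ length u) z \<in> cyl v"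
proof (induction u arbitrary: z)
  case Nil
  then show ?case using cyl_sub by auto
next
  case (Cons c u)
  then show ?case by (simp only: append_Cons cyl_Cons length_Cons Tn_Suc conj_assoc)
qed

lemma code_biextendable: "biextendable code_lang"
  unfolding biextendable_def
proof (intro conjI allI impI ballI)
  show "[] \<in> code_lang" unfolding code_lang_def by auto
next
  fix u v assume "sublist v u \<and> u \<in> code_lang"
  then obtain p q z where "z \<in> cyl (p @ v @ q)" unfolding code_lang_def sublist_def by blast
  then show "v \<in> code_lang" unfolding cyl_append code_lang_def by blast
next
  fix u assume "u \<in> code_lang"
  then show "\<exists>c d. [c] @ u @ [d] \<in> code_lang" using code_ext unfolding code_lang_def by blast
qed

lemma code_letter: "[c] \<in> code_lang"
proof -
  have "lo c \<in> cyl [c]" using lo_in[of c] I_sub[OF lo_in] T_in unfolding cyl_Cons cyl_Nil by blast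
  then show ?thesis unfolding code_lang_def by blast
qed

section \<open>Regularity as absence of connections\<close>

text \<open>Keane's condition. The source may be the left end 0, but the target may not: 0 is always
  the image of some left end.\<close>

definition no_connection where
  "no_connection \<longleftrightarrow> (\<forall>c d j. 1 \<le> j \<and> lo d \<noteq> 0 \<longrightarrow> (T ^^ j) (lo c) \<noteq> lo d)"

lemma lo01: "lo c \<in> {0..<1}"
  using lo_in I_sub by blast

lemma regular_no_connection:
  assumes reg: "IET_regular I T" shows no_connection
  unfolding no_connection_def
proof (intro allI impI notI)
  have main: False if j: "1 \<le> j" "lo d \<noteq> 0" "lo c \<noteq> 0" "(T ^^ j) (lo c) = lo d" for c d j
  proof (cases "lo c = lo d")
    case True
    \<comment> \<open>For a bijection, a periodic forward orbit contains the backward orbit as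
      well.\<close>
    have "orbit T (lo d) \<subseteq> (\<lambda>i. (T ^^ i) (lo d)) ` {..<j}"
    proof
      fix y assume "y \<in> orbit T (lo d)"
      then obtain n where y: "y \<in> {0..<1}" "(T ^^ n) (lo d) = y \<or> (T ^^ n) y = lo d" unfolding orbit_def by blast
      have per: "(T ^^ (i mod j)) (lo d) = (T ^^ i) (lo d)" for i using j True by (intro funpow_mod_eq) simp
      have "\<exists>i. (T ^^ i) (lo d) = y"
      proof (cases "(T ^^ n) (lo d) = y")
        case False
        have "(T ^^ (n * j)) (lo d) = lo d" using per[of "n * j"] by simp
        then have "(T ^^ n) y = (T ^^ (n * j)) (lo d)" using False y(2) by simp
        moreover have "n \<le> n * j" using j(1) by simp
        ultimately have "y = (T ^^ (n * j - n)) (lo d)" using funpow_cancel[OF T_bij y(1) lo01] by blast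
        then show ?thesis by blast
      qed blast
      then obtain i where "(T ^^ (i mod j)) (lo d) = y" using per by blast
      moreover have "i mod j < j" using j(1) by simp
      ultimately show "y \<in> (\<lambda>i. (T ^^ i) (lo d)) ` {..<j}" by blast
    qed
    then have "finite (orbit T (lo d))" using finite_surj[of "{..<j}"] by blast
    then show False using reg j(2) unfolding IET_regular_def lo_def by blast
  next
    case False
    have "lo d \<in> orbit T (lo c)" "lo d \<in> orbit T (lo d)"
      unfolding orbit_def using j lo01 by (auto intro: exI[of _ j] exI[of _ 0])
    then show False using reg j False unfolding IET_regular_def lo_def by blast
  qed
  fix c d j assume h: "1 \<le> j \<and> lo d \<noteq> 0" and eq: "(T ^^ j) (lo c) = lo d"
  show False
  proof (cases "lo c = 0")
    case True
    \<comment> \<open>0 is the image of a left end \<open>lo e\<close>, nonzero since otherwise 0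
      would be fixed. Prolonging the connection by this step reduces to a nonzero source.\<close>
    obtain e where e: "glo e = 0" using ex_glo_0 by blast
    have "lo e \<noteq> 0"
    proof
      assume "lo e = 0"
      then have "T 0 = 0" using e by simp
      then have "(T ^^ j) 0 = 0" by (induction j) auto
      then show False using True eq h by simp
    qed
    moreover have "(T ^^ Suc j) (lo e) = lo d" using e True eq by (simp only: Tn_Suc)
    ultimately show False using main[of "Suc j" d e] h by simp
  qed (use main h eq in blast)
qed

text \<open>A finite orbit makes a left end return to itself, and two meeting orbits make one left
  end an iterate of the other, by injectivity. Either way there is a connection.\<close>

lemma no_connection_regular:
  assumes nc: no_connection shows "IET_regular I T"
proof -
  have no1: "j = 0" if "lo d \<noteq> 0" "(T ^^ j) (lo c) = lo d" for c d j
    using nc that unfolding no_connection_def by (metis less_one not_le)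
  have no: "lo c = lo d" if "lo d \<noteq> 0" "(T ^^ j) (lo c) = lo d" for c d j
    using no1[OF that] that by simp
  have inf: "infinite (orbit T (lo c))" if c: "lo c \<noteq> 0" for c
  proof
    assume fin: "finite (orbit T (lo c))"
    have "range (\<lambda>n. (T ^^ n) (lo c)) \<subseteq> orbit T (lo c)" unfolding orbit_def using Tn_in[OF lo01] by blast
    then have "finite (range (\<lambda>n. (T ^^ n) (lo c)))" using fin finite_subset by blast
    then have "\<not> inj (\<lambda>n. (T ^^ n) (lo c))" using finite_imageD infinite_UNIV_nat by blast
    then obtain m n where mn: "m < n" "(T ^^ m) (lo c) = (T ^^ n) (lo c)"
      unfolding inj_def by (metis linorder_neqE_nat)
    then have "lo c = (T ^^ (n - m)) (lo c)" using funpow_cancel[OF T_bij lo01 lo01] by simp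
    then show False using no1[OF c, of "n - m" c] mn(1) by simp
  qed
  have disj: "orbit T (lo c) \<inter> orbit T (lo d) = {}" if cd: "lo c \<noteq> 0" "lo d \<noteq> 0" "lo c \<noteq> lo d" for c d
  proof (rule ccontr)
    assume "\<not> ?thesis"
    then obtain y m n where y: "y \<in> {0..<1}" and m: "(T ^^ m) (lo c) = y \<or> (T ^^ m) y = lo c"
      and n: "(T ^^ n) (lo d) = y \<or> (T ^^ n) y = lo d" unfolding orbit_def by blast
    have "\<exists>j. (T ^^ j) (lo c) = lo d \<or> (T ^^ j) (lo d) = lo c"
    proof (cases "(T ^^ m) (lo c) = y")
      case c: True
      show ?thesis
      proof (cases "(T ^^ n) (lo d) = y")
        case True
        show ?thesis
        proof (cases "m \<le> n")
          case True
          then show ?thesis using funpow_cancel[OF T_bij lo01 lo01, of m c n d] c \<open>(T ^^ n) (lo d) = y\<close> by metis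
        next
          case False
          then show ?thesis using funpow_cancel[OF T_bij lo01 lo01, of n d m c] c \<open>(T ^^ n) (lo d) = y\<close> by (metis nat_le_linear)
        qed
      next
        case False
        then have "(T ^^ (n + m)) (lo c) = lo d" using n c by (simp add: funpow_add)
        then show ?thesis by blast
      qed
    next
      case c: False
      then have c: "(T ^^ m) y = lo c" using m by blast
      show ?thesis
      proof (cases "(T ^^ n) (lo d) = y")
        case True
        then have "(T ^^ (m + n)) (lo d) = lo c" using c by (simp add: funpow_add)
        then show ?thesis by blast
      next
        case False
        then have d: "(T ^^ n) y = lo d" using n by blast
        show ?thesis
        proof (cases "m \<le> n")
          case True
          have "(T ^^ (n - m + m)) y = (T ^^ (n - m)) ((T ^^ m) y)" by (simp only: funpow_add comp_apply)
          then show ?thesis using True c d by auto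
        next
          case False
          have "(T ^^ (m - n + n)) y = (T ^^ (m - n)) ((T ^^ n) y)" by (simp only: funpow_add comp_apply)
          then show ?thesis using False c d by auto
        qed
      qed
    qed
    then show False using no cd by metis
  qed
  show ?thesis unfolding IET_regular_def lo_def[symmetric] using inf disj by blast
qed

text \<open>On \<open>cyl u\<close> the left letter, read from the point, and the right letter, read
  from its translate, both increase with the point.\<close>

lemma code_planar: "planar r2 r1 (ext code_lang u)"
  unfolding planar_def
proof (intro allI impI)
  fix c1 d1 c2 d2 assume h: "(c1, d1) \<in> ext code_lang u \<and> (c2, d2) \<in> ext code_lang u \<and> lt r2 c1 c2"
  then obtain y1 y2 where y: "y1 \<in> cyl u" "y1 \<in> J c1" "(T ^^ length u) y1 \<in> I d1"
    "y2 \<in> cyl u" "y2 \<in> J c2" "(T ^^ length u) y2 \<in> I d2" unfolding ext_code by blast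
  have "y1 < y2" using J_order[OF y(5,2)] h lt_iff[OF lin2] by (metis not_le)
  moreover obtain \<tau> where "\<forall>z\<in>cyl u. (T ^^ length u) z = z + \<tau>" using cyl_trans by blast
  ultimately have "(T ^^ length u) y1 \<le> (T ^^ length u) y2" using y by simp
  then show "(d1, d2) \<in> r1" using I_order y by blast
qed

text \<open>Let \<open>c\<close> and \<open>d\<close> be the first letters above a cut. Inside
  \<open>cyl u\<close>, the points above the cut begin at \<open>glo c\<close> when judged by the
  left letter and at the preimage of \<open>lo d\<close> when judged by the right letter. The two
  agree, so \<open>T ^^ Suc ?n\<close> maps \<open>lo c\<close> to \<open>lo d\<close>.\<close>

lemma code_uncut:
  assumes nc: no_connection shows "uncut r2 r1 (ext code_lang u)"
  unfolding uncut_def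
proof (intro allI impI, rule ccontr)
  fix P Q assume h: "downset r2 P \<and> downset r1 Q \<and> (\<forall>(c, d)\<in>ext code_lang u. c \<in> P \<longleftrightarrow> d \<in> Q)"
    and n: "\<not> ((\<forall>(c, d)\<in>ext code_lang u. c \<in> P) \<or> (\<forall>(c, d)\<in>ext code_lang u. c \<notin> P))"
  let ?E = "ext code_lang u" and ?n = "length u"
  have iff: "c \<in> P \<longleftrightarrow> d \<in> Q" if "y \<in> cyl u" "y \<in> J c" "(T ^^ ?n) y \<in> I d" for y c d
    using h that ext_code[of c d u] by blast
  obtain \<tau> where \<tau>: "\<forall>z\<in>cyl u. (T ^^ ?n) z = z + \<tau>" using cyl_trans by blast
  obtain a1 b1 a2 b2 where ab: "(a1, b1) \<in> ?E" "a1 \<in> P" "(a2, b2) \<in> ?E" "a2 \<notin> P" using n by blast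
  then have b: "b1 \<in> Q" "b2 \<notin> Q" using h by blast+
  obtain y1 where y1: "y1 \<in> cyl u" "y1 \<in> J a1" "(T ^^ ?n) y1 \<in> I b1" using ab(1) ext_code by blast
  obtain c where c: "c \<notin> P" "\<exists>d. (c, d) \<in> ?E" "\<forall>c' d. (c', d) \<in> ?E \<and> c' \<notin> P \<longrightarrow> (c, c') \<in> r2"
    using lin_min[OF lin2, of "{c. c \<notin> P \<and> (\<exists>d. (c, d) \<in> ?E)}"] ab by auto
  obtain d where d: "d \<notin> Q" "\<exists>c. (c, d) \<in> ?E" "\<forall>c d'. (c, d') \<in> ?E \<and> d' \<notin> Q \<longrightarrow> (d, d') \<in> r1"
    using lin_min[OF lin1, of "{d. d \<notin> Q \<and> (\<exists>c. (c, d) \<in> ?E)}"] ab b by auto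
  obtain y where y: "y \<in> cyl u" "y \<in> J c" using c(2) ext_code by blast
  have "lt r2 a1 c" using h ab(2) c(1) lt_iff[OF lin2] unfolding downset_def by blast
  then have y1g: "y1 < glo c" using lt_glo y1(2) by blast
  have zc: "glo c \<in> cyl u" using cyl_convex[OF y1(1) y(1)] y1g y(2) by (simp add: J_eq)
  obtain y' where y': "y' \<in> cyl u" "(T ^^ ?n) y' \<in> I d" using d(2) ext_code by blast
  have "lt r1 b1 d" using h b(1) d(1) lt_iff[OF lin1] unfolding downset_def by blast
  then have y1l: "(T ^^ ?n) y1 < lo d" using lt_lo y1(3) by blast
  define z' where "z' = lo d - \<tau>"
  have "y1 \<le> z'" "z' \<le> y'" using y1l y'(2) \<tau> y1(1) y'(1) unfolding z'_def by (auto simp: I_eq)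
  then have zd: "z' \<in> cyl u" using cyl_convex y1(1) y'(1) by blast
  then have Tz': "(T ^^ ?n) z' = lo d" using \<tau> unfolding z'_def by simp
  have "glo c = z'"
  proof (cases "glo c" z' rule: linorder_cases)
    case less
    obtain e where e: "(T ^^ ?n) (glo c) \<in> I e" using ex_letter Tn_in cyl_sub[OF zc] by blast
    then have "e \<notin> Q" using iff[OF zc glo_in] c(1) by blast
    moreover have "(c, e) \<in> ?E" using ext_code zc glo_in e by blast
    ultimately have "(d, e) \<in> r1" using d(3) by blast
    moreover have "(T ^^ ?n) (glo c) < lo d" using less \<tau> zc Tz' zd by simp
    then have "(e, d) \<in> r1" "e \<noteq> d" using I_order[OF e lo_in] e I_eq[of d] by auto
    ultimately show ?thesis using lin_antisym[OF lin1] by blast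
  next
    case greater
    obtain e where e: "z' \<in> J e" using ex_jletter cyl_sub[OF zd] by blast
    have "(T ^^ ?n) z' \<in> I d" using Tz' lo_in by simp
    then have "e \<notin> P" "(e, d) \<in> ?E" using iff[OF zd e] d(1) ext_code zd e by blast+
    then have "(c, e) \<in> r2" using c(3) by blast
    moreover have "(e, c) \<in> r2" "e \<noteq> c" using J_order[OF e glo_in] greater e J_eq[of c] by auto
    ultimately show ?thesis using lin_antisym[OF lin2] by blast
  qed simp
  then have "(T ^^ Suc ?n) (lo c) = lo d" using Tz' by (simp only: Tn_Suc)
  moreover have "lo d \<noteq> 0" using y1l Tn_in[OF cyl_sub[OF y1(1)], of ?n] by auto
  ultimately show False using nc unfolding no_connection_def by (metis le_add1 plus_1_eq_Suc)
qed

end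

section \<open>Recurrence of piecewise translations\<close>

text \<open>A setting shared by \<open>T\<close>, with breaks among the left ends, and its inverse,
  with breaks among their images.\<close>

locale piecewise =
  fixes T :: "real \<Rightarrow> real" and D :: "real set"
  assumes bij: "bij_betw T {0..<1} {0..<1}" and finD: "finite D"
    and piece: "\<And>x y. 0 \<le> x \<Longrightarrow> x < y \<Longrightarrow> y \<le> 1 \<Longrightarrow> (\<forall>d\<in>D. \<not> (x < d \<and> d < y)) \<Longrightarrow> \<exists>t. \<forall>z\<in>{x..<y}. T z = z + t"
begin

text \<open>An interval is cut at the finitely many points whose orbit meets a discontinuity or an end
  point before returning; each piece then returns as a whole.\<close>

lemma bounded_return:
  assumes a: "0 \<le> a" and b: "b \<le> 1"
  shows "\<exists>R. \<forall>z\<in>{a..<b}. \<exists>m. 1 \<le> m \<and> m \<le> R \<and> (T ^^ m) z \<in> {a..<b}"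
proof -
  let ?K = "{a..<b}"
  define E where "E = D \<union> {a, b}"
  \<comment> \<open>The points of the interval whose orbit meets \<open>e\<close> no later than its
    first return; by injectivity there is at most one for each \<open>e\<close>.\<close>
  define Ce where "Ce e = {c \<in> ?K. \<exists>k\<ge>1. (T ^^ k) c = e \<and> (\<forall>j. 1 \<le> j \<and> j < k \<longrightarrow> (T ^^ j) c \<notin> ?K)}" for e
  define C where "C = E \<union> (\<Union>e\<in>E. Ce e)"
  have K01: "z \<in> {0..<1}" if "z \<in> ?K" for z using that a b by auto
  have Tin: "(T ^^ k) z \<in> {0..<1}" if "z \<in> {0..<1}" for z k using funpow_in[OF bij that] .
  have Ce_unique: "c = c'" if "c \<in> Ce e" "c' \<in> Ce e" for c c' e
  proof -
    have wlog: "c = c'" if c: "c \<in> ?K" "(T ^^ k) c = e" "k \<ge> 1" and c': "c' \<in> ?K" "(T ^^ k') c' = e"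
      "\<forall>j. 1 \<le> j \<and> j < k' \<longrightarrow> (T ^^ j) c' \<notin> ?K" and le: "k \<le> k'" for c c' k k'
    proof -
      have eq: "c = (T ^^ (k' - k)) c'" using funpow_cancel[OF bij K01[OF c(1)] K01[OF c'(1)]] c c' le by simp
      have "k' - k = 0"
      proof (rule ccontr)
        assume "k' - k \<noteq> 0"
        then have "1 \<le> k' - k" "k' - k < k'" using c(3) by auto
        then show False using c'(3) eq c(1) by metis
      qed
      then show ?thesis using eq by simp
    qed
    obtain k where k: "k \<ge> 1" "(T ^^ k) c = e" "\<forall>j. 1 \<le> j \<and> j < k \<longrightarrow> (T ^^ j) c \<notin> ?K" "c \<in> ?K"
      using \<open>c \<in> Ce e\<close> unfolding Ce_def by blast
    obtain k' where k': "k' \<ge> 1" "(T ^^ k') c' = e" "\<forall>j. 1 \<le> j \<and> j < k' \<longrightarrow> (T ^^ j) c' \<notin> ?K" "c' \<in> ?K"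
      using \<open>c' \<in> Ce e\<close> unfolding Ce_def by blast
    show ?thesis
    proof (cases "k \<le> k'")
      case True
      show ?thesis by (rule wlog[OF k(4,2,1) k'(4,2,3) True])
    next
      case False
      then have "k' \<le> k" by simp
      show ?thesis by (rule wlog[OF k'(4,2,1) k(4,2,3) \<open>k' \<le> k\<close>, symmetric])
    qed
  qed
  have "finite (Ce e)" for e
  proof (cases "Ce e = {}")
    case False
    then obtain c where "c \<in> Ce e" by blast
    then have "Ce e \<subseteq> {c}" using Ce_unique by blast
    then show ?thesis using finite_subset by blast
  qed simp
  then have finC: "finite C" unfolding C_def E_def using finD by simp
  have piece_ret: "\<exists>m\<ge>1. \<forall>z\<in>{x..<y}. (T ^^ m) z \<in> ?K"
    if xy: "a \<le> x" "x < y" "y \<le> b" "\<forall>c\<in>C. \<not> (x < c \<and> c < y)" for x y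
  proof -
    have sub: "z \<in> ?K" if "z \<in> {x..<y}" for z using that xy by auto
    \<comment> \<open>As long as the piece has not returned, an interior point whose orbit meets
      \<open>E\<close> would be one of the cut points in \<open>C\<close>.\<close>
    have noE: "\<not> (\<exists>c. x < c \<and> c < y \<and> (T ^^ k) c \<in> E)"
      if av: "\<forall>j. 1 \<le> j \<and> j < k \<longrightarrow> (\<forall>z\<in>{x..<y}. (T ^^ j) z \<notin> ?K)" for k
    proof
      assume "\<exists>c. x < c \<and> c < y \<and> (T ^^ k) c \<in> E"
      then obtain c where c: "x < c" "c < y" "(T ^^ k) c \<in> E" by blast
      then have cin: "c \<in> {x..<y}" by simp
      have "c \<in> C"
      proof (cases "k = 0")
        case True
        then show ?thesis using c unfolding C_def by simp
      next
        case False
        then have "1 \<le> k" by simp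
        moreover have "\<forall>j. 1 \<le> j \<and> j < k \<longrightarrow> (T ^^ j) c \<notin> ?K" using av cin by blast
        ultimately have "c \<in> Ce ((T ^^ k) c)" unfolding Ce_def using sub[OF cin] by blast
        then show ?thesis using c(3) unfolding C_def by blast
      qed
      then show False using xy(4) c by blast
    qed
    have transl: "(\<forall>j. 1 \<le> j \<and> j < k \<longrightarrow> (\<forall>z\<in>{x..<y}. (T ^^ j) z \<notin> ?K)) \<Longrightarrow> \<exists>t. \<forall>z\<in>{x..<y}. (T ^^ k) z = z + t" for k
    proof (induction k)
      case 0
      then show ?case by (intro exI[of _ 0]) simp
    next
      case (Suc k)
      then obtain t where t: "\<forall>z\<in>{x..<y}. (T ^^ k) z = z + t" by auto
      have noD: "\<forall>d\<in>D. \<not> (x + t < d \<and> d < y + t)"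
      proof (intro ballI notI)
        fix d assume d: "d \<in> D" "x + t < d \<and> d < y + t"
        then have "(T ^^ k) (d - t) = d" "x < d - t" "d - t < y" using t by auto
        then show False using noE[of k] Suc.prems d(1) unfolding E_def by auto
      qed
      have lt1: "z + t < 1 \<and> 0 \<le> z + t" if "z \<in> {x..<y}" for z
        using t that Tin[OF K01[OF sub[OF that]], of k] by auto
      have "y + t \<le> 1"
      proof (rule ccontr)
        assume "\<not> ?thesis"
        then have "max x (1 - t) \<in> {x..<y}" using xy by auto
        then have "max x (1 - t) + t < 1" using lt1 by blast
        then show False by linarith
      qed
      moreover have "0 \<le> x + t" using lt1[of x] xy by simp
      ultimately obtain s where s: "\<forall>z\<in>{x + t..<y + t}. T z = z + s"
        using piece[of "x + t" "y + t"] noD xy by auto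
      have "\<forall>z\<in>{x..<y}. (T ^^ Suc k) z = z + (t + s)" using t s by simp
      then show ?case by blast
    qed
    \<comment> \<open>Otherwise all iterates of the piece are translates of it inside the unit
      interval, pairwise disjoint by injectivity. Slots of length \<open>\<delta>\<close> and the
      pigeonhole principle give two of them closer than \<open>\<delta>\<close>.\<close>
    have "\<exists>k\<ge>1. \<exists>z\<in>{x..<y}. (T ^^ k) z \<in> ?K"
    proof (rule ccontr)
      assume n: "\<not> ?thesis"
      then have "\<exists>t. \<forall>z\<in>{x..<y}. (T ^^ k) z = z + t" for k using transl[of k] by blast
      then obtain t where t: "\<And>k z. z \<in> {x..<y} \<Longrightarrow> (T ^^ k) z = z + t k" by metis
      have sep: "y - x \<le> \<bar>t k - t j\<bar>" if "k < j" for k j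
      proof (rule ccontr)
        assume "\<not> ?thesis"
        then have l: "\<bar>t k - t j\<bar> < y - x" by simp
        obtain z z' where z: "z \<in> {x..<y}" "z' \<in> {x..<y}" "z + t k = z' + t j"
        proof (cases "t k \<le> t j")
          case True
          then show thesis using that[of "x + (t j - t k)" x] l xy by auto
        next
          case False
          then show thesis using that[of x "x + (t k - t j)"] l xy by auto
        qed
        then have "(T ^^ k) z = (T ^^ j) z'" using t by simp
        then have "z = (T ^^ (j - k)) z'"
          using funpow_cancel[OF bij K01[OF sub[OF z(1)]] K01[OF sub[OF z(2)]]] that by simp
        moreover have "1 \<le> j - k" using that by simp
        ultimately show False using n z sub by metis
      qed
      define \<delta> where "\<delta> = y - x"
      have \<delta>: "0 < \<delta>" using xy unfolding \<delta>_def by simp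
      define g where "g k = \<lfloor>(x + t k) / \<delta>\<rfloor>" for k
      have "g k \<in> {0..\<lfloor>1 / \<delta>\<rfloor>}" for k
      proof -
        have "(T ^^ k) x = x + t k" using t xy by simp
        then have "0 \<le> x + t k" "x + t k < 1" using Tin[OF K01[OF sub[of x]], of k] xy by auto
        then show ?thesis unfolding g_def using \<delta> by (auto intro!: floor_mono divide_right_mono)
      qed
      then have "finite (range g)" by (meson finite_atLeastAtMost_int finite_subset image_subsetI)
      then have "\<not> inj g" using finite_imageD infinite_UNIV_nat by blast
      then obtain k j where kj: "k < j" "g k = g j" unfolding inj_def by (metis linorder_neqE_nat)
      have "\<bar>(x + t k) / \<delta> - (x + t j) / \<delta>\<bar> < 1" using kj(2) unfolding g_def by linarith
      then have "\<bar>(t k - t j) / \<delta>\<bar> < 1" by (simp add: add_divide_distrib diff_divide_distrib)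
      then have "\<bar>t k - t j\<bar> < \<delta>" using \<delta> by (simp add: abs_divide)
      then show False using sep[OF kj(1)] unfolding \<delta>_def by simp
    qed
    then obtain k where k: "1 \<le> k \<and> (\<exists>z\<in>{x..<y}. (T ^^ k) z \<in> ?K)"
      "\<forall>j<k. \<not> (1 \<le> j \<and> (\<exists>z\<in>{x..<y}. (T ^^ j) z \<in> ?K))"
      using exists_least_iff[of "\<lambda>k. 1 \<le> k \<and> (\<exists>z\<in>{x..<y}. (T ^^ k) z \<in> ?K)"] by blast
    then have av: "\<forall>j. 1 \<le> j \<and> j < k \<longrightarrow> (\<forall>z\<in>{x..<y}. (T ^^ j) z \<notin> ?K)" by blast
    obtain t where t: "\<forall>z\<in>{x..<y}. (T ^^ k) z = z + t" using transl[OF av] by blast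
    obtain z0 where z0: "z0 \<in> {x..<y}" "(T ^^ k) z0 \<in> ?K" using k(1) by blast
    have ne: "\<not> (x + t < e \<and> e < y + t)" if "e \<in> {a, b}" for e
    proof
      assume "x + t < e \<and> e < y + t"
      then have "(T ^^ k) (e - t) = e" "x < e - t" "e - t < y" using t by auto
      then show False using noE[OF av] that unfolding E_def by auto
    qed
    have "(T ^^ k) z \<in> ?K" if "z \<in> {x..<y}" for z
      using t z0 that ne[of a] ne[of b] by auto
    then show ?thesis using k(1) by blast
  qed
  define X where "X = insert a (C \<inter> ?K)"
  define Y where "Y = insert b (C \<inter> ?K)"
  have finX: "finite X" "finite Y" unfolding X_def Y_def using finC by auto
  have "\<exists>m. (a \<le> x \<and> x < y \<and> y \<le> b \<and> (\<forall>c\<in>C. \<not> (x < c \<and> c < y))) \<longrightarrow> 1 \<le> m \<and> (\<forall>z\<in>{x..<y}. (T ^^ m) z \<in> ?K)" for x y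
    using piece_ret by blast
  then obtain m where m: "\<And>x y. a \<le> x \<and> x < y \<and> y \<le> b \<and> (\<forall>c\<in>C. \<not> (x < c \<and> c < y)) \<Longrightarrow>
      1 \<le> m x y \<and> (\<forall>z\<in>{x..<y}. (T ^^ m x y) z \<in> ?K)" by metis
  \<comment> \<open>A crude bound: the sum over all pairs of cut points dominates the return time of
    each piece.\<close>
  define R where "R = (\<Sum>x\<in>X. \<Sum>y\<in>Y. m x y)"
  have "\<exists>n. 1 \<le> n \<and> n \<le> R \<and> (T ^^ n) z \<in> ?K" if z: "z \<in> ?K" for z
  proof -
    define x where "x = Max {c \<in> X. c \<le> z}"
    define y where "y = Min {c \<in> Y. z < c}"
    have x: "x \<in> X" "x \<le> z" "\<forall>c\<in>X. c \<le> z \<longrightarrow> c \<le> x"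
    proof -
      have ne: "{c \<in> X. c \<le> z} \<noteq> {}" using z unfolding X_def by auto
      have f: "finite {c \<in> X. c \<le> z}" using finX by simp
      show "x \<in> X" "x \<le> z" using Max_in[OF f ne] unfolding x_def by auto
      show "\<forall>c\<in>X. c \<le> z \<longrightarrow> c \<le> x" using Max_ge[OF f] unfolding x_def by auto
    qed
    have y: "y \<in> Y" "z < y" "\<forall>c\<in>Y. z < c \<longrightarrow> y \<le> c"
    proof -
      have ne: "{c \<in> Y. z < c} \<noteq> {}" using z unfolding Y_def by auto
      have f: "finite {c \<in> Y. z < c}" using finX by simp
      show "y \<in> Y" "z < y" using Min_in[OF f ne] unfolding y_def by auto
      show "\<forall>c\<in>Y. z < c \<longrightarrow> y \<le> c" using Min_le[OF f] unfolding y_def by auto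
    qed
    have ax: "a \<le> x" "y \<le> b" using x(1) y(1) unfolding X_def Y_def by auto
    have "\<forall>c\<in>C. \<not> (x < c \<and> c < y)"
    proof (intro ballI notI)
      fix c assume c: "c \<in> C" "x < c \<and> c < y"
      then have "c \<in> X" "c \<in> Y" using ax unfolding X_def Y_def by auto
      then show False using x(3) y(3) c by (meson not_le)
    qed
    then have mm: "1 \<le> m x y" "(T ^^ m x y) z \<in> ?K" using m[of x y] ax x y by auto
    have "m x y \<le> (\<Sum>y\<in>Y. m x y)" using y(1) finX by (intro member_le_sum) auto
    also have "\<dots> \<le> R" unfolding R_def using x(1) finX by (intro member_le_sum[of x X "\<lambda>x. \<Sum>y\<in>Y. m x y"]) auto
    finally show ?thesis using mm by blast
  qed
  then show ?thesis by blast
qed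

end

section \<open>Piecewise constant sets and their jumps\<close>

definition piecewise_const :: "real set \<Rightarrow> bool" where
  "piecewise_const A \<longleftrightarrow> (\<exists>D. finite D \<and> (\<forall>x y. 0 \<le> x \<and> x < y \<and> y < 1 \<and> D \<inter> {x<..y} = {} \<longrightarrow> (x \<in> A \<longleftrightarrow> y \<in> A)))"

text \<open>Left discontinuities of membership. Unlike the set \<open>D\<close> in
  \<open>piecewise_const\<close> they are determined by \<open>A\<close>, so an invariant set has
  its jumps carried along by \<open>T\<close> wherever \<open>T\<close> is continuous.\<close>

definition jump :: "real set \<Rightarrow> real \<Rightarrow> bool" where
  "jump A p \<longleftrightarrow> 0 < p \<and> p < 1 \<and> (\<forall>q<p. \<exists>x. q < x \<and> x < p \<and> 0 \<le> x \<and> (x \<in> A \<longleftrightarrow> p \<notin> A))"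

lemma piecewise_const_Un: "piecewise_const A \<Longrightarrow> piecewise_const B \<Longrightarrow> piecewise_const (A \<union> B)"
proof -
  assume "piecewise_const A" "piecewise_const B"
  then obtain D E where D: "finite D" "\<forall>x y. 0 \<le> x \<and> x < y \<and> y < 1 \<and> D \<inter> {x<..y} = {} \<longrightarrow> (x \<in> A \<longleftrightarrow> y \<in> A)"
    and E: "finite E" "\<forall>x y. 0 \<le> x \<and> x < y \<and> y < 1 \<and> E \<inter> {x<..y} = {} \<longrightarrow> (x \<in> B \<longleftrightarrow> y \<in> B)"
    unfolding piecewise_const_def by blast
  have "x \<in> A \<union> B \<longleftrightarrow> y \<in> A \<union> B" if "0 \<le> x \<and> x < y \<and> y < 1 \<and> (D \<union> E) \<inter> {x<..y} = {}" for x y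
  proof -
    have "D \<inter> {x<..y} = {}" "E \<inter> {x<..y} = {}" using that by blast+
    then have "x \<in> A \<longleftrightarrow> y \<in> A" "x \<in> B \<longleftrightarrow> y \<in> B" using D(2) E(2) that by blast+
    then show ?thesis by blast
  qed
  then show "piecewise_const (A \<union> B)" unfolding piecewise_const_def using D(1) E(1) by (intro exI[of _ "D \<union> E"]) blast
qed

text \<open>Every jump lies in \<open>D\<close>. If there is none between \<open>x\<close> and
  \<open>y\<close>, membership passes from the last point of \<open>D\<close> to a point just left
  of it, and fewer points of \<open>D\<close> remain.\<close>

lemma piecewise_const_jumps:
  assumes "piecewise_const A"
  shows "finite {p. jump A p}" and "0 \<le> x \<Longrightarrow> x < y \<Longrightarrow> y < 1 \<Longrightarrow> (\<forall>p. x < p \<and> p \<le> y \<longrightarrow> \<not> jump A p) \<Longrightarrow> (x \<in> A \<longleftrightarrow> y \<in> A)"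
proof -
  obtain D where D: "finite D" "\<And>x y. 0 \<le> x \<Longrightarrow> x < y \<Longrightarrow> y < 1 \<Longrightarrow> D \<inter> {x<..y} = {} \<Longrightarrow> (x \<in> A \<longleftrightarrow> y \<in> A)"
    using assms unfolding piecewise_const_def by blast
  have "{p. jump A p} \<subseteq> D"
  proof
    fix p assume "p \<in> {p. jump A p}"
    then have p: "jump A p" by simp
    show "p \<in> D"
    proof (rule ccontr)
      assume nD: "p \<notin> D"
      define q where "q = Max (insert 0 {d \<in> D. d < p})"
      have f: "finite (insert 0 {d \<in> D. d < p})" using D(1) by simp
      have "q < p" using Max_in[OF f] p unfolding q_def jump_def by auto
      then obtain x where x: "q < x" "x < p" "0 \<le> x" "x \<in> A \<longleftrightarrow> p \<notin> A" using p unfolding jump_def by blast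
      have "D \<inter> {x<..p} = {}"
      proof (rule ccontr)
        assume "D \<inter> {x<..p} \<noteq> {}"
        then obtain d where d: "d \<in> D" "x < d" "d \<le> p" by auto
        then have "d < p" using nD by (cases "d = p") auto
        then have "d \<le> q" unfolding q_def using d f by (intro Max_ge) auto
        then show False using d x by simp
      qed
      then have "x \<in> A \<longleftrightarrow> p \<in> A" using D(2) x p unfolding jump_def by blast
      then show False using x(4) by blast
    qed
  qed
  then show "finite {p. jump A p}" using D(1) finite_subset by blast
  show "x \<in> A \<longleftrightarrow> y \<in> A" if "0 \<le> x" "x < y" "y < 1" "\<forall>p. x < p \<and> p \<le> y \<longrightarrow> \<not> jump A p"
    using that
  proof (induction "card (D \<inter> {x<..y})" arbitrary: y rule: less_induct)
    case less
    show ?case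
    proof (cases "D \<inter> {x<..y} = {}")
      case True
      then show ?thesis using D(2) less.prems by blast
    next
      case False
      define p where "p = Max (D \<inter> {x<..y})"
      have f: "finite (D \<inter> {x<..y})" using D(1) by simp
      have p: "p \<in> D" "x < p" "p \<le> y" using Max_in[OF f False] unfolding p_def by auto
      have py: "p \<in> A \<longleftrightarrow> y \<in> A"
      proof (cases "p = y")
        case False
        have "D \<inter> {p<..y} = {}"
        proof (rule ccontr)
          assume "D \<inter> {p<..y} \<noteq> {}"
          then obtain d where d: "d \<in> D" "p < d" "d \<le> y" by auto
          then have "d \<in> D \<inter> {x<..y}" using p(2) by auto
          then have "d \<le> p" unfolding p_def using f by (intro Max_ge)
          then show False using d by simp
        qed
        then show ?thesis using D(2)[of p y] p False less.prems by auto
      qed simp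
      have "\<not> jump A p" using less.prems(4) p by blast
      then obtain q where q: "q < p" "\<forall>x. q < x \<and> x < p \<and> 0 \<le> x \<longrightarrow> (x \<in> A \<longleftrightarrow> p \<in> A)"
        using p less.prems unfolding jump_def by force
      define z where "z = (max q x + p) / 2"
      have z: "max q x < z" "z < p" using q(1) p(2) unfolding z_def by auto
      have zp: "z \<in> A \<longleftrightarrow> p \<in> A" using q(2) z less.prems(1) by auto
      have "D \<inter> {x<..z} \<subseteq> D \<inter> {x<..y}" "p \<in> D \<inter> {x<..y}" "p \<notin> D \<inter> {x<..z}" using z p by auto
      then have "D \<inter> {x<..z} \<subset> D \<inter> {x<..y}" by blast
      then have "card (D \<inter> {x<..z}) < card (D \<inter> {x<..y})" using f by (intro psubset_card_mono)
      then have "x \<in> A \<longleftrightarrow> z \<in> A" using less.hyps[of z] less.prems z p by auto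
      then show ?thesis using zp py by blast
    qed
  qed
qed

section \<open>Regular interval exchanges are minimal\<close>

context iet
begin

lemma same_I:
  assumes "x \<le> z" "\<not> (x < lo c \<and> lo c \<le> z)" "z \<in> I c" shows "x \<in> I c"
proof -
  have "lo c \<le> z" "z < hi c" using assms(3) I_eq[of c] by auto
  then have "lo c \<le> x" "x < hi c" using assms(1,2) by linarith+
  then show ?thesis using I_eq[of c] by simp
qed

lemma same_J:
  assumes "x \<le> z" "\<not> (x < glo c \<and> glo c \<le> z)" "z \<in> J c" shows "x \<in> J c"
proof -
  have "glo c \<le> z" "z < hi c + tr c" using assms(3) J_eq[of c] by auto
  then have "glo c \<le> x" "x < hi c + tr c" using assms(1,2) by linarith+
  then show ?thesis using J_eq[of c] by simp
qed

lemma piecewise_T: "piecewise T (range lo)"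
proof
  fix x y :: real assume h: "0 \<le> x" "x < y" "y \<le> 1" "\<forall>d\<in>range lo. \<not> (x < d \<and> d < y)"
  obtain c where c: "x \<in> I c" using ex_letter[of x] h by auto
  have "z \<in> I c" if z: "z \<in> {x..<y}" for z
  proof -
    obtain d where d: "z \<in> I d" using ex_letter[of z] z h by auto
    have "\<not> (x < lo d \<and> lo d \<le> z)" using h(4)[rule_format, of "lo d"] z by auto
    then have "x \<in> I d" using same_I[OF _ _ d] z by simp
    then show ?thesis using c d I_unique by blast
  qed
  then show "\<exists>t. \<forall>z\<in>{x..<y}. T z = z + t" using T_tr by blast
qed (use T_bij in auto)

abbreviation T' where "T' \<equiv> inv_into {0..<1} T"

lemma T'_bij: "bij_betw T' {0..<1} {0..<1}"
  using bij_betw_inv_into[OF T_bij] .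

lemma T'_in: "x \<in> {0..<1} \<Longrightarrow> T' x \<in> {0..<1}"
  using T'_bij bij_betwE by blast

lemma T_T': "x \<in> {0..<1} \<Longrightarrow> T (T' x) = x"
  using bij_betw_inv_into_right[OF T_bij] .

lemma T'_T: "x \<in> {0..<1} \<Longrightarrow> T' (T x) = x"
  using bij_betw_inv_into_left[OF T_bij] .

lemma T'_I: "x \<in> J c \<Longrightarrow> T' x \<in> I c \<and> T' x = x - tr c"
proof -
  assume "x \<in> J c"
  then obtain z where z: "z \<in> I c" "x = T z" unfolding J_def by blast
  then show ?thesis using T'_T[OF I_sub[OF z(1)]] T_tr by simp
qed

lemma piecewise_T': "piecewise T' (range glo)"
proof
  fix x y :: real assume h: "0 \<le> x" "x < y" "y \<le> 1" "\<forall>d\<in>range glo. \<not> (x < d \<and> d < y)"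
  obtain c where c: "x \<in> J c" using ex_jletter[of x] h by auto
  have "z \<in> J c" if z: "z \<in> {x..<y}" for z
  proof -
    obtain d where d: "z \<in> J d" using ex_jletter[of z] z h by auto
    have "\<not> (x < glo d \<and> glo d \<le> z)" using h(4)[rule_format, of "glo d"] z by auto
    then have "x \<in> J d" using same_J[OF _ _ d] z by simp
    then show ?thesis using c d J_unique by blast
  qed
  then have "\<forall>z\<in>{x..<y}. T' z = z + - tr c" using T'_I by simp
  then show "\<exists>t. \<forall>z\<in>{x..<y}. T' z = z + t" by blast
qed (use T'_bij in auto)

lemma T'n_in: "x \<in> {0..<1} \<Longrightarrow> (T' ^^ n) x \<in> {0..<1}"
  using funpow_in[OF T'_bij] .

lemma Tn_T'n: "x \<in> {0..<1} \<Longrightarrow> (T ^^ n) ((T' ^^ n) x) = x"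
proof (induction n)
  case (Suc n)
  have "(T ^^ Suc n) ((T' ^^ Suc n) x) = (T ^^ n) (T ((T' ^^ Suc n) x))" by (rule Tn_Suc)
  also have "T ((T' ^^ Suc n) x) = (T' ^^ n) x" using T_T'[OF T'n_in[OF Suc.prems]] by simp
  finally show ?case using Suc by simp
qed simp

text \<open>New breaks can arise only at images of old breaks and at left ends of the
  \<open>J c\<close>.\<close>

lemma piecewise_const_image:
  assumes A: "A \<subseteq> {0..<1}" "piecewise_const A" shows "piecewise_const (T ` A)"
proof -
  obtain D where D: "finite D" "\<forall>x y. 0 \<le> x \<and> x < y \<and> y < 1 \<and> D \<inter> {x<..y} = {} \<longrightarrow> (x \<in> A \<longleftrightarrow> y \<in> A)"
    using A unfolding piecewise_const_def by blast
  have mem: "x \<in> T ` A \<longleftrightarrow> T' x \<in> A" if "x \<in> {0..<1}" for x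
  proof
    assume "x \<in> T ` A"
    then show "T' x \<in> A" using T'_T A(1) by auto
  next
    assume "T' x \<in> A"
    then show "x \<in> T ` A" using T_T'[OF that] by (metis imageI)
  qed
  have "x \<in> T ` A \<longleftrightarrow> y \<in> T ` A" if h: "0 \<le> x \<and> x < y \<and> y < 1 \<and> (T ` D \<union> range glo) \<inter> {x<..y} = {}" for x y
  proof -
    obtain c where c: "y \<in> J c" using ex_jletter[of y] h by auto
    have "\<not> (x < glo c \<and> glo c \<le> y)"
    proof
      assume "x < glo c \<and> glo c \<le> y"
      then have "glo c \<in> (T ` D \<union> range glo) \<inter> {x<..y}" by auto
      then show False using h by blast
    qed
    then have "x \<in> J c" using same_J[OF _ _ c, of x] h by simp
    then have x: "T' x \<in> I c" "T' x = x - tr c" and y: "T' y \<in> I c" "T' y = y - tr c"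
      using T'_I[of x c] T'_I[OF c] by blast+
    have "D \<inter> {T' x<..T' y} = {}"
    proof (rule ccontr)
      assume "D \<inter> {T' x<..T' y} \<noteq> {}"
      then obtain d where d: "d \<in> D" "T' x < d" "d \<le> T' y" by auto
      then have "d \<in> I c" using x(1) y(1) by (auto simp: I_eq)
      then have "T d = d + tr c" using T_tr by blast
      then have "T d \<in> {x<..y}" using d x y by auto
      then show False using h d(1) by blast
    qed
    then have "T' x \<in> A \<longleftrightarrow> T' y \<in> A" using D(2) I_sub[OF x(1)] I_sub[OF y(1)] x y h by auto
    then show ?thesis using mem h by auto
  qed
  then show ?thesis unfolding piecewise_const_def using D(1) by (intro exI[of _ "T ` D \<union> range glo"]) auto
qed

lemma piecewise_const_interval: "piecewise_const {a..<b}"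
  unfolding piecewise_const_def
proof (intro exI[of _ "{a, b}"] conjI allI impI)
  fix x y assume h: "0 \<le> x \<and> x < y \<and> y < 1 \<and> {a, b} \<inter> {x<..y} = {}"
  then have "\<not> (x < a \<and> a \<le> y)" "\<not> (x < b \<and> b \<le> y)" by auto
  then show "x \<in> {a..<b} \<longleftrightarrow> y \<in> {a..<b}" using h by auto
qed simp

text \<open>Slide the periodic orbit to the left by its least distance \<open>\<epsilon>\<close> to
  a left end. Every point stays in its interval, so the slid orbit is again periodic and now
  contains a left end; if that end is not 0, this is a connection.\<close>

lemma no_periodic:
  assumes nc: no_connection and two: "(c0::'a) \<noteq> c1" and p: "p \<in> {0..<1}" "1 \<le> m" "(T ^^ m) p = p"
    and av: "\<forall>k c. (T ^^ k) p \<noteq> lo c"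
  shows False
proof -
  define l where "l k = (SOME c. (T ^^ k) p \<in> I c)" for k
  have l: "(T ^^ k) p \<in> I (l k)" for k
    unfolding l_def using someI_ex[OF ex_letter[OF Tn_in[OF p(1)]]] .
  define g where "g k = (T ^^ k) p - lo (l k)" for k
  have gpos: "0 < g k" for k
  proof -
    have "lo (l k) \<le> (T ^^ k) p" using l[of k] I_eq[of "l k"] by simp
    moreover have "(T ^^ k) p \<noteq> lo (l k)" using av by blast
    ultimately show ?thesis unfolding g_def by simp
  qed
  have per: "(T ^^ (k mod m)) p = (T ^^ k) p" for k using p(3) by (rule funpow_mod_eq)
  have gper: "g (k mod m) = g k" for k unfolding g_def l_def per ..
  define \<epsilon> where "\<epsilon> = Min (g ` {..<m})"
  have "0 \<in> {..<m}" using p(2) by simp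
  then have fin: "finite (g ` {..<m})" "g ` {..<m} \<noteq> {}" by blast+
  obtain k0 where k0: "g k0 = \<epsilon>" using Min_in[OF fin] unfolding \<epsilon>_def by auto
  have \<epsilon>le: "\<epsilon> \<le> g k" for k
  proof -
    have "g (k mod m) \<in> g ` {..<m}" using p(2) by auto
    then show ?thesis using Min_le[OF fin(1)] gper unfolding \<epsilon>_def by metis
  qed
  have \<epsilon>pos: "0 < \<epsilon>" using gpos k0 by metis
  have shift: "(T ^^ k) p - \<epsilon> \<in> I (l k)" for k
    using l[of k] \<epsilon>le[of k] \<epsilon>pos unfolding g_def by (auto simp: I_eq)
  have T_shift: "T ((T ^^ k) p - \<epsilon>) = (T ^^ Suc k) p - \<epsilon>" for k
    using T_tr[OF shift[of k]] T_tr[OF l[of k]] by simp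
  let ?q = "(T ^^ k0) p"
  have it: "(T ^^ j) (?q - \<epsilon>) = (T ^^ (j + k0)) p - \<epsilon>" for j
  proof (induction j)
    case (Suc j)
    then show ?case using T_shift[of "j + k0"] by simp
  qed simp
  have "(T ^^ (m + k0)) p = ?q" using p(3) by (simp add: funpow_add add.commute[of m])
  then have per': "(T ^^ m) (?q - \<epsilon>) = ?q - \<epsilon>" using it by simp
  have q: "?q - \<epsilon> = lo (l k0)" using k0 unfolding g_def by simp
  let ?d = "l k0"
  show False
  proof (cases "lo ?d = 0")
    case False
    then show ?thesis using nc per' p(2) unfolding no_connection_def q by blast
  next
    case True
    \<comment> \<open>The slid orbit passes through \<open>lo e\<close>, the point sent to 0. If
      \<open>lo e\<close> is not 0, it is connected to the left end 0.\<close>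
    then have per0: "(T ^^ m) 0 = 0" using per' q by simp
    obtain e where e: "glo e = 0" using ex_glo_0 by blast
    obtain m' where m': "m = Suc m'" using p(2) by (cases m) auto
    have "T ((T ^^ m') 0) = T (lo e)" using per0 e unfolding m' by simp
    then have zero_back: "(T ^^ m') 0 = lo e" using T_inj Tn_in[of 0 m'] lo01 by auto
    show ?thesis
    proof (cases "lo e = 0")
      case False
      then have "1 \<le> m'" using zero_back by (cases m') auto
      then show ?thesis using nc zero_back False True unfolding no_connection_def by metis
    next
      case e0: True
      \<comment> \<open>Now \<open>T\<close> fixes the first interval pointwise. With two letters
        this is not the whole unit interval, and both the next interval and the next image begin at
        its right end, which connects \<open>lo f'\<close> to \<open>lo f\<close>.\<close>
      then have "e = ?d" using True I_unique[of 0 e ?d] I_eq lo_hi by (metis lo_in)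
      then have tr0: "tr ?d = 0" using e e0 glo_tr[of ?d] True by simp
      have hi1: "hi ?d < 1"
      proof (rule ccontr)
        assume "\<not> ?thesis"
        then have "x \<in> I ?d" if "x \<in> {0..<1}" for x using that True by (auto simp: I_eq)
        then have "c = ?d" for c using lo01 lo_in I_unique by blast
        then show False using two by metis
      qed
      have h0: "0 < hi ?d" using lo_hi[of ?d] True by simp
      obtain f where f: "hi ?d \<in> I f" using ex_letter[of "hi ?d"] hi1 h0 by auto
      have lof: "lo f = hi ?d"
      proof (rule ccontr)
        assume "lo f \<noteq> hi ?d"
        then have "lo f \<in> I ?d" using f lo_ge[of f] True by (auto simp: I_eq)
        then have "f = ?d" using lo_in I_unique by blast
        then show False using f by (simp add: I_eq)
      qed
      obtain f' where f': "hi ?d \<in> J f'" using ex_jletter[of "hi ?d"] hi1 h0 by auto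
      have Jd: "J ?d = {0..<hi ?d}" using J_eq[of ?d] glo_tr[of ?d] tr0 True by simp
      have "glo f' = hi ?d"
      proof (rule ccontr)
        assume "glo f' \<noteq> hi ?d"
        then have "glo f' \<in> J ?d" using f' glo_ge[of f'] unfolding Jd by (auto simp: J_eq)
        then have "f' = ?d" using glo_in J_unique by blast
        then show False using f' unfolding Jd using Jd by auto
      qed
      then have "(T ^^ 1) (lo f') = lo f" using lof by simp
      then show ?thesis using nc lof h0 unfolding no_connection_def by (metis le_refl less_irrefl)
    qed
  qed
qed

text \<open>Keane's argument. The union \<open>U\<close> of the forward iterates of the interval is
  invariant and, by bounded return, a finite union, hence piecewise constant. A jump of
  \<open>U\<close> travels forward to a left end and backward to an image of a left end, and
  together these form a connection. So there is no jump and \<open>U\<close> is everything.\<close>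

lemma saturation_all:
  assumes nc: no_connection and two: "(c0::'a) \<noteq> c1" and K: "0 \<le> a" "a < b" "b \<le> 1" and y: "y \<in> {0..<1}"
  shows "\<exists>k. \<exists>z\<in>{a..<b}. (T ^^ k) z = y"
proof -
  let ?K = "{a..<b}"
  interpret P: piecewise T "range lo" by (rule piecewise_T)
  interpret P': piecewise T' "range glo" by (rule piecewise_T')
  have K01: "z \<in> {0..<1}" if "z \<in> ?K" for z using that K by auto
  obtain R where R: "\<forall>z\<in>?K. \<exists>m. 1 \<le> m \<and> m \<le> R \<and> (T ^^ m) z \<in> ?K" using P.bounded_return K by blast
  obtain R' where R': "\<forall>z\<in>?K. \<exists>m. 1 \<le> m \<and> m \<le> R' \<and> (T' ^^ m) z \<in> ?K" using P'.bounded_return K by blast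
  define U where "U = {y. \<exists>k. \<exists>z\<in>?K. (T ^^ k) z = y}"
  have U_T: "T x \<in> U" if xU: "x \<in> U" for x
  proof -
    obtain k z where "z \<in> ?K" "(T ^^ k) z = x" using xU unfolding U_def by blast
    then have "(T ^^ Suc k) z = T x" by simp
    then show ?thesis unfolding U_def using \<open>z \<in> ?K\<close> by blast
  qed
  have U_back: "x \<in> U" if x: "x \<in> {0..<1}" "T x \<in> U" for x
  proof -
    obtain k z where kz: "z \<in> ?K" "(T ^^ k) z = T x" using x(2) unfolding U_def by blast
    obtain k' z' where kz': "z' \<in> ?K" "(T ^^ Suc k') z' = T x"
    proof (cases k)
      case (Suc k')
      then show thesis using that kz by blast
    next
      case 0
      obtain m where m: "1 \<le> m" "(T' ^^ m) z \<in> ?K" using R' kz(1) by blast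
      then obtain m' where m': "m = Suc m'" by (cases m) auto
      have "(T ^^ Suc m') ((T' ^^ m) z) = z" unfolding m' by (rule Tn_T'n[OF K01[OF kz(1)]])
      then show thesis using that[of "(T' ^^ m) z" m'] m(2) kz(2) 0 by simp
    qed
    then have "T ((T ^^ k') z') = T x" by simp
    then have "(T ^^ k') z' = x" using T_inj Tn_in[OF K01[OF kz'(1)]] x(1) by blast
    then show ?thesis unfolding U_def using kz'(1) by blast
  qed
  have U_iff: "T x \<in> U \<longleftrightarrow> x \<in> U" if "x \<in> {0..<1}" for x using U_T U_back that by blast
  \<comment> \<open>A long orbit segment is shortened by starting it at a later return to the
    interval.\<close>
  have UR: "U = (\<Union>k<Suc R. (T ^^ k) ` ?K)"
  proof (intro set_eqI iffI)
    fix x assume "x \<in> U"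
    then obtain k z where "z \<in> ?K" "(T ^^ k) z = x" unfolding U_def by blast
    then show "x \<in> (\<Union>k<Suc R. (T ^^ k) ` ?K)"
    proof (induction k arbitrary: z rule: less_induct)
      case (less k)
      show ?case
      proof (cases "k < Suc R")
        case True
        then show ?thesis using less.prems by blast
      next
        case False
        obtain m where m: "1 \<le> m" "m \<le> R" "(T ^^ m) z \<in> ?K" using R less.prems(1) by blast
        have "k = (k - m) + m" using m False by simp
        then have "(T ^^ (k - m)) ((T ^^ m) z) = x" using less.prems(2) by (metis funpow_add comp_apply)
        then show ?thesis using less.IH[of "k - m"] m False by simp
      qed
    qed
  next
    fix x assume "x \<in> (\<Union>k<Suc R. (T ^^ k) ` ?K)"
    then show "x \<in> U" unfolding U_def by blast
  qed
  have constK: "piecewise_const ((T ^^ k) ` ?K) \<and> (T ^^ k) ` ?K \<subseteq> {0..<1}" for k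
  proof (induction k)
    case 0
    have "?K \<subseteq> {0..<1}" using K01 by blast
    moreover have "(T ^^ 0) ` ?K = ?K" by simp
    ultimately show ?case using piecewise_const_interval by metis
  next
    case (Suc k)
    have "(T ^^ Suc k) ` ?K = T ` ((T ^^ k) ` ?K)" by (simp only: funpow.simps image_comp)
    then show ?case using Suc piecewise_const_image T_in by auto
  qed
  have "piecewise_const (\<Union>k<n. (T ^^ k) ` ?K)" for n
  proof (induction n)
    case 0
    then show ?case unfolding piecewise_const_def by (intro exI[of _ "{}"]) simp
  next
    case (Suc n)
    have "(\<Union>k<Suc n. (T ^^ k) ` ?K) = (T ^^ n) ` ?K \<union> (\<Union>k<n. (T ^^ k) ` ?K)" by (simp only: lessThan_Suc UN_insert)
    then show ?case using piecewise_const_Un constK Suc by metis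
  qed
  then have constU: "piecewise_const U" using UR by metis
  have aU: "a \<in> U" unfolding U_def using K by (intro CollectI exI[of _ 0] bexI[of _ a]) auto
  have fwd: "jump U (T p)" if p: "jump U p" "\<forall>c. p \<noteq> lo c" for p
  proof -
    have p01: "p \<in> {0..<1}" using p(1) unfolding jump_def by auto
    obtain c where c: "p \<in> I c" using ex_letter[OF p01] by blast
    then have "lo c \<le> p" by (simp add: I_eq)
    then have lp: "lo c < p" using p(2)[rule_format, of c] by simp
    have tp: "T p = p + tr c" using T_tr[OF c] .
    have "0 < T p" using glo_ge[of c] glo_tr[of c] lp tp by simp
    moreover have "\<exists>x. q < x \<and> x < T p \<and> 0 \<le> x \<and> (x \<in> U \<longleftrightarrow> T p \<notin> U)" if "q < T p" for q
    proof -
      have "max (q - tr c) (lo c) < p" using that tp lp by simp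
      then obtain x where x: "max (q - tr c) (lo c) < x" "x < p" "0 \<le> x" "x \<in> U \<longleftrightarrow> p \<notin> U"
        using p(1) unfolding jump_def by blast
      have xc: "x \<in> I c" using x c by (auto simp: I_eq)
      then have "T x = x + tr c" using T_tr by blast
      moreover have "T x \<in> {0..<1}" using T_in I_sub[OF xc] by blast
      moreover have "T x \<in> U \<longleftrightarrow> T p \<notin> U" using U_iff[OF I_sub[OF xc]] U_iff[OF p01] x(4) by blast
      ultimately show ?thesis using x tp by (intro exI[of _ "T x"]) auto
    qed
    ultimately show ?thesis using T_in[OF p01] unfolding jump_def by auto
  qed
  have bwd: "jump U (T' p)" if p: "jump U p" "\<forall>c. p \<noteq> glo c" for p
  proof -
    have p01: "p \<in> {0..<1}" using p(1) unfolding jump_def by auto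
    obtain c where c: "p \<in> J c" using ex_jletter[OF p01] by blast
    then have "glo c \<le> p" unfolding J_eq by simp
    then have lp: "glo c < p" using p(2)[rule_format, of c] by simp
    have tp: "T' p \<in> I c" "T' p = p - tr c" using T'_I[OF c] by auto
    have U'_iff: "T' x \<in> U \<longleftrightarrow> x \<in> U" if "x \<in> {0..<1}" for x using U_iff[OF T'_in[OF that]] T_T'[OF that] by simp
    have "0 < T' p" using lp tp glo_tr[of c] lo_ge[of c] by simp
    moreover have "\<exists>x. q < x \<and> x < T' p \<and> 0 \<le> x \<and> (x \<in> U \<longleftrightarrow> T' p \<notin> U)" if "q < T' p" for q
    proof -
      have "max (q + tr c) (glo c) < p" using that tp lp by simp
      then obtain x where x: "max (q + tr c) (glo c) < x" "x < p" "0 \<le> x" "x \<in> U \<longleftrightarrow> p \<notin> U"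
        using p(1) unfolding jump_def by blast
      have xc: "x \<in> J c" using x c unfolding J_eq by auto
      then have "T' x = x - tr c" "T' x \<in> I c" using T'_I[OF xc] by auto
      moreover have "T' x \<in> U \<longleftrightarrow> T' p \<notin> U" using U'_iff[OF J_sub[OF xc]] U'_iff[OF p01] x(4) by blast
      ultimately show ?thesis using x tp I_sub[of "T' x" c] by (intro exI[of _ "T' x"]) auto
    qed
    ultimately show ?thesis using T'_in[OF p01] unfolding jump_def by auto
  qed
  have nojump: "\<not> jump U p" for p
  proof
    assume jp: "jump U p"
    then have p01: "p \<in> {0..<1}" unfolding jump_def by auto
    have finJ: "finite {p. jump U p}" using piecewise_const_jumps(1)[OF constU] .
    \<comment> \<open>A forward orbit avoiding the left ends would consist of jumps. There are
      finitely many, so it would be periodic, against \<open>no_periodic\<close>.\<close>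
    have "\<exists>k c. (T ^^ k) p = lo c"
    proof (rule ccontr)
      assume "\<not> ?thesis"
      then have av: "\<forall>k c. (T ^^ k) p \<noteq> lo c" by blast
      have all: "jump U ((T ^^ k) p)" for k
      proof (induction k)
        case (Suc k)
        then show ?case using fwd av by simp
      qed (simp add: jp)
      then have "finite (range (\<lambda>k. (T ^^ k) p))" using finJ by (meson finite_subset image_subsetI mem_Collect_eq)
      then have "\<not> inj (\<lambda>k. (T ^^ k) p)" using finite_imageD infinite_UNIV_nat by blast
      then obtain i j where ij: "i < j" "(T ^^ i) p = (T ^^ j) p" unfolding inj_def by (metis linorder_neqE_nat)
      then have "(T ^^ (j - i)) p = p" using funpow_cancel[OF T_bij p01 p01 ij(2)] by simp
      moreover have "1 \<le> j - i" using ij(1) by linarith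
      ultimately show False using no_periodic[OF nc two p01] av by blast
    qed
    then obtain k where k: "\<exists>c. (T ^^ k) p = lo c" "\<forall>j<k. \<not> (\<exists>c. (T ^^ j) p = lo c)"
      using exists_least_iff[of "\<lambda>k. \<exists>c. (T ^^ k) p = lo c"] by blast
    have "jump U ((T ^^ j) p)" if "j \<le> k" for j
      using that
    proof (induction j)
      case (Suc j)
      then show ?case using fwd k(2) by simp
    qed (simp add: jp)
    then have jk: "jump U ((T ^^ k) p)" by simp
    obtain d where d: "(T ^^ k) p = lo d" using k(1) by blast
    have d0: "lo d \<noteq> 0" using jk unfolding d jump_def by simp
    \<comment> \<open>By the same count an orbit that never stops backwards is periodic; it contains
      \<open>lo d\<close>, which would then be connected to itself.\<close>
    have "\<exists>k c. (T' ^^ k) p = glo c"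
    proof (rule ccontr)
      assume "\<not> ?thesis"
      then have av: "\<forall>k c. (T' ^^ k) p \<noteq> glo c" by blast
      have all: "jump U ((T' ^^ k) p)" for k
      proof (induction k)
        case (Suc k)
        then show ?case using bwd av by simp
      qed (simp add: jp)
      then have "finite (range (\<lambda>k. (T' ^^ k) p))" using finJ by (meson finite_subset image_subsetI mem_Collect_eq)
      then have "\<not> inj (\<lambda>k. (T' ^^ k) p)" using finite_imageD infinite_UNIV_nat by blast
      then obtain i j where ij: "i < j" "(T' ^^ i) p = (T' ^^ j) p" unfolding inj_def by (metis linorder_neqE_nat)
      then have "(T' ^^ (j - i)) p = p" using funpow_cancel[OF T'_bij p01 p01 ij(2)] by simp
      then have "(T ^^ (j - i)) p = p" using Tn_T'n[OF p01, of "j - i"] by simp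
      then have "(T ^^ k) ((T ^^ (j - i)) p) = lo d" using d by simp
      then have "(T ^^ (k + (j - i))) p = lo d" by (simp only: funpow_add comp_apply)
      then have "(T ^^ (j - i)) ((T ^^ k) p) = lo d" by (simp only: add.commute[of k] funpow_add comp_apply)
      moreover have "1 \<le> j - i" using ij(1) by linarith
      ultimately show False using nc d d0 unfolding no_connection_def by metis
    qed
    then obtain k' c where c: "(T' ^^ k') p = glo c" by blast
    then have "(T ^^ k') (T (lo c)) = p" using Tn_T'n[OF p01, of k'] by simp
    then have "(T ^^ (k + Suc k')) (lo c) = lo d" using d by (simp only: funpow_add comp_apply Tn_Suc)
    then show False using nc d0 unfolding no_connection_def by (metis le_add2 le_trans One_nat_def Suc_le_mono zero_le)
  qed
  have a01: "a \<in> {0..<1}" using K by auto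
  have "y \<in> U"
  proof (cases a y rule: linorder_cases)
    case less
    then show ?thesis using piecewise_const_jumps(2)[OF constU, of a y] nojump aU a01 y by auto
  next
    case greater
    then show ?thesis using piecewise_const_jumps(2)[OF constU, of y a] nojump aU a01 y by auto
  qed (use aU in simp)
  then show ?thesis unfolding U_def by blast
qed

text \<open>Every point lies on the forward orbit of a point of the interval by
  \<open>saturation_all\<close>, and along such an orbit the next visit comes within
  \<open>R\<close> steps.\<close>

lemma uniform_hit:
  assumes nc: no_connection and two: "(c0::'a) \<noteq> c1" and K: "0 \<le> a" "a < b" "b \<le> 1"
  shows "\<exists>R. \<forall>y\<in>{0..<1}. \<exists>m\<le>R. (T ^^ m) y \<in> {a..<b}"
proof -
  let ?K = "{a..<b}"
  interpret P: piecewise T "range lo" by (rule piecewise_T)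
  obtain R where R: "\<forall>z\<in>?K. \<exists>m. 1 \<le> m \<and> m \<le> R \<and> (T ^^ m) z \<in> ?K" using P.bounded_return K by blast
  have "\<exists>m\<le>R. (T ^^ m) ((T ^^ k) z) \<in> ?K" if "z \<in> ?K" for k z
    using that
  proof (induction k arbitrary: z rule: less_induct)
    case (less k)
    obtain m where m: "1 \<le> m" "m \<le> R" "(T ^^ m) z \<in> ?K" using R less.prems by blast
    show ?case
    proof (cases "k \<le> m")
      case True
      have "(T ^^ (m - k)) ((T ^^ k) z) = (T ^^ m) z" using True by (metis funpow_add comp_apply le_add_diff_inverse2)
      then show ?thesis using m by (intro exI[of _ "m - k"]) auto
    next
      case False
      have "(T ^^ (k - m)) ((T ^^ m) z) = (T ^^ k) z" using False by (metis funpow_add comp_apply le_add_diff_inverse2 nat_le_linear)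
      then show ?thesis using less.IH[of "k - m" "(T ^^ m) z"] m False by simp
    qed
  qed
  then have "\<forall>y\<in>{0..<1}. \<exists>m\<le>R. (T ^^ m) y \<in> ?K" using saturation_all[OF nc two K] by metis
  then show ?thesis by blast
qed

lemma code_uniformly_recurrent:
  assumes nc: no_connection and two: "(c0::'a) \<noteq> c1"
  shows "uniformly_recurrent code_lang"
  unfolding uniformly_recurrent_def
proof
  fix u assume "u \<in> code_lang"
  then have ne: "cyl u \<noteq> {}" unfolding code_lang_def by simp
  obtain a b where ab: "0 \<le> a" "b \<le> 1" "cyl u = {a..<b}" using cyl_interval by blast
  have "a < b" using ne unfolding ab(3) by simp
  then obtain R where R: "\<forall>y\<in>{0..<1}. \<exists>m\<le>R. (T ^^ m) y \<in> cyl u" using uniform_hit[OF nc two ab(1) \<open>a < b\<close> ab(2)] unfolding ab(3) by blast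
  have "sublist u v" if v: "v \<in> code_lang" "R + length u \<le> length v" for v
  proof -
    obtain z where z: "z \<in> cyl v" using v(1) unfolding code_lang_def by blast
    obtain m where m: "m \<le> R" "(T ^^ m) z \<in> cyl u" using R cyl_sub[OF z] by blast
    have "take (length u) (drop m v) = u"
    proof (rule nth_equalityI)
      fix i assume "i < length (take (length u) (drop m v))"
      then have i: "i < length u" by simp
      have "(T ^^ i) ((T ^^ m) z) \<in> I (u ! i)" using m(2) i unfolding cyl_def by blast
      then have "(T ^^ (m + i)) z \<in> I (u ! i)" by (metis funpow_add comp_apply add.commute)
      moreover have "(T ^^ (m + i)) z \<in> I (v ! (m + i))" using z i m(1) v(2) unfolding cyl_def by simp
      ultimately show "take (length u) (drop m v) ! i = u ! i" using I_unique i v(2) m(1) by auto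
    qed (use v(2) m(1) in simp)
    then show ?thesis by (metis sublist_order.order.trans sublist_take sublist_drop)
  qed
  then show "\<exists>R. \<forall>v\<in>code_lang. R \<le> length v \<longrightarrow> sublist u v" by blast
qed

end

section \<open>Letter frequencies\<close>

lemma diagonal_limit:
  fixes f :: "'b::countable \<Rightarrow> nat \<Rightarrow> real"
  assumes bd: "\<And>u n. \<bar>f u n\<bar> \<le> 1"
  shows "\<exists>r. strict_mono (r :: nat \<Rightarrow> nat) \<and> (\<forall>u. convergent (\<lambda>n. f u (r n)))"
proof -
  interpret subseqs "\<lambda>k s. convergent (\<lambda>n. f (from_nat k) (s n))"
  proof
    fix k and s :: "nat \<Rightarrow> nat" assume "strict_mono s"
    obtain r where r: "strict_mono r" "monoseq (\<lambda>n. f (from_nat k) (s (r n)))"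
      using seq_monosub[of "\<lambda>n. f (from_nat k) (s n)"] by auto
    have "Bseq (\<lambda>n. f (from_nat k) (s (r n)))" using bd by (intro BseqI'[of _ 1]) auto
    then show "\<exists>r'. strict_mono r' \<and> convergent (\<lambda>n. f (from_nat k) ((s \<circ> r') n))"
      using r Bseq_monoseq_convergent by (intro exI[of _ r]) auto
  qed
  have "convergent (\<lambda>n. f u (diagseq n))" for u
  proof -
    have "convergent (\<lambda>n. f (from_nat (to_nat u)) ((diagseq \<circ> (+) (Suc (to_nat u))) n))"
    proof (rule diagseq_holds)
      fix r s :: "nat \<Rightarrow> nat" and n assume h: "strict_mono r" "convergent (\<lambda>m. f (from_nat n) (s m))"
      then obtain l where "(\<lambda>m. f (from_nat n) (s m)) \<longlonglongrightarrow> l" unfolding convergent_def by blast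
      from LIMSEQ_subseq_LIMSEQ[OF this h(1)]
      show "convergent (\<lambda>m. f (from_nat n) ((s \<circ> r) m))" unfolding convergent_def by (auto simp: o_def)
    qed
    then have "convergent (\<lambda>n. f u (diagseq (n + Suc (to_nat u))))" by (simp add: add.commute)
    then show ?thesis using convergent_ignore_initial_segment[of "\<lambda>n. f u (diagseq n)" "Suc (to_nat u)"] by simp
  qed
  then show ?thesis using subseq_diagseq by blast
qed

lemma word_at_Suc: "word_at x i (Suc n) = word_at x i n @ [x (i + int n)]"
  unfolding word_at_def by simp

lemma word_at_Cons: "word_at x i (Suc n) = x i # word_at x (i + 1) n"
  unfolding word_at_def by (simp add: upt_conv_Cons map_Suc_upt[symmetric] del: upt_Suc)
    (auto simp: o_def algebra_simps)

lemma length_word_at [simp]: "length (word_at x i n) = n"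
  unfolding word_at_def by simp

lemma word_at_add: "word_at x i (m + n) = word_at x i m @ word_at x (i + int m) n"
  by (induction n) (simp_all add: word_at_Suc algebra_simps, simp add: word_at_def)

text \<open>The weights are limits of proportions of occurrences among the first n positions of
  \<open>x\<close>, along one subsequence for all words. Positivity on \<open>F\<close> comes from
  bounded gaps between occurrences, vanishing outside \<open>F\<close> from the inclusion of
  \<open>lang x\<close>.\<close>

lemma frequencies:
  fixes x :: "int \<Rightarrow> 'a::finite"
  assumes sub: "lang x \<subseteq> F" and rec: "uniformly_recurrent F"
  shows "\<exists>\<mu> :: 'a list \<Rightarrow> real. \<mu> [] = 1 \<and> (\<forall>u. 0 \<le> \<mu> u) \<and> (\<forall>u. 0 < \<mu> u \<longleftrightarrow> u \<in> F) \<and>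
    (\<forall>u. (\<Sum>d\<in>UNIV. \<mu> (u @ [d])) = \<mu> u) \<and> (\<forall>u. (\<Sum>c\<in>UNIV. \<mu> (c # u)) = \<mu> u)"
proof -
  \<comment> \<open>Only the start of an occurrence has to lie below \<open>n\<close>. Summing over
    right extensions is then exact, while summing over left extensions shifts positions by one and
    errs by at most one.\<close>
  define M where "M u n = {i. i < n \<and> word_at x (int i) (length u) = u}" for u :: "'a list" and n :: nat
  define f where "f u n = real (card (M u n)) / real n" for u n
  have finM: "finite (M u n)" for u n unfolding M_def by simp
  have cM: "card (M u n) \<le> n" for u n
  proof -
    have "card (M u n) \<le> card {..<n}" unfolding M_def by (intro card_mono) auto
    then show ?thesis by simp
  qed
  have f01: "0 \<le> f u n" "f u n \<le> 1" for u n
    unfolding f_def using cM[of u n] by (auto simp: divide_le_eq_1)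
  obtain r where r: "strict_mono (r :: nat \<Rightarrow> nat)" "\<And>u. convergent (\<lambda>n. f u (r n))"
    using diagonal_limit[of f] f01 by auto
  define \<mu> where "\<mu> u = lim (\<lambda>n. f u (r n))" for u
  have lim: "(\<lambda>n. f u (r n)) \<longlonglongrightarrow> \<mu> u" for u using r(2)[of u] unfolding \<mu>_def convergent_LIMSEQ_iff .
  have rn: "n \<le> r n" for n using r(1) seq_suble by blast
  have r0: "(\<lambda>n. 1 / real (r n)) \<longlonglongrightarrow> 0"
    using LIMSEQ_subseq_LIMSEQ[OF lim_1_over_n r(1)] by (simp add: o_def)
  have nonneg: "0 \<le> \<mu> u" for u using LIMSEQ_le_const[OF lim] f01 by blast
  have Nil: "\<mu> [] = 1"
  proof -
    have "f [] (r n) = 1" if "n \<ge> 1" for n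
      using rn[of n] that unfolding f_def M_def by (simp add: word_at_def)
    then have "(\<lambda>n. f [] (r n)) \<longlonglongrightarrow> 1" by (intro tendsto_eventually) (auto simp: eventually_sequentially)
    then show ?thesis using lim LIMSEQ_unique by blast
  qed
  have right: "(\<Sum>d\<in>UNIV. \<mu> (u @ [d])) = \<mu> u" for u
  proof -
    have "(\<Sum>d\<in>UNIV. card (M (u @ [d]) n)) = card (M u n)" for n
    proof -
      have "M u n = (\<Union>d\<in>UNIV. M (u @ [d]) n)" unfolding M_def by (auto simp: word_at_Suc)
      moreover have "card (\<Union>d\<in>UNIV. M (u @ [d]) n) = (\<Sum>d\<in>UNIV. card (M (u @ [d]) n))"
        by (rule card_UN_disjoint) (auto simp: M_def word_at_Suc)
      ultimately show ?thesis by simp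
    qed
    then have "(\<Sum>d\<in>UNIV. f (u @ [d]) n) = f u n" for n
      unfolding f_def by (simp add: sum_divide_distrib[symmetric] of_nat_sum[symmetric] del: of_nat_sum)
    moreover have "(\<lambda>n. \<Sum>d\<in>UNIV. f (u @ [d]) (r n)) \<longlonglongrightarrow> (\<Sum>d\<in>UNIV. \<mu> (u @ [d]))"
      by (intro tendsto_sum lim)
    ultimately show ?thesis using lim[of u] LIMSEQ_unique by simp
  qed
  have left: "(\<Sum>c\<in>UNIV. \<mu> (c # u)) = \<mu> u" for u
  proof -
    have close: "\<bar>(\<Sum>c\<in>UNIV. f (c # u) n) - f u n\<bar> \<le> 1 / real n" for n
    proof -
      let ?N = "{i. i < n \<and> word_at x (int i + 1) (length u) = u}"
      have "?N = (\<Union>c\<in>UNIV. M (c # u) n)" unfolding M_def by (auto simp: word_at_Cons)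
      moreover have "card (\<Union>c\<in>UNIV. M (c # u) n) = (\<Sum>c\<in>UNIV. card (M (c # u) n))"
        by (rule card_UN_disjoint) (auto simp: M_def word_at_Cons)
      ultimately have N: "(\<Sum>c\<in>UNIV. card (M (c # u) n)) = card ?N" by simp
      have im: "Suc ` ?N \<subseteq> insert n (M u n)" "M u n \<subseteq> insert 0 (Suc ` ?N)"
      proof -
        show "Suc ` ?N \<subseteq> insert n (M u n)" unfolding M_def by (auto simp: algebra_simps)
        show "M u n \<subseteq> insert 0 (Suc ` ?N)"
        proof
          fix i assume i: "i \<in> M u n"
          show "i \<in> insert 0 (Suc ` ?N)"
          proof (cases i)
            case (Suc k)
            then have "k \<in> ?N" using i unfolding M_def by (auto simp: algebra_simps)
            then show ?thesis using Suc by blast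
          qed simp
        qed
      qed
      have cI: "card (Suc ` ?N) = card ?N" by (intro card_image) auto
      have "card (Suc ` ?N) \<le> card (insert n (M u n))" by (intro card_mono im) (simp add: finM)
      then have 1: "card ?N \<le> card (M u n) + 1" using card_insert_le_m1[of 1] cI
        by (simp add: card_insert_if finM split: if_splits)
      have "card (M u n) \<le> card (insert 0 (Suc ` ?N))" by (intro card_mono im) simp
      then have 2: "card (M u n) \<le> card ?N + 1" using cI by (simp add: card_insert_if split: if_splits)
      have "\<bar>real (card ?N) - real (card (M u n))\<bar> \<le> 1" using 1 2 by linarith
      moreover have "(\<Sum>c\<in>UNIV. f (c # u) n) - f u n = (real (card ?N) - real (card (M u n))) / real n"
        unfolding f_def N[symmetric] by (simp add: sum_divide_distrib[symmetric] diff_divide_distrib)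
      ultimately show ?thesis by (simp add: abs_divide divide_right_mono)
    qed
    have "(\<lambda>n. (\<Sum>c\<in>UNIV. f (c # u) (r n)) - f u (r n)) \<longlonglongrightarrow> (\<Sum>c\<in>UNIV. \<mu> (c # u)) - \<mu> u"
      by (intro tendsto_diff tendsto_sum lim)
    moreover have "(\<lambda>n. (\<Sum>c\<in>UNIV. f (c # u) (r n)) - f u (r n)) \<longlonglongrightarrow> 0"
      by (rule tendsto_0_le[OF r0, of _ 1]) (simp add: close)
    ultimately show ?thesis using LIMSEQ_unique by fastforce
  qed
  have pos: "0 < \<mu> u" if u: "u \<in> F" for u
  proof -
    obtain R0 where R0: "\<forall>v\<in>F. R0 \<le> length v \<longrightarrow> sublist u v" using rec u unfolding uniformly_recurrent_def by blast
    define R where "R = Suc R0"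
    have win: "\<exists>p\<ge>i. p < i + R + 1 \<and> word_at x (int p) (length u) = u" for i
    proof -
      have "word_at x (int i) R \<in> F" using sub unfolding lang_def by blast
      then have "sublist u (word_at x (int i) R)" using R0 unfolding R_def by simp
      then obtain a b where ab: "word_at x (int i) R = a @ u @ b" unfolding sublist_def by blast
      then have lR: "R = length a + (length u + length b)" by (metis length_append length_word_at)
      then have "word_at x (int i) R = word_at x (int i) (length a) @ word_at x (int i + int (length a)) (length u) @
          word_at x (int i + int (length a) + int (length u)) (length b)"
        by (simp only: word_at_add)
      then have "word_at x (int i + int (length a)) (length u) = u" using ab by simp
      then show ?thesis using lR by (intro exI[of _ "i + length a"]) auto
    qed
    \<comment> \<open>Among any \<open>?R\<close> consecutive positions an occurrence of
      \<open>u\<close> starts, so the first \<open>k * ?R\<close> positions carry at least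
      \<open>k\<close> of them.\<close>
    let ?R = "R + 1"
    have "k \<le> card (M u (k * ?R))" for k
    proof (induction k)
      case (Suc k)
      obtain p where p: "k * ?R \<le> p" "p < k * ?R + R + 1" "word_at x (int p) (length u) = u" using win by blast
      have "insert p (M u (k * ?R)) \<subseteq> M u (Suc k * ?R)" using p unfolding M_def by auto
      then have "card (insert p (M u (k * ?R))) \<le> card (M u (Suc k * ?R))" by (intro card_mono finM)
      moreover have "p \<notin> M u (k * ?R)" using p(1) unfolding M_def by auto
      ultimately show ?case using Suc finM by simp
    qed simp
    moreover have "M u m \<subseteq> M u n" if "m \<le> n" for m n using that unfolding M_def by auto
    ultimately have cnt: "n div ?R \<le> card (M u n)" for n
      by (meson card_mono finM le_trans div_times_less_eq_dividend)
    have "1 / real ?R - 1 / real n \<le> f u n" if "1 \<le> n" for n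
    proof -
      have "n < ?R * (n div ?R) + ?R"
        using mod_less_divisor[of ?R n] mult_div_mod_eq[of ?R n] by linarith
      then have "real n < real ?R * real (n div ?R) + real ?R" by (metis of_nat_add of_nat_less_iff of_nat_mult)
      also have "\<dots> \<le> real ?R * real (card (M u n)) + real ?R" using cnt[of n] by (intro add_right_mono mult_left_mono) auto
      finally have "real n / real ?R \<le> real (card (M u n)) + 1" by (simp add: field_simps)
      then have "(real n / real ?R - 1) / real n \<le> f u n" unfolding f_def by (intro divide_right_mono) auto
      moreover have "(real n / real ?R - 1) / real n = 1 / real ?R - 1 / real n" using that by (simp add: diff_divide_distrib)
      ultimately show ?thesis by simp
    qed
    then have "\<exists>N. \<forall>n\<ge>N. 1 / real ?R - 1 / real (r n) \<le> f u (r n)" using rn by (meson le_trans)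
    moreover have "(\<lambda>n. 1 / real ?R - 1 / real (r n)) \<longlonglongrightarrow> 1 / real ?R - 0" by (intro tendsto_diff tendsto_const r0)
    ultimately have "1 / real ?R - 0 \<le> \<mu> u" using LIMSEQ_le[OF _ lim] by blast
    moreover have "0 < 1 / real ?R" by simp
    ultimately show ?thesis by linarith
  qed
  have zero: "\<mu> u = 0" if u: "u \<notin> F" for u
  proof -
    have "M u n = {}" for n
    proof (rule ccontr)
      assume "M u n \<noteq> {}"
      then obtain i where "word_at x (int i) (length u) = u" unfolding M_def by blast
      then have "u \<in> lang x" unfolding lang_def by (metis (mono_tags, lifting) mem_Collect_eq)
      then show False using u sub by blast
    qed
    then have "(\<lambda>n. f u (r n)) \<longlonglongrightarrow> 0" unfolding f_def by simp
    then show ?thesis using lim LIMSEQ_unique by blast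
  qed
  have "0 < \<mu> u \<longleftrightarrow> u \<in> F" for u using pos[of u] zero[of u] by (cases "u \<in> F") simp_all
  then show ?thesis using Nil nonneg right left by blast
qed

section \<open>Cells of a weighted order\<close>

definition offset :: "('a \<times> 'a) set \<Rightarrow> ('a::finite \<Rightarrow> real) \<Rightarrow> 'a \<Rightarrow> real" where
  "offset r m c = (\<Sum>d\<in>UNIV. if lt r d c then m d else 0)"

definition cell :: "('a \<times> 'a) set \<Rightarrow> ('a::finite \<Rightarrow> real) \<Rightarrow> 'a \<Rightarrow> real set" where
  "cell r m c = {offset r m c..<offset r m c + m c}"

lemma offset_nonneg: "(\<And>d. 0 \<le> m d) \<Longrightarrow> 0 \<le> offset r m c"
  unfolding offset_def by (intro sum_nonneg) auto

lemma sum_nonzero: "(\<Sum>x\<in>UNIV. g x) \<noteq> (0::real) \<Longrightarrow> \<exists>x. g x \<noteq> 0"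
  by (meson sum.neutral)

lemma offset_total:
  assumes "linear_order r"
  shows "offset r m c + m c + (\<Sum>d\<in>UNIV. if lt r c d then m d else 0) = sum m UNIV"
proof -
  have "m c = (\<Sum>d\<in>UNIV. if d = c then m d else 0)" by simp
  then have "offset r m c + m c + (\<Sum>d\<in>UNIV. if lt r c d then m d else 0) =
    (\<Sum>d\<in>UNIV. (if lt r d c then m d else 0) + (if d = c then m d else 0) + (if lt r c d then m d else 0))"
    unfolding offset_def by (simp only: sum.distrib)
  also have "\<dots> = sum m UNIV"
  proof (rule sum.cong)
    fix d
    show "(if lt r d c then m d else 0) + (if d = c then m d else 0) + (if lt r c d then m d else 0) = m d"
      using lt_total[OF assms, of d c] lt_asym[OF assms, of d c] by auto
  qed simp
  finally show ?thesis .
qed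

lemma offset_le:
  assumes r: "linear_order r" and m: "\<And>d. 0 \<le> m d" and cd: "lt r c d"
  shows "offset r m c + m c \<le> offset r m d"
proof -
  have "m c = (\<Sum>e\<in>UNIV. if e = c then m e else 0)" by simp
  then have "offset r m c + m c = (\<Sum>e\<in>UNIV. (if lt r e c then m e else 0) + (if e = c then m e else 0))"
    unfolding offset_def by (simp only: sum.distrib)
  also have "\<dots> \<le> offset r m d" unfolding offset_def
  proof (rule sum_mono)
    fix e
    show "(if lt r e c then m e else 0) + (if e = c then m e else 0) \<le> (if lt r e d then m e else 0)"
      using cd lt_trans[OF r, of e c d] m[of e] by auto
  qed
  finally show ?thesis .
qed

lemma cell_order:
  assumes "linear_order r" "\<And>d. 0 \<le> m d" "lt r c d" "x \<in> cell r m c" "y \<in> cell r m d"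
  shows "x < y"
  using offset_le[of r m, OF assms(1-3)] assms(4,5) unfolding cell_def by auto

lemma cell_disjoint:
  assumes "linear_order r" "\<And>d. 0 \<le> m d" "x \<in> cell r m c" "x \<in> cell r m d"
  shows "c = d"
  using cell_order[of r m, OF assms(1,2)] assms(3,4) lt_total[OF assms(1)] by (metis less_irrefl)

lemma cell_sub:
  assumes "linear_order r" "\<And>d. 0 \<le> m d" "x \<in> cell r m c"
  shows "x \<in> {0..<sum m UNIV}"
proof -
  have "0 \<le> (\<Sum>d\<in>UNIV. if lt r c d then m d else 0)" using assms(2) by (intro sum_nonneg) auto
  then show ?thesis using offset_total[OF assms(1), of m c] offset_nonneg[of m r c] assms(2,3)
    unfolding cell_def by auto
qed

text \<open>Take the largest letter whose cell starts at or before \<open>z\<close>; being largest,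
  it skips letters of weight zero, whose cells are empty.\<close>

lemma cell_cover:
  fixes m :: "'a::finite \<Rightarrow> real"
  assumes r: "linear_order r" and m: "\<And>d. 0 \<le> m d" and z: "z \<in> {0..<sum m UNIV}"
  shows "\<exists>c. z \<in> cell r m c"
proof -
  obtain m0 :: 'a where m0: "\<forall>x. (m0, x) \<in> r" using lin_min[OF r, of UNIV] by auto
  then have "offset r m m0 = 0" unfolding offset_def using lt_iff[OF r] by (intro sum.neutral) auto
  then have "m0 \<in> {c. offset r m c \<le> z}" using z by simp
  then have "{c. offset r m c \<le> z} \<noteq> {}" by blast
  then obtain c where c: "offset r m c \<le> z" "\<forall>d. offset r m d \<le> z \<longrightarrow> (d, c) \<in> r"
    using lin_max[OF r, of "{c. offset r m c \<le> z}"] by auto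
  have "z < offset r m c + m c"
  proof (rule ccontr)
    assume n: "\<not> ?thesis"
    show False
    proof (cases "\<exists>d. lt r c d")
      case False
      then have "offset r m c + m c = sum m UNIV" using offset_total[OF r, of m c] by simp
      then show False using n z by simp
    next
      case True
      then obtain d where d: "lt r c d" "\<forall>e. lt r c e \<longrightarrow> (d, e) \<in> r"
        using lin_min[OF r, of "{d. lt r c d}"] by auto
      have "lt r e d \<longleftrightarrow> lt r e c \<or> e = c" for e
        using d lt_trans[OF r] lt_iff[OF r] lt_total[OF r] by metis
      then have "offset r m d = (\<Sum>e\<in>UNIV. (if lt r e c then m e else 0) + (if e = c then m e else 0))"
        unfolding offset_def by (intro sum.cong) auto
      also have "\<dots> = offset r m c + m c" unfolding offset_def by (simp add: sum.distrib)
      finally have "offset r m d \<le> z" using n by simp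
      then show False using c(2) d(1) lt_iff[OF r] by blast
    qed
  qed
  then show ?thesis using c(1) unfolding cell_def by auto
qed

text \<open>A planar coupling of two weighted orders is the monotone one.\<close>

lemma coupling:
  fixes m :: "'a::finite \<Rightarrow> 'a \<Rightarrow> real"
  assumes r1: "linear_order r1" and r2: "linear_order r2" and m: "\<And>c d. 0 \<le> m c d"
    and pl: "\<And>c d c' d'. 0 < m c d \<Longrightarrow> 0 < m c' d' \<Longrightarrow> lt r2 c c' \<Longrightarrow> (d, d') \<in> r1"
  defines "p \<equiv> (\<lambda>c. \<Sum>d\<in>UNIV. m c d)" and "q \<equiv> (\<lambda>d. \<Sum>c\<in>UNIV. m c d)"
  shows "cell r2 p c \<inter> cell r1 q d =
      {offset r2 p c + offset r1 (m c) d..<offset r2 p c + offset r1 (m c) d + m c d}" (is "?X = ?Y")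
    and "cell r2 p c \<inter> cell r1 q d =
      {offset r1 q d + offset r2 (\<lambda>c. m c d) c..<offset r1 q d + offset r2 (\<lambda>c. m c d) c + m c d}" (is "?X = ?Z")
proof -
  have p0: "0 \<le> p c" "0 \<le> q c" for c unfolding p_def q_def using m by (auto intro: sum_nonneg)
  have main: "offset r2 p c + offset r1 (m c) d = offset r1 q d + offset r2 (\<lambda>c. m c d) c \<and>
      cell r2 p c \<inter> cell r1 q d =
      {offset r2 p c + offset r1 (m c) d..<offset r2 p c + offset r1 (m c) d + m c d}" if pos: "0 < m c d" for c d
  proof -
    let ?s1 = "offset r1 (m c) d" and ?s2 = "offset r2 (\<lambda>c. m c d) c"
    let ?e1 = "\<Sum>d'\<in>UNIV. if lt r1 d d' then m c d' else 0" and ?e2 = "\<Sum>c'\<in>UNIV. if lt r2 c c' then m c' d else 0"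
    \<comment> \<open>\<open>?g1\<close> and \<open>?g2\<close> select the mass preceding
      \<open>(c, d)\<close> row by row and column by column. Planarity makes them agree wherever
      \<open>m\<close> is positive, so both descriptions of the left end give the same
      number.\<close>
    let ?g1 = "\<lambda>c' d'. if lt r2 c' c \<or> (c' = c \<and> lt r1 d' d) then m c' d' else 0"
    let ?g2 = "\<lambda>c' d'. if lt r1 d' d \<or> (d' = d \<and> lt r2 c' c) then m c' d' else 0"
    have "?s1 = (\<Sum>c'\<in>UNIV. if c' = c then \<Sum>d'\<in>UNIV. if lt r1 d' d then m c' d' else 0 else 0)"
      unfolding offset_def by simp
    then have "offset r2 p c + ?s1 = (\<Sum>c'\<in>UNIV. (if lt r2 c' c then p c' else 0) +
        (if c' = c then \<Sum>d'\<in>UNIV. if lt r1 d' d then m c' d' else 0 else 0))"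
      unfolding offset_def by (simp only: sum.distrib)
    also have "\<dots> = (\<Sum>c'\<in>UNIV. \<Sum>d'\<in>UNIV. ?g1 c' d')"
    proof (rule sum.cong)
      fix c'
      show "(if lt r2 c' c then p c' else 0) + (if c' = c then \<Sum>d'\<in>UNIV. if lt r1 d' d then m c' d' else 0 else 0)
          = (\<Sum>d'\<in>UNIV. ?g1 c' d')"
        unfolding p_def by (cases "c' = c"; cases "lt r2 c' c") auto
    qed simp
    finally have L: "offset r2 p c + ?s1 = (\<Sum>c'\<in>UNIV. \<Sum>d'\<in>UNIV. ?g1 c' d')" .
    have "?s2 = (\<Sum>d'\<in>UNIV. if d' = d then \<Sum>c'\<in>UNIV. if lt r2 c' c then m c' d' else 0 else 0)"
      unfolding offset_def by simp
    then have "offset r1 q d + ?s2 = (\<Sum>d'\<in>UNIV. (if lt r1 d' d then q d' else 0) +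
        (if d' = d then \<Sum>c'\<in>UNIV. if lt r2 c' c then m c' d' else 0 else 0))"
      unfolding offset_def by (simp only: sum.distrib)
    also have "\<dots> = (\<Sum>d'\<in>UNIV. \<Sum>c'\<in>UNIV. ?g2 c' d')"
    proof (rule sum.cong)
      fix d'
      show "(if lt r1 d' d then q d' else 0) + (if d' = d then \<Sum>c'\<in>UNIV. if lt r2 c' c then m c' d' else 0 else 0)
          = (\<Sum>c'\<in>UNIV. ?g2 c' d')"
        unfolding q_def by (cases "d' = d"; cases "lt r1 d' d") auto
    qed simp
    also have "\<dots> = (\<Sum>c'\<in>UNIV. \<Sum>d'\<in>UNIV. ?g2 c' d')" by (rule sum.swap)
    also have "\<dots> = (\<Sum>c'\<in>UNIV. \<Sum>d'\<in>UNIV. ?g1 c' d')"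
    proof (intro sum.cong refl)
      fix c' d'
      show "?g2 c' d' = ?g1 c' d'"
      proof (cases "0 < m c' d'")
        case True
        have "lt r2 c' c \<Longrightarrow> (d', d) \<in> r1" "lt r2 c c' \<Longrightarrow> (d, d') \<in> r1" using pl[OF True pos] pl[OF pos True] by blast+
        then have "(lt r1 d' d \<or> (d' = d \<and> lt r2 c' c)) \<longleftrightarrow> (lt r2 c' c \<or> (c' = c \<and> lt r1 d' d))"
        proof -
          consider "lt r2 c' c" | "c' = c" | "lt r2 c c'" using lt_total[OF r2, of c' c] by blast
          then show ?thesis
          proof cases
            case 1
            then have "d' = d \<or> lt r1 d' d" using pl[OF True pos] by (auto simp: lt_def)
            then show ?thesis using 1 by blast
          next
            case 3
            then have "\<not> lt r1 d' d" "\<not> lt r2 c' c" "c' \<noteq> c"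
              using pl[OF pos True] lt_iff[OF r1] lt_asym[OF r2] by auto
            then show ?thesis by blast
          qed simp
        qed
        then show ?thesis by simp
      next
        case False
        then have "m c' d' = 0" using m[of c' d'] by simp
        then show ?thesis by auto
      qed
    qed
    finally have R: "offset r1 q d + ?s2 = (\<Sum>c'\<in>UNIV. \<Sum>d'\<in>UNIV. ?g1 c' d')" .
    have eq: "offset r2 p c + ?s1 = offset r1 q d + ?s2" using L R by simp
    \<comment> \<open>By planarity, there cannot be mass both before \<open>(c, d)\<close> in its
      row and before it in its column. So the later of the two cells starts exactly at the claimed
      point; \<open>z2\<close> does the same for the right end.\<close>
    have z1: "?s1 = 0 \<or> ?s2 = 0"
    proof (rule ccontr)
      assume "\<not> ?thesis"
      then have ne: "?s1 \<noteq> 0" "?s2 \<noteq> 0" by auto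
      obtain d' where "(if lt r1 d' d then m c d' else 0) \<noteq> 0" using sum_nonzero[OF ne(1)[unfolded offset_def]] ..
      moreover obtain c' where "(if lt r2 c' c then m c' d else 0) \<noteq> 0" using sum_nonzero[OF ne(2)[unfolded offset_def]] ..
      ultimately have h: "lt r1 d' d" "m c d' \<noteq> 0" "lt r2 c' c" "m c' d \<noteq> 0" by (auto split: if_splits)
      then have "0 < m c d'" "0 < m c' d" using m by (auto simp: less_le)
      then have "(d, d') \<in> r1" using pl h by blast
      then show False using h lt_iff[OF r1] by blast
    qed
    have z2: "?e1 = 0 \<or> ?e2 = 0"
    proof (rule ccontr)
      assume "\<not> ?thesis"
      then have ne: "?e1 \<noteq> 0" "?e2 \<noteq> 0" by auto
      obtain d' where "(if lt r1 d d' then m c d' else 0) \<noteq> 0" using sum_nonzero[OF ne(1)] ..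
      moreover obtain c' where "(if lt r2 c c' then m c' d else 0) \<noteq> 0" using sum_nonzero[OF ne(2)] ..
      ultimately have h: "lt r1 d d'" "m c d' \<noteq> 0" "lt r2 c c'" "m c' d \<noteq> 0" by (auto split: if_splits)
      then have "0 < m c d'" "0 < m c' d" using m by (auto simp: less_le)
      then have "(d', d) \<in> r1" using pl h by blast
      then show False using h lt_iff[OF r1] by blast
    qed
    have ge: "0 \<le> ?s1" "0 \<le> ?s2" "0 \<le> ?e1" "0 \<le> ?e2"
      using m by (auto intro!: offset_nonneg sum_nonneg)
    have pe: "p c = ?s1 + m c d + ?e1" using offset_total[OF r1, of "m c" d] unfolding p_def by simp
    have qe: "q d = ?s2 + m c d + ?e2" using offset_total[OF r2, of "\<lambda>c. m c d" c] unfolding q_def by simp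
    have "cell r2 p c \<inter> cell r1 q d = {offset r2 p c + ?s1..<offset r2 p c + ?s1 + m c d}"
    proof (intro set_eqI iffI)
      fix z assume "z \<in> cell r2 p c \<inter> cell r1 q d"
      then show "z \<in> {offset r2 p c + ?s1..<offset r2 p c + ?s1 + m c d}"
        using z1 z2 eq pe qe unfolding cell_def by auto
    next
      fix z assume "z \<in> {offset r2 p c + ?s1..<offset r2 p c + ?s1 + m c d}"
      then show "z \<in> cell r2 p c \<inter> cell r1 q d" using ge eq pe qe unfolding cell_def by auto
    qed
    then show ?thesis using eq by blast
  qed
  show "?X = ?Y"
  proof (cases "0 < m c d")
    case False
    then have m0: "m c d = 0" using m[of c d] by simp
    \<comment> \<open>A point of the row cell lies in the subcell of some column \<open>d'\<close>
      of positive mass, hence by \<open>main\<close> in the column cell of \<open>d'\<close>;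
      disjointness would give \<open>d' = d\<close>.\<close>
    have "?X = {}"
    proof (rule ccontr)
      assume "?X \<noteq> {}"
      then obtain z where z: "z \<in> cell r2 p c" "z \<in> cell r1 q d" by blast
      then have "z - offset r2 p c \<in> {0..<sum (m c) UNIV}" unfolding cell_def p_def by auto
      then obtain d' where d': "z - offset r2 p c \<in> cell r1 (m c) d'" using cell_cover[OF r1, of "m c"] m by blast
      then have pos: "0 < m c d'" unfolding cell_def by auto
      have "z \<in> cell r2 p c \<inter> cell r1 q d'" using main[OF pos] d' unfolding cell_def[of r1 "m c"] by auto
      then have "d' = d" using cell_disjoint[OF r1, of q] p0 z(2) by blast
      then show False using pos m0 by simp
    qed
    then show ?thesis using m0 by simp
  qed (use main in blast)
  then show "?X = ?Z"
    using main[of c d] m[of c d] by (cases "0 < m c d") auto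
qed

section \<open>Interval exchanges from invariant weights\<close>

context iet
begin

lemma ex_coding: "z \<in> {0..<1} \<Longrightarrow> \<exists>u. length u = n \<and> z \<in> cyl u"
proof (induction n)
  case 0
  then show ?case by (intro exI[of _ "[]"]) simp
next
  case (Suc n)
  then obtain u where u: "length u = n" "z \<in> cyl u" by blast
  obtain d where "(T ^^ n) z \<in> I d" using ex_letter Tn_in Suc.prems by blast
  then show ?case using u by (intro exI[of _ "u @ [d]"]) (simp add: cyl_snoc)
qed

text \<open>As long as no iterate sits on a left end, each further letter leaves some room to the
  left of \<open>z\<close>.\<close>

lemma cyl_left:
  assumes "0 < z" "z \<in> cyl u" "\<forall>i<length u. \<forall>e. (T ^^ i) z \<noteq> lo e"
  shows "\<exists>y<z. y \<in> cyl u"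
  using assms(2,3)
proof (induction u rule: rev_induct)
  case Nil
  then show ?case using assms(1) by (intro exI[of _ 0]) auto
next
  case (snoc d u)
  then have zu: "z \<in> cyl u" "(T ^^ length u) z \<in> I d" by (auto simp: cyl_snoc)
  obtain y where y: "y < z" "y \<in> cyl u" using snoc zu by auto
  have "(T ^^ length u) z \<noteq> lo d" using snoc.prems(2) by simp
  then have gt: "lo d < (T ^^ length u) z" "(T ^^ length u) z < hi d" using zu(2) I_eq[of d] by auto
  obtain \<tau> where \<tau>: "\<forall>z\<in>cyl u. (T ^^ length u) z = z + \<tau>" using cyl_trans by blast
  define y' where "y' = max y (z - ((T ^^ length u) z - lo d))"
  have y': "y \<le> y'" "y' < z" using y gt unfolding y'_def by auto
  then have yc: "y' \<in> cyl u" using cyl_convex[OF y(2) zu(1)] by simp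
  have "(T ^^ length u) y' = (T ^^ length u) z - (z - y')" using \<tau> yc zu(1) by simp
  moreover have "z - y' \<le> (T ^^ length u) z - lo d" unfolding y'_def by simp
  ultimately have "(T ^^ length u) y' \<in> I d" using gt y' I_eq[of d] by simp
  then show ?case using yc y' cyl_snoc by blast
qed

text \<open>In a shortest connection the intermediate points avoid the left ends, so
  \<open>z = glo c\<close> has points of its cylinder to its left. At \<open>z\<close> both the left
  letter reaches \<open>c\<close> and the right letter reaches \<open>d\<close>, which cuts the
  extension set of \<open>w\<close>.\<close>

lemma uncut_no_connection:
  assumes un: "\<forall>u\<in>code_lang. uncut r2 r1 (ext code_lang u)" shows no_connection
proof (rule ccontr)
  let ?P = "\<lambda>j. 1 \<le> j \<and> (\<exists>c d. lo d \<noteq> 0 \<and> (T ^^ j) (lo c) = lo d)"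
  assume "\<not> no_connection"
  then have "\<exists>j. ?P j" unfolding no_connection_def by blast
  then obtain j where j: "?P j" "\<forall>i<j. \<not> ?P i" using exists_least_iff[of ?P] by blast
  then obtain c d where cd: "lo d \<noteq> 0" "(T ^^ j) (lo c) = lo d" by blast
  obtain n where n: "j = Suc n" using j(1) by (cases j) auto
  define z where "z = glo c"
  have z01: "z \<in> {0..<1}" unfolding z_def using T_in lo01 by blast
  have Tz: "(T ^^ n) z = lo d" using cd(2) unfolding n Tn_Suc z_def .
  have av: "(T ^^ i) z \<noteq> lo e" if "i < n" for i e
  proof
    assume "(T ^^ i) z = lo e"
    moreover have "(T ^^ (n - i)) ((T ^^ i) z) = (T ^^ n) z" using that by (metis funpow_add comp_apply le_add_diff_inverse2 less_imp_le)
    ultimately have "(T ^^ (n - i)) (lo e) = lo d" using Tz by simp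
    moreover have "1 \<le> n - i" "n - i < j" using that n by auto
    ultimately show False using j(2) cd(1) by blast
  qed
  have z0: "0 < z"
  proof (rule ccontr)
    assume "\<not> ?thesis"
    then have z: "z = 0" using z01 by simp
    obtain e where "lo e = 0" using ex_lo_0 by blast
    then have "n = 0" using av[of 0 e] z by (cases n) auto
    then show False using Tz z cd(1) by simp
  qed
  obtain w where w: "length w = n" "z \<in> cyl w" using ex_coding z01 by blast
  obtain y0 where y0: "y0 < z" "y0 \<in> cyl w" using cyl_left[OF z0 w(2)] av w(1) by blast
  obtain \<tau> where \<tau>: "\<forall>z\<in>cyl w. (T ^^ n) z = z + \<tau>" using cyl_trans[of n w] w(1) by auto
  have iffL: "lt r2 c' c \<longleftrightarrow> y < z" if "y \<in> J c'" for y c'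
  proof
    assume "lt r2 c' c"
    then show "y < z" using lt_glo that unfolding z_def by blast
  next
    assume l: "y < z"
    have "(c', c) \<in> r2" using J_order[OF that glo_in] l unfolding z_def by simp
    moreover have "c' \<noteq> c" using l that J_eq[of c] unfolding z_def by auto
    ultimately show "lt r2 c' c" by (simp add: lt_def)
  qed
  have iffR: "lt r1 d' d \<longleftrightarrow> y < z" if y: "y \<in> cyl w" "(T ^^ n) y \<in> I d'" for y d'
  proof -
    have eq: "(T ^^ n) y < lo d \<longleftrightarrow> y < z" using \<tau> y(1) w(2) Tz by (metis add_less_cancel_right)
    show ?thesis
    proof
      assume "lt r1 d' d"
      then show "y < z" using lt_lo[OF y(2)] eq by blast
    next
      assume "y < z"
      then have l: "(T ^^ n) y < lo d" using eq by blast
      have "(d', d) \<in> r1" using I_order[OF y(2) lo_in] l by simp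
      moreover have "d' \<noteq> d" using l y(2) I_eq[of d] by auto
      ultimately show "lt r1 d' d" by (simp add: lt_def)
    qed
  qed
  let ?A = "{c'. lt r2 c' c}" and ?B = "{d'. lt r1 d' d}"
  have "downset r2 ?A" "downset r1 ?B"
    unfolding downset_def using le_lt_trans[OF lin2] le_lt_trans[OF lin1] by blast+
  moreover have "c' \<in> ?A \<longleftrightarrow> d' \<in> ?B" if "(c', d') \<in> ext code_lang w" for c' d'
    using that iffL iffR w(1) unfolding ext_code by blast
  moreover have "uncut r2 r1 (ext code_lang w)" using un w(2) unfolding code_lang_def by blast
  ultimately have all: "(\<forall>(c', d')\<in>ext code_lang w. c' \<in> ?A) \<or> (\<forall>(c', d')\<in>ext code_lang w. c' \<notin> ?A)"
    unfolding uncut_def by blast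
  have edge: "\<exists>c' d'. (c', d') \<in> ext code_lang w \<and> y \<in> J c'" if yw: "y \<in> cyl w" for y
  proof -
    obtain c' where "y \<in> J c'" using ex_jletter cyl_sub[OF yw] by blast
    moreover obtain d' where "(T ^^ length w) y \<in> I d'" using ex_letter Tn_in cyl_sub[OF yw] by blast
    ultimately show ?thesis using yw ext_code by blast
  qed
  obtain c1 d1 where 1: "(c1, d1) \<in> ext code_lang w" "y0 \<in> J c1" using edge[OF y0(2)] by blast
  obtain c2 d2 where 2: "(c2, d2) \<in> ext code_lang w" "z \<in> J c2" using edge[OF w(2)] by blast
  have "c1 \<in> ?A" "c2 \<notin> ?A" using iffL[OF 1(2)] iffL[OF 2(2)] y0(1) by auto
  then show False using all 1 2 by blast
qed

end

locale weights =
  fixes r1 r2 :: "('a::finite \<times> 'a) set" and F :: "'a list set" and \<mu> :: "'a list \<Rightarrow> real"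
  assumes lin1: "linear_order r1" and lin2: "linear_order r2"
    and biF: "biextendable F" and fullF: "\<forall>c. [c] \<in> F" and stF: "staircase r2 r1 F"
    and \<mu>_Nil: "\<mu> [] = 1" and \<mu>_nonneg: "\<And>u. 0 \<le> \<mu> u" and \<mu>_pos: "\<And>u. 0 < \<mu> u \<longleftrightarrow> u \<in> F"
    and \<mu>_right: "\<And>u. (\<Sum>d\<in>UNIV. \<mu> (u @ [d])) = \<mu> u" and \<mu>_left: "\<And>u. (\<Sum>c\<in>UNIV. \<mu> (c # u)) = \<mu> u"
begin

abbreviation m where "m \<equiv> \<lambda>c. \<mu> [c]"

definition wI where "wI c = cell r1 m c"
definition wT where "wT z = z + (offset r2 m (THE c. z \<in> wI c) - offset r1 m (THE c. z \<in> wI c))"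

lemma m_sum: "sum m UNIV = 1"
  using \<mu>_right[of "[]"] \<mu>_Nil by simp

lemma m_pos: "0 < m c"
  using \<mu>_pos fullF by blast

lemma wT_on: "z \<in> wI c \<Longrightarrow> wT z = z + (offset r2 m c - offset r1 m c)"
proof -
  assume z: "z \<in> wI c"
  then have "(THE c. z \<in> wI c) = c"
    using cell_disjoint[OF lin1, of m z] \<mu>_nonneg unfolding wI_def by (intro the_equality) auto
  then show ?thesis unfolding wT_def by simp
qed

lemma wT_image: "wT ` wI c = cell r2 m c"
proof -
  have "wT ` wI c = (\<lambda>z. z + (offset r2 m c - offset r1 m c)) ` wI c"
    by (intro image_cong refl wT_on)
  also have "\<dots> = cell r2 m c" unfolding wI_def cell_def by (simp add: add.commute)
  finally show ?thesis .
qed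

lemma cells_Union:
  assumes "linear_order r" shows "(\<Union>c. cell r m c) = {0..<1}"
proof (intro set_eqI iffI)
  fix z assume "z \<in> (\<Union>c. cell r m c)"
  then show "z \<in> {0..<1}" using cell_sub[of r m z, OF assms \<mu>_nonneg] unfolding m_sum by blast
next
  fix z assume "z \<in> {0..<1::real}"
  then have "z \<in> {0..<sum m UNIV}" unfolding m_sum .
  from cell_cover[of r m, OF assms \<mu>_nonneg this] show "z \<in> (\<Union>c. cell r m c)" by blast
qed

lemma wIET: "IET r1 r2 wI wT"
  unfolding IET_def
proof (intro conjI allI impI ballI)
  fix c
  show "\<exists>l r. l < r \<and> wI c = {l..<r}"
    unfolding wI_def cell_def using m_pos[of c]
    by (intro exI[of _ "offset r1 m c"] exI[of _ "offset r1 m c + m c"]) simp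
  show "\<exists>t. \<forall>x\<in>wI c. wT x = x + t" using wT_on by blast
next
  show "\<Union> (range wI) = {0..<1}" using cells_Union[OF lin1] unfolding wI_def .
next
  fix c d :: 'a assume "c \<noteq> d"
  then show "wI c \<inter> wI d = {}" unfolding wI_def using cell_disjoint[OF lin1, of m] \<mu>_nonneg by blast
next
  fix c d x y assume "lt r1 c d" "x \<in> wI c" "y \<in> wI d"
  then show "x < y" unfolding wI_def using cell_order[OF lin1, of m] \<mu>_nonneg by blast
next
  fix c d x y assume "lt r2 c d" "x \<in> wT ` wI c" "y \<in> wT ` wI d"
  then show "x < y" unfolding wT_image using cell_order[OF lin2, of m] \<mu>_nonneg by blast
next
  have U: "{0..<1} = (\<Union>c. wI c)" using cells_Union[OF lin1] unfolding wI_def by simp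
  have "inj_on wT {0..<1}"
  proof (rule inj_onI)
    fix x y assume xy: "x \<in> {0..<1}" "y \<in> {0..<1}" "wT x = wT y"
    then obtain c d where cd: "x \<in> wI c" "y \<in> wI d" unfolding U by blast
    then have "wT x \<in> cell r2 m c" "wT x \<in> cell r2 m d" using wT_image xy(3) by (metis imageI)+
    then have "c = d" using cell_disjoint[OF lin2, of m] \<mu>_nonneg by blast
    then show "x = y" using wT_on cd xy(3) by simp
  qed
  moreover have "wT ` {0..<1} = {0..<1}"
  proof -
    have "wT ` {0..<1} = (\<Union>c. cell r2 m c)" unfolding U image_UN wT_image ..
    then show ?thesis using cells_Union[OF lin2] by simp
  qed
  ultimately show "bij_betw wT {0..<1} {0..<1}" by (simp add: bij_betw_def)
qed

sublocale iet r1 r2 wI wT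
  by standard (rule lin1, rule lin2, rule wIET)

lemma J_cell: "J c = cell r2 m c"
  unfolding J_def by (rule wT_image)

lemma ext_coupling_planar:
  assumes "0 < \<mu> (c # u @ [d])" "0 < \<mu> (c' # u @ [d'])" "lt r2 c c'"
  shows "(d, d') \<in> r1"
proof -
  have "[c] @ u @ [d] \<in> F" "[c'] @ u @ [d'] \<in> F" using assms \<mu>_pos by auto
  then have "(c, d) \<in> ext F u" "(c', d') \<in> ext F u" "u \<in> F"
    using biextendable_factor[OF biF, of "[c]" u "[d]"] by (auto simp: ext_def)
  then show ?thesis using stF assms(3) unfolding staircase_def planar_def by blast
qed

section \<open>Cylinder lengths agree with the weights\<close>

definition shift :: "real \<Rightarrow> real set \<Rightarrow> real set" where
  "shift l A = (\<lambda>z. l + z) ` A"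

lemma shift_Int: "shift l A \<inter> shift l B = shift l (A \<inter> B)"
  unfolding shift_def by auto

lemma shift_interval: "shift l {x..<y} = {l + x..<l + y}"
  unfolding shift_def by (simp add: add.commute)

text \<open>The induction invariant. The subdivisions of the cylinder by the next letter and by the
  previous letter share the left end \<open>l\<close>, so \<open>coupling\<close> applies to them
  directly.\<close>

definition good_cyl :: "'a list \<Rightarrow> real \<Rightarrow> bool" where
  "good_cyl u l \<longleftrightarrow> cyl u = {l..<l + \<mu> u} \<and> (\<forall>d. cyl (u @ [d]) = shift l (cell r1 (\<lambda>d. \<mu> (u @ [d])) d)) \<and>
     (\<forall>c. J c \<inter> cyl u = shift l (cell r2 (\<lambda>c. \<mu> (c # u)) c))"

lemma \<mu>_zero_ext: "\<mu> u = 0 \<Longrightarrow> \<mu> (c # u) = 0"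
  using \<mu>_left[of u] sum_nonneg_eq_0_iff[of UNIV "\<lambda>c. \<mu> (c # u)"] \<mu>_nonneg by simp

text \<open>Inside \<open>cyl u\<close> the two subdivisions are the row and column cells of the
  weights \<open>\<mu> (c # u @ [d])\<close>. The first form of \<open>coupling\<close> describes
  the right extensions of \<open>c # u\<close>, the second the left extensions of
  \<open>u @ [d]\<close>.\<close>

lemma good_cyl_step:
  assumes u: "good_cyl u l"
  shows "cyl (c # u) = {l + offset r2 (\<lambda>c. \<mu> (c # u)) c - tr c..<l + offset r2 (\<lambda>c. \<mu> (c # u)) c - tr c + \<mu> (c # u)}"
    and "cyl (c # u @ [d]) = shift (l + offset r2 (\<lambda>c. \<mu> (c # u)) c - tr c) (cell r1 (\<lambda>d. \<mu> (c # u @ [d])) d)"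
    and "cyl (u @ [d]) = {l + offset r1 (\<lambda>d. \<mu> (u @ [d])) d..<l + offset r1 (\<lambda>d. \<mu> (u @ [d])) d + \<mu> (u @ [d])}"
    and "J c \<inter> cyl (u @ [d]) = shift (l + offset r1 (\<lambda>d. \<mu> (u @ [d])) d) (cell r2 (\<lambda>c. \<mu> (c # u @ [d])) c)"
proof -
  let ?M = "\<lambda>c d. \<mu> (c # u @ [d])"
  let ?p = "\<lambda>c. \<mu> (c # u)" and ?q = "\<lambda>d. \<mu> (u @ [d])"
  have pq: "(\<Sum>d\<in>UNIV. ?M c d) = ?p c" "(\<Sum>c\<in>UNIV. ?M c d) = ?q d" for c d
    using \<mu>_right[of "c # u"] \<mu>_left[of "u @ [d]"] by auto
  have coup: "cell r2 ?p c \<inter> cell r1 ?q d = {offset r2 ?p c + offset r1 (?M c) d..<offset r2 ?p c + offset r1 (?M c) d + ?M c d}"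
    "cell r2 ?p c \<inter> cell r1 ?q d = {offset r1 ?q d + offset r2 (\<lambda>c. ?M c d) c..<offset r1 ?q d + offset r2 (\<lambda>c. ?M c d) c + ?M c d}"
    using coupling[OF lin1 lin2, of ?M c d] \<mu>_nonneg ext_coupling_planar[of _ u] unfolding pq by blast+
  have cu: "cyl (u @ [d]) \<subseteq> cyl u" using cyl_snoc by blast
  have both: "J c \<inter> cyl (u @ [d]) = shift l (cell r2 ?p c \<inter> cell r1 ?q d)"
  proof -
    have "J c \<inter> cyl (u @ [d]) = (J c \<inter> cyl u) \<inter> cyl (u @ [d])" using cu by blast
    moreover have "J c \<inter> cyl u = shift l (cell r2 ?p c)" "cyl (u @ [d]) = shift l (cell r1 ?q d)"
      using u unfolding good_cyl_def by blast+
    ultimately show ?thesis unfolding shift_Int[symmetric] by (simp only:)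
  qed
  have pull: "cyl (c # v) = shift (- tr c) (J c \<inter> cyl v)" for v
  proof (intro set_eqI iffI)
    fix z assume "z \<in> cyl (c # v)"
    then have z: "z \<in> wI c" "wT z \<in> cyl v" unfolding cyl_Cons by auto
    have "wT z \<in> J c" unfolding J_def by (rule imageI) (rule z(1))
    then have "wT z \<in> J c \<inter> cyl v" "z = - tr c + wT z" using T_tr[OF z(1)] z(2) by auto
    then show "z \<in> shift (- tr c) (J c \<inter> cyl v)" unfolding shift_def by blast
  next
    fix z assume "z \<in> shift (- tr c) (J c \<inter> cyl v)"
    then obtain y where y: "y \<in> J c" "y \<in> cyl v" "z = - tr c + y" unfolding shift_def by blast
    then obtain x where x: "x \<in> wI c" "y = wT x" unfolding J_def by blast
    then have "z = x" using y(3) T_tr[OF x(1)] by simp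
    then show "z \<in> cyl (c # v)" using x y(2) unfolding cyl_Cons by simp
  qed
  have Ju: "J c \<inter> cyl u = {l + offset r2 ?p c..<l + offset r2 ?p c + ?p c}"
  proof -
    have "J c \<inter> cyl u = shift l (cell r2 ?p c)" using u unfolding good_cyl_def by blast
    then show ?thesis unfolding cell_def shift_interval by (simp add: add.assoc)
  qed
  show "cyl (c # u) = {l + offset r2 ?p c - tr c..<l + offset r2 ?p c - tr c + ?p c}"
    unfolding pull Ju shift_interval by (simp add: algebra_simps)
  show "cyl (c # u @ [d]) = shift (l + offset r2 ?p c - tr c) (cell r1 (\<lambda>d. \<mu> (c # u @ [d])) d)"
    unfolding pull both coup(1) unfolding cell_def shift_interval by (simp add: algebra_simps)
  show "cyl (u @ [d]) = {l + offset r1 ?q d..<l + offset r1 ?q d + ?q d}"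
  proof -
    have "cyl (u @ [d]) = shift l (cell r1 ?q d)" using u unfolding good_cyl_def by blast
    then show ?thesis unfolding cell_def shift_interval by (simp add: add.assoc)
  qed
  show "J c \<inter> cyl (u @ [d]) = shift (l + offset r1 ?q d) (cell r2 (\<lambda>c. \<mu> (c # u @ [d])) c)"
    unfolding both coup(2) unfolding cell_def shift_interval by (simp add: algebra_simps)
qed

lemma good_cyl_Nil: "good_cyl [] 0"
proof -
  have "cyl ([] @ [d]) = cell r1 m d" for d
  proof (intro set_eqI iffI)
    fix z assume "z \<in> cyl ([] @ [d])"
    then show "z \<in> cell r1 m d" unfolding cyl_snoc by (simp add: wI_def)
  next
    fix z assume z: "z \<in> cell r1 m d"
    then have "z \<in> {0..<1}" using I_sub[of z d] unfolding wI_def by blast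
    then show "z \<in> cyl ([] @ [d])" unfolding cyl_snoc using z by (simp add: wI_def)
  qed
  moreover have "J c \<inter> cyl [] = cell r2 m c" for c
    unfolding cyl_Nil using J_sub J_cell by blast
  moreover have "shift 0 A = A" for A unfolding shift_def by simp
  ultimately show ?thesis unfolding good_cyl_def using \<mu>_Nil by simp
qed

text \<open>Dropping the first letter of \<open>u\<close> yields its right subdivision, dropping the
  last letter its left one. Their left ends agree because a nonempty half-open interval determines
  its ends; if \<open>\<mu> u = 0\<close>, the left subdivision consists of empty cells.\<close>

lemma ex_good_cyl: "\<exists>l. good_cyl u l"
proof (induction "length u" arbitrary: u)
  case 0
  then show ?case using good_cyl_Nil by auto
next
  case (Suc n)
  obtain c u1 where u1: "u = c # u1" using Suc.hyps(2) by (cases u) auto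
  obtain u2 d where u2: "u = u2 @ [d]" using Suc.hyps(2) by (cases u rule: rev_cases) auto
  obtain l1 where l1: "good_cyl u1 l1" using Suc u1 by auto
  obtain l2 where l2: "good_cyl u2 l2" using Suc u2 by auto
  obtain l where l: "cyl u = {l..<l + \<mu> u}" "\<forall>d. cyl (u @ [d]) = shift l (cell r1 (\<lambda>d. \<mu> (u @ [d])) d)"
    using good_cyl_step(1,2)[OF l1] unfolding u1 append_Cons by blast
  obtain l' where l': "cyl u = {l'..<l' + \<mu> u}" "\<forall>c. J c \<inter> cyl u = shift l' (cell r2 (\<lambda>c. \<mu> (c # u)) c)"
    using good_cyl_step(3,4)[OF l2] unfolding u2 by blast
  show ?case
  proof (cases "0 < \<mu> u")
    case True
    then have "l = l'" using l(1) l'(1) by (metis atLeastLessThan_eq_iff less_add_same_cancel1)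
    then show ?thesis using l l' unfolding good_cyl_def by blast
  next
    case False
    then have z: "\<mu> u = 0" using \<mu>_nonneg[of u] by simp
    then have "J c \<inter> cyl u = shift l (cell r2 (\<lambda>c. \<mu> (c # u)) c)" for c
      using l(1) \<mu>_zero_ext[OF z] unfolding cell_def shift_interval by simp
    then show ?thesis using l unfolding good_cyl_def by blast
  qed
qed

lemma code_lang_eq: "code_lang = F"
proof (intro set_eqI)
  fix u
  obtain l where "cyl u = {l..<l + \<mu> u}" using ex_good_cyl unfolding good_cyl_def by blast
  then have "u \<in> code_lang \<longleftrightarrow> 0 < \<mu> u" unfolding code_lang_def by simp
  then show "u \<in> code_lang \<longleftrightarrow> u \<in> F" using \<mu>_pos by simp
qed

lemma coding: "coding_of_regular_IET_for r1 r2 {x. lang x \<subseteq> F}"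
proof -
  have "no_connection" using uncut_no_connection stF unfolding code_lang_eq staircase_def by blast
  then have "IET_regular wI wT" by (rule no_connection_regular)
  moreover have "{x. lang x \<subseteq> F} = natural_coding wI wT" unfolding natural_coding_eq code_lang_eq ..
  ultimately show ?thesis unfolding coding_of_regular_IET_for_def using wIET by blast
qed

end

section \<open>Bi-infinite codings of orbits\<close>

context iet
begin

text \<open>Code the two-sided orbit of a point of \<open>cyl u\<close>: all its windows have
  nonempty cylinders, and the one at time 0 is \<open>u\<close>.\<close>

lemma code_occurs:
  assumes "u \<in> code_lang" shows "\<exists>x. x \<in> natural_coding I T \<and> u \<in> lang x"
proof -
  obtain z where z: "z \<in> cyl u" using assms unfolding code_lang_def by blast
  have z01: "z \<in> {0..<1}" using cyl_sub[OF z] .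
  define o' where "o' i = (if 0 \<le> i then (T ^^ nat i) z else (T' ^^ nat (- i)) z)" for i :: int
  have o01: "o' i \<in> {0..<1}" for i unfolding o'_def using Tn_in[OF z01] T'n_in[OF z01] by simp
  have oT: "T (o' i) = o' (i + 1)" for i
  proof (cases "0 \<le> i")
    case True
    then have "nat (i + 1) = Suc (nat i)" by simp
    then show ?thesis using True unfolding o'_def by simp
  next
    case False
    then obtain k where k: "nat (- i) = Suc k" by (cases "nat (- i)") auto
    have "T ((T' ^^ Suc k) z) = (T' ^^ k) z" using T_T'[OF T'n_in[OF z01], of k] by simp
    moreover have "o' (i + 1) = (T' ^^ k) z"
    proof (cases "i + 1 = 0")
      case True
      then have "k = 0" using k by simp
      then show ?thesis using True unfolding o'_def by simp
    next
      case False
      then have "nat (- (i + 1)) = k" "\<not> 0 \<le> i + 1" using k \<open>\<not> 0 \<le> i\<close> by auto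
      then show ?thesis unfolding o'_def by simp
    qed
    ultimately show ?thesis using False k unfolding o'_def by simp
  qed
  have oTn: "(T ^^ n) (o' i) = o' (i + int n)" for n i
    by (induction n) (simp_all add: oT algebra_simps)
  define x where "x i = (SOME c. o' i \<in> I c)" for i
  have xI: "o' i \<in> I (x i)" for i unfolding x_def using someI_ex[OF ex_letter[OF o01]] .
  have win: "o' i \<in> cyl (word_at x i n)" for i n
  proof (induction n)
    case 0
    then show ?case using o01 by (simp add: word_at_def)
  next
    case (Suc n)
    then show ?case unfolding word_at_Suc cyl_snoc using oTn xI by simp
  qed
  then have "lang x \<subseteq> code_lang" unfolding lang_def code_lang_def by blast
  moreover have "word_at x 0 (length u) = u"
  proof (rule nth_equalityI)
    fix i assume "i < length (word_at x 0 (length u))"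
    then have i: "i < length u" by simp
    have "o' (int i) \<in> I (u ! i)" using z i oTn[of i 0] unfolding cyl_def by (simp add: o'_def)
    then have "x (int i) = u ! i" using xI I_unique by blast
    then show "word_at x 0 (length u) ! i = u ! i" using i unfolding word_at_def by simp
  qed simp
  then have "u \<in> lang x" unfolding lang_def by (metis (mono_tags, lifting) mem_Collect_eq)
  ultimately show ?thesis unfolding natural_coding_eq by blast
qed

end

section \<open>Irreducibility\<close>

text \<open>Starting from a letter of \<open>P\<close> one never leaves \<open>P\<close>, yet by
  uniform recurrence \<open>q\<close> occurs in every long enough word starting with
  \<open>p\<close>.\<close>

lemma closed_letters:
  assumes bi: "biextendable F" and rec: "uniformly_recurrent F" and full: "\<forall>c. [c] \<in> F"
    and cl: "\<forall>(c, d)\<in>ext F []. c \<in> P \<longrightarrow> d \<in> P" and P: "p \<in> P"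
  shows "q \<in> P"
proof -
  obtain R where R: "\<forall>v\<in>F. R \<le> length v \<longrightarrow> sublist [q] v" using rec full unfolding uniformly_recurrent_def by blast
  have letters: "set (c # y) \<subseteq> P" if "c \<in> P" "c # y \<in> F" for c y
    using that
  proof (induction y arbitrary: c)
    case (Cons d y)
    have "[] @ [c, d] @ y \<in> F" using Cons.prems by simp
    then have "(c, d) \<in> ext F []" using biextendable_factor[OF bi, of "[]" "[c, d]" y] by (simp add: ext_def)
    then have "d \<in> P" using cl Cons.prems by blast
    moreover have "[c] @ (d # y) @ [] \<in> F" using Cons.prems by simp
    then have "d # y \<in> F" using biextendable_factor[OF bi] by blast
    ultimately show ?case using Cons by auto
  qed simp
  obtain x y where xy: "length y = R" "x @ [p] @ y \<in> F" using biextendable_extend[OF bi, of "[p]" R] full by blast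
  then have py: "p # y \<in> F" using biextendable_factor[OF bi, of x "p # y" "[]"] by simp
  then have "sublist [q] (p # y)" using R xy(1) by simp
  then have "q \<in> set (p # y)" using set_mono_sublist[of "[q]" "p # y"] by auto
  then show ?thesis using letters[OF P py] by blast
qed

lemma smallest_downset:
  assumes "linear_order r" shows "downset (r :: ('a::finite \<times> 'a) set) (smallest r k)"
  unfolding downset_def
proof (intro allI impI)
  fix x y assume h: "y \<in> smallest r k \<and> (x, y) \<in> r"
  then have "{z. lt r z x} \<subseteq> {z. lt r z y}" using lt_le_trans[OF assms] by blast
  then have "card {z. lt r z x} \<le> card {z. lt r z y}" by (intro card_mono) auto
  then show "x \<in> smallest r k" using h unfolding smallest_def by simp
qed

lemma smallest_proper:
  fixes r :: "('a::finite \<times> 'a) set"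
  assumes r: "linear_order r" and k: "0 < k" "k < card (UNIV :: 'a set)"
  shows "\<exists>p q. p \<in> smallest r k \<and> q \<notin> smallest r k"
proof -
  obtain p :: 'a where p: "\<forall>x. (p, x) \<in> r" using lin_min[OF r, of UNIV] by auto
  then have "{y. lt r y p} = {}" using lt_iff[OF r] by blast
  then have "p \<in> smallest r k" using k(1) unfolding smallest_def by simp
  moreover obtain q :: 'a where q: "\<forall>x. (x, q) \<in> r" using lin_max[OF r, of UNIV] by auto
  have "{y. lt r y q} = UNIV - {q}" using q by (auto simp: lt_def)
  then have "card {y. lt r y q} = card (UNIV :: 'a set) - 1" by simp
  then have "q \<notin> smallest r k" using k(2) unfolding smallest_def by simp
  ultimately show ?thesis by blast
qed

text \<open>If the \<open>k\<close> smallest letters agree, \<open>uncut\<close> provides a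
  two-letter word crossing between \<open>?K\<close> and its complement. Planarity then forbids
  crossings in the other direction, so one of the two sets is closed under successors, against
  recurrence.\<close>

lemma staircase_irreducible:
  fixes rL rR :: "('a::finite \<times> 'a) set"
  assumes lin: "linear_order rL" "linear_order rR" and bi: "biextendable F" and rec: "uniformly_recurrent F" and full: "\<forall>c. [c] \<in> F"
    and st: "staircase rL rR F"
  shows "irreducible_pair rL rR"
  unfolding irreducible_pair_def
proof (intro allI impI notI)
  fix k assume k: "0 < k \<and> k < card (UNIV :: 'a set)" and eq: "smallest rL k = smallest rR k"
  let ?K = "smallest rL k"
  have dL: "downset rL ?K" and dR: "downset rR ?K"
    using smallest_downset[OF lin(1)] smallest_downset[OF lin(2)] eq by metis+
  obtain p q where pq: "p \<in> ?K" "q \<notin> ?K" using smallest_proper[OF lin(1)] k by blast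
  have pl: "planar rL rR (ext F [])" and un: "uncut rL rR (ext F [])"
    using st biextendable_Nil[OF bi] unfolding staircase_def by blast+
  have ex: "\<exists>d. (c, d) \<in> ext F []" for c using biextendable_ext_right[OF bi, of "[c]"] full by (auto simp: ext_def)
  have "\<not> (\<forall>(c, d)\<in>ext F []. c \<in> ?K \<longleftrightarrow> d \<in> ?K)"
  proof
    assume all: "\<forall>(c, d)\<in>ext F []. c \<in> ?K \<longleftrightarrow> d \<in> ?K"
    have "(\<forall>(c, d)\<in>ext F []. c \<in> ?K) \<or> (\<forall>(c, d)\<in>ext F []. c \<notin> ?K)"
      using un[unfolded uncut_def, rule_format, of ?K ?K] dL dR all by blast
    moreover obtain d1 d2 where "(p, d1) \<in> ext F []" "(q, d2) \<in> ext F []" using ex by blast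
    ultimately show False using pq by blast
  qed
  then obtain c d where cd: "(c, d) \<in> ext F []" "(c \<in> ?K) \<noteq> (d \<in> ?K)" by blast
  show False
  proof (cases "c \<in> ?K")
    case True
    then have "\<forall>(c', d')\<in>ext F []. c' \<in> - ?K \<longrightarrow> d' \<in> - ?K"
      using cd pl dL dR lt_iff[OF lin(1)] unfolding planar_def downset_def by fast
    from closed_letters[OF bi rec full this, of q p] show False using pq by blast
  next
    case False
    then have "\<forall>(c', d')\<in>ext F []. c' \<in> ?K \<longrightarrow> d' \<in> ?K"
      using cd pl dL dR lt_iff[OF lin(1)] unfolding planar_def downset_def by fast
    from closed_letters[OF bi rec full this, of p q] show False using pq by blast
  qed
qed

section \<open>The characterization\<close>

lemma path_coding:
  fixes S :: "('a::finite \<Rightarrow> 'a list) set"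
  assumes S: "\<forall>\<tau>\<in>S. dendric_return_morphism \<tau>" and ab: "a \<noteq> b"
    and X: "shift_space X" and \<sigma>S: "\<forall>n. \<sigma> n \<in> S" and XS: "X = S_adic_shift \<sigma>"
    and prim: "primitive \<sigma>" and path: "labels_path S a b \<sigma> v"
  shows "coding_of_regular_IET_for (snd (v 0)) (fst (v 0)) X"
proof -
  have retn: "return_for (\<sigma> n) (ret_word (\<sigma> n))" for n
    using S \<sigma>S ab ret_word_return[of "\<sigma> n" a b] unfolding dendric_return_morphism_def by blast
  have ne: "\<forall>n c. \<sigma> n c \<noteq> []" using retn unfolding return_for_def by blast
  interpret P: primitive_seq \<sigma> a b by standard (rule ab, rule ne, rule prim)
  interpret U: uniformly_recurrent_sequence \<sigma> "lang_n \<sigma>" a b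
  proof
    show "lang_n \<sigma> n \<subseteq> prelang \<sigma> n" for n
    proof
      fix u assume "u \<in> lang_n \<sigma> n"
      then show "u \<in> prelang \<sigma> n" unfolding prelang_def lang_n_iff by blast
    qed
  qed (rule ab retn P.lang_n_biextendable P.lang_n_uniformly_recurrent P.lang_n_letter P.lang_n_image)+
  have edge: "gIET_edge S a b (v n) (\<sigma> n) (v (Suc n))" for n using path unfolding labels_path_def by blast
  have lin: "linear_order (fst (v n))" "linear_order (snd (v n))" for n
    using edge[of n] unfolding gIET_edge_def gIET_vertex_def by blast+
  define Q where "Q n u \<longleftrightarrow> planar (fst (v n)) (snd (v n)) (ext (lang_n \<sigma> n) u) \<and>
    uncut (fst (v n)) (snd (v n)) (ext (lang_n \<sigma> n) u)" for n u
  have step: "Q n u" if u: "u \<in> lang_n \<sigma> n"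
    and IH: "\<And>x. x \<in> lang_n \<sigma> (Suc n) \<Longrightarrow> length (morph_app (\<sigma> n) x) + length (ret_word (\<sigma> n)) \<le> length u \<Longrightarrow> Q (Suc n) x"
    for n u
  proof -
    interpret image_step "\<sigma> n" "lang_n \<sigma> (Suc n)" "lang_n \<sigma> n"
      by standard (rule retn, rule P.lang_n_biextendable, rule P.lang_n_image)
    let ?pL = "fst (v (Suc n))" and ?pR = "snd (v (Suc n))"
    note e = edge[of n, unfolded gIET_edge_def]
    have cL: "\<forall>s\<in>TL (\<sigma> n). convex_in ?pL (AL (\<sigma> n) s)"
      using e convex_connected[OF lin(1)] unfolding left_valid_def by blast
    have cR: "\<forall>p\<in>TR (\<sigma> n). convex_in ?pR (AR (\<sigma> n) p)"
      using e convex_connected[OF lin(2)] unfolding right_valid_def by blast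
    have dm: "dendric_morph (\<sigma> n)" using S \<sigma>S unfolding dendric_return_morphism_def by blast
    have pm: "planar_morph (fst (v n)) (snd (v n)) (\<sigma> n)" using e by blast
    have full: "\<forall>c. [c] \<in> lang_n \<sigma> (Suc n)" using P.lang_n_letter by blast
    from e consider "planar_preserving (\<sigma> n) ?pL ?pR (fst (v n)) (snd (v n))"
      | "planar_preserving (\<sigma> n) (?pL\<inverse>) (?pR\<inverse>) (fst (v n)) (snd (v n))" by blast
    then show ?thesis
    proof cases
      case 1
      show ?thesis unfolding Q_def
        by (rule staircase_step[OF full dm lin lin pm 1 cL cR u]) (use IH in \<open>auto simp: Q_def\<close>)
    next
      \<comment> \<open>\<open>Q\<close> is insensitive to reversing both orders, so the induction
        hypothesis is used for the reversed pair.\<close>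
      case 2
      have c: "\<forall>s\<in>TL (\<sigma> n). convex_in (?pL\<inverse>) (AL (\<sigma> n) s)" "\<forall>p\<in>TR (\<sigma> n). convex_in (?pR\<inverse>) (AR (\<sigma> n) p)"
        using cL cR convex_in_converse by blast+
      show ?thesis unfolding Q_def
      proof (rule staircase_step[OF full dm linear_order_converse[OF lin(1)] linear_order_converse[OF lin(2)] lin pm 2 c u])
        fix x assume "x \<in> lang_n \<sigma> (Suc n)" "length (morph_app (\<sigma> n) x) + length (ret_word (\<sigma> n)) \<le> length u"
        then have "Q (Suc n) x" by (rule IH)
        then show "planar (?pL\<inverse>) (?pR\<inverse>) (ext (lang_n \<sigma> (Suc n)) x) \<and> uncut (?pL\<inverse>) (?pR\<inverse>) (ext (lang_n \<sigma> (Suc n)) x)"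
          unfolding Q_def using planar_converse uncut_converse by blast
      qed
    qed
  qed
  \<comment> \<open>A level with nonempty return word strictly shortens words, and no level
    lengthens them. The outer induction is on the length, the inner one on the number of levels up
    to a nonempty return word.\<close>
  have Qall: "u \<in> lang_n \<sigma> n \<Longrightarrow> Q n u" for n u
  proof (induction "length u" arbitrary: u n rule: less_induct)
    case less
    have inner: "x \<in> lang_n \<sigma> i \<Longrightarrow> length x \<le> length u \<Longrightarrow> ret_word (\<sigma> (i + k)) \<noteq> [] \<Longrightarrow> Q i x" for k i x
    proof (induction k arbitrary: i x)
      case 0
      show ?case
      proof (rule step[OF 0(1)])
        fix y assume y: "y \<in> lang_n \<sigma> (Suc i)" "length (morph_app (\<sigma> i) y) + length (ret_word (\<sigma> i)) \<le> length x"
        have "length y \<le> length (morph_app (\<sigma> i) y)" using length_morph_app_ge[of "\<sigma> i"] ne by blast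
        moreover have "0 < length (ret_word (\<sigma> i))" using 0(3) by simp
        ultimately have "length y < length u" using y(2) 0(2) by linarith
        then show "Q (Suc i) y" using less.hyps y(1) by blast
      qed
    next
      case (Suc k)
      show ?case
      proof (rule step[OF Suc.prems(1)])
        fix y assume y: "y \<in> lang_n \<sigma> (Suc i)" "length (morph_app (\<sigma> i) y) + length (ret_word (\<sigma> i)) \<le> length x"
        have "length y \<le> length (morph_app (\<sigma> i) y)" using length_morph_app_ge[of "\<sigma> i"] ne by blast
        then have "length y \<le> length u" using y(2) Suc.prems(2) by linarith
        then show "Q (Suc i) y" using Suc.IH[OF y(1)] Suc.prems(3) by simp
      qed
    qed
    obtain j where "j \<ge> n" "ret_word (\<sigma> j) \<noteq> []" using U.return_nonempty_inf by blast
    then have "ret_word (\<sigma> (n + (j - n))) \<noteq> []" by simp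
    then show ?case using inner[OF less.prems] by blast
  qed
  obtain x where x: "x \<in> X" using X unfolding shift_space_def by blast
  then have "lang x \<subseteq> lang_n \<sigma> 0" unfolding XS S_adic_shift_def by simp
  from frequencies[OF this P.lang_n_uniformly_recurrent] obtain \<mu> :: "'a list \<Rightarrow> real" where \<mu>:
    "\<mu> [] = 1" "\<forall>u. 0 \<le> \<mu> u" "\<forall>u. 0 < \<mu> u \<longleftrightarrow> u \<in> lang_n \<sigma> 0"
    "\<forall>u. (\<Sum>d\<in>UNIV. \<mu> (u @ [d])) = \<mu> u" "\<forall>u. (\<Sum>c\<in>UNIV. \<mu> (c # u)) = \<mu> u" by blast
  interpret W: weights "snd (v 0)" "fst (v 0)" "lang_n \<sigma> 0" \<mu>
    by standard (use lin P.lang_n_biextendable P.lang_n_letter Qall \<mu> in \<open>auto simp: staircase_def Q_def\<close>)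
  show ?thesis using W.coding unfolding XS S_adic_shift_def .
qed

lemma coding_path:
  fixes S :: "('a::finite \<Rightarrow> 'a list) set"
  assumes S: "\<forall>\<tau>\<in>S. dendric_return_morphism \<tau>" and ab: "a \<noteq> b"
    and \<sigma>S: "\<forall>n. \<sigma> n \<in> S" and XS: "X = S_adic_shift \<sigma>" and cod: "coding_of_regular_IET X"
  shows "primitive \<sigma> \<and> (\<exists>v. labels_path S a b \<sigma> v)"
proof -
  obtain r1 r2 I T where lin: "linear_order r1" "linear_order r2" and IT: "IET r1 r2 I T" "IET_regular I T"
    "X = natural_coding I T"
    using cod unfolding coding_of_regular_IET_def coding_of_regular_IET_for_def by blast
  interpret iet r1 r2 I T by standard (rule lin IT(1))+
  have nc: no_connection using regular_no_connection IT(2) .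
  have retn: "return_for (\<sigma> n) (ret_word (\<sigma> n))" for n
    using S \<sigma>S ab ret_word_return[of "\<sigma> n" a b] unfolding dendric_return_morphism_def by blast
  \<comment> \<open>The derived languages depend only on the coding and on the directive sequence,
    so the choices made at the successive levels concern orders alone.\<close>
  define Fs where "Fs = rec_nat code_lang (\<lambda>n F. {v. morph_app (\<sigma> n) v @ ret_word (\<sigma> n) \<in> F})"
  have Fs0: "Fs 0 = code_lang" and FsS: "Fs (Suc n) = {v. morph_app (\<sigma> n) v @ ret_word (\<sigma> n) \<in> Fs n}" for n
    unfolding Fs_def by simp_all
  define Good where "Good n v \<longleftrightarrow> linear_order (fst v) \<and> linear_order (snd v) \<and> lt (fst v) a b \<and>
    biextendable (Fs n) \<and> uniformly_recurrent (Fs n) \<and> (\<forall>c. [c] \<in> Fs n) \<and> Fs n \<subseteq> prelang \<sigma> n \<and> staircase (fst v) (snd v) (Fs n)"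
    for n and v :: "('a \<times> 'a) set \<times> ('a \<times> 'a) set"
  have vertex: "gIET_vertex a b v" if "Good n v" for n v
    using that staircase_irreducible[of "fst v" "snd v" "Fs n"] unfolding Good_def gIET_vertex_def by blast
  \<comment> \<open>Reversing both orders preserves every property collected in \<open>Good\<close>
    except the relative position of \<open>a\<close> and \<open>b\<close>.\<close>
  have ex_orient: "\<exists>v'. (v' = (rL, rR) \<or> v' = (rL\<inverse>, rR\<inverse>)) \<and> lt (fst v') a b" if "linear_order rL" for rL rR :: "('a \<times> 'a) set"
    using lt_total[OF that ab] by (metis fst_conv lt_converse)
  have base: "\<exists>v. Good 0 v"
  proof -
    obtain v where v: "v = (r2, r1) \<or> v = (r2\<inverse>, r1\<inverse>)" "lt (fst v) a b" using ex_orient[OF lin(2)] by blast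
    have st: "staircase r2 r1 code_lang" unfolding staircase_def using code_planar code_uncut[OF nc] by blast
    have st': "staircase (fst v) (snd v) code_lang" using v(1) st staircase_converse[OF st] by auto
    have linv: "linear_order (fst v)" "linear_order (snd v)" using v(1) lin linear_order_converse by auto
    have pre: "code_lang \<subseteq> prelang \<sigma> 0"
    proof
      fix u assume "u \<in> code_lang"
      then obtain x where "x \<in> X" "u \<in> lang x" using code_occurs IT(3) by blast
      then have "u \<in> lang_n \<sigma> 0" unfolding XS S_adic_shift_def by blast
      then show "u \<in> prelang \<sigma> 0" unfolding prelang_def lang_n_iff by blast
    qed
    have "Good 0 v" unfolding Good_def Fs0
      using linv v(2) code_biextendable code_uniformly_recurrent[OF nc ab] code_letter pre st' by blast
    then show ?thesis by blast
  qed
  have extend: "\<exists>v'. Good (Suc n) v' \<and> gIET_edge S a b v (\<sigma> n) v' \<and> Fs n = image_lang (\<sigma> n) (Fs (Suc n))"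
    if v: "Good n v" for n v
  proof -
    interpret D: derivation \<sigma> n "Fs n"
      by standard (use retn v in \<open>auto simp: Good_def\<close>)
    have F1: "D.F1 = Fs (Suc n)" unfolding D.F1_def FsS ..
    interpret E: derive_step "\<sigma> n" "Fs (Suc n)" "Fs n" "fst v" "snd v"
    proof
      show "Fs n = image_lang (\<sigma> n) (Fs (Suc n))" using D.F0_image unfolding F1 .
      show "biextendable (Fs (Suc n))" using D.F1_biextendable unfolding F1 .
    qed (use retn v in \<open>auto simp: Good_def\<close>)
    obtain v' where v': "v' = (E.pL, E.pR) \<or> v' = (E.pL\<inverse>, E.pR\<inverse>)" "lt (fst v') a b"
      using ex_orient[OF E.lin_pL] by blast
    have "uniformly_recurrent (Fs (Suc n))" using D.F1_uniformly_recurrent v unfolding F1 Good_def by blast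
    moreover have "linear_order (fst v')" "linear_order (snd v')"
      using v'(1) E.lin_pL E.lin_pR linear_order_converse by auto
    moreover have "staircase (fst v') (snd v') (Fs (Suc n))"
      using v'(1) E.derived_staircase staircase_converse[OF E.derived_staircase] by auto
    ultimately have G: "Good (Suc n) v'"
      using v'(2) D.F1_biextendable D.F1_prelang E.full unfolding F1 Good_def by blast
    have graphs: "order_graph (fst v') = order_graph E.pL" "order_graph (snd v') = order_graph E.pR"
      using v'(1) order_graph_converse by auto
    have "planar_preserving (\<sigma> n) (fst v') (snd v') (fst v) (snd v) \<or>
      planar_preserving (\<sigma> n) ((fst v')\<inverse>) ((snd v')\<inverse>) (fst v) (snd v)"
      using v'(1) E.derived_planar_preserving by auto
    then have "gIET_edge S a b v (\<sigma> n) v'"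
      unfolding gIET_edge_def graphs
      using vertex[OF v] vertex[OF G] \<sigma>S E.derived_left_valid E.derived_right_valid E.derived_planar_morph by blast
    then show ?thesis using G D.F0_image unfolding F1 by blast
  qed
  \<comment> \<open>Dependent choice: the orders at each vertex are lexicographic over those at the
    previous one.\<close>
  obtain v where v: "\<And>n. Good n (v n)"
    "\<And>n. gIET_edge S a b (v n) (\<sigma> n) (v (Suc n)) \<and> Fs n = image_lang (\<sigma> n) (Fs (Suc n))"
    using dependent_nat_choice[of Good "\<lambda>n v v'. gIET_edge S a b v (\<sigma> n) v' \<and> Fs n = image_lang (\<sigma> n) (Fs (Suc n))"]
      base extend by blast
  interpret U: uniformly_recurrent_sequence \<sigma> Fs a b
  proof
    show "a \<noteq> b" by (rule ab)
    show "return_for (\<sigma> n) (ret_word (\<sigma> n))" for n by (rule retn)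
    show "biextendable (Fs n)" "uniformly_recurrent (Fs n)" "[c] \<in> Fs n" "Fs n \<subseteq> prelang \<sigma> n" for n c
      using v(1)[of n] unfolding Good_def by blast+
    show "Fs n = image_lang (\<sigma> n) (Fs (Suc n))" for n using v(2) by blast
  qed
  show ?thesis using U.primitive_directive v(2) unfolding labels_path_def by blast
qed

theorem mainTheorem2:
  fixes S :: "('a::finite \<Rightarrow> 'a list) set"
    and a b :: 'a
    and X :: "(int \<Rightarrow> 'a) set"
    and \<sigma> :: "nat \<Rightarrow> 'a \<Rightarrow> 'a list"
  assumes "\<forall>\<tau>\<in>S. dendric_return_morphism \<tau>"
    and "a \<noteq> b"
    and "shift_space X"
    and "\<forall>n. \<sigma> n \<in> S"
    and "X = S_adic_shift \<sigma>"
  shows "(coding_of_regular_IET X \<longleftrightarrow> primitive \<sigma> \<and> (\<exists>v. labels_path S a b \<sigma> v))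
    \<and> (\<forall>v. primitive \<sigma> \<and> labels_path S a b \<sigma> v \<longrightarrow>
           coding_of_regular_IET_for (snd (v 0)) (fst (v 0)) X)"
proof -
  have coding: "coding_of_regular_IET_for (snd (v 0)) (fst (v 0)) X"
    if "primitive \<sigma>" "labels_path S a b \<sigma> v" for v
    using path_coding[OF assms that] .
  moreover have "coding_of_regular_IET X" if p: "primitive \<sigma>" "labels_path S a b \<sigma> v" for v
  proof -
    have "gIET_vertex a b (v 0)" using p(2) unfolding labels_path_def gIET_edge_def by blast
    then have "linear_order (snd (v 0))" "linear_order (fst (v 0))" unfolding gIET_vertex_def by blast+
    then show ?thesis using coding[OF p] unfolding coding_of_regular_IET_def by blast
  qed
  ultimately show ?thesis using coding_path[OF assms(1,2,4,5)] by blast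
qed

end
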